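(* Let $G$ be a finite abelian group acting without inversion on a finite graph $Y$, let $H\le G$, let $V$ be an Artin representation of $H$ and $\mathrm{Ind}(V)=\mathbb{C}[G]\otimes_{\mathbb{C}[H]}V$ the induced representation of $G$. Then $c_{\mathrm{Ind}(V)}(u)=c_V(u)$ and $h_{\mathrm{Ind}(V)}(u)=h_V(u)$, so that also $L_{\mathrm{Ind}(V)}(u)=L_V(u)$, where the left-hand sides are formed with respect to the action of $G$ on $Y$ and the right-hand sides with respect to the restricted action of $H$ on $Y$.
   Context: Graphs in Serre's sense (vertices $V_Y$, directed edges $\mathbf{E}_Y$, maps $o,t$, fixed-point-free involution $\varepsilon\mapsto\bar\varepsilon$ with $o(\bar\varepsilon)=t(\varepsilon)$); $\mathrm{val}_Y(w)=|\{\varepsilon:o(\varepsilon)=w\}|$; without inversion: $\sigma\varepsilon\ne\bar\varepsilon$. For a finite abelian group $K$ acting without inversion: $C_0(Y)=\mathbb{C}V_Y$, $C_1(Y)=\mathbb{C}\mathbf{E}_Y/W$ ($W$ spanned by $\varepsilon+\bar\varepsilon$); $\chi_{\mathbb{C}[K]}(Y)=\mathrm{rank}_{\mathbb{C}[K]}C_0(Y)-\mathrm{rank}_{\mathbb{C}[K]}C_1(Y)$ (Hattori–Stallings ranks); $\gamma_Y(u)=\exp(-\chi_{\mathbb{C}[K]}(Y)\log(1-u^2))\in\mathbb{C}[K][[u]]$; $\eta_Y(u)=\det_{\mathbb{C}[K][u]}(\mathcal{I}-\mathcal{A}u+(\mathcal{D}-\mathcal{I})u^2)$ on $C_0(Y)[u]$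 with $\mathcal{D}(w)=\mathrm{val}_Y(w)w$, $\mathcal{A}(w)=\sum_{o(\varepsilon)=w}t(\varepsilon)$ (determinants of endomorphisms of finitely generated projective modules computed after adding the identity on a complement making the module free); $\theta_Y=(\gamma_Y\eta_Y)^{-1}$. For an Artin representation (finitely generated $\mathbb{C}[K]$-module) $V$, $\sigma_V:\mathbb{C}[K][[u]]\to\mathbb{C}[[u]]$ sends $\sum\lambda_iu^i$ to $\det_{\mathbb{C}[[u]]}$ of the endomorphism $\sum\rho_V(\lambda_i)u^i$ of $V[[u]]$ ($\rho_V$ the action on $V$), and $c_V=\sigma_V(\gamma_Y)$, $h_V=\sigma_V(\eta_Y)$, $L_V=\sigma_V(\theta_Y)$. *)

theory Defs
  imports
    "Jordan_Normal_Form.VS_Connect"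
    "HOL-Algebra.AbelCoset"
    "HOL-Algebra.Group_Action"
    "HOL-Library.Poly_Mapping"
    "HOL-Computational_Algebra.Group_Closure"
    "HOL-Computational_Algebra.Formal_Power_Series"
    "HOL-Computational_Algebra.Polynomial_FPS"
begin

hide_const (open) Multiset.mult Polynomial.smult Modules.module Modules.module_hom

section \<open>Rings and modules\<close>

text \<open>
  Rings are subrings \<open>R\<close> of a commutative ring type, with the operations of that type;
  modules over them are those of \<open>HOL-Algebra\<close>.
\<close>

abbreviation ring_on :: "'r::comm_ring_1 set \<Rightarrow> 'r ring" where
  "ring_on R \<equiv> class_ring\<lparr>carrier := R\<rparr>"

definition free_module :: "'r::comm_ring_1 set \<Rightarrow> nat \<Rightarrow> ('r, 'r vec) module" where
  "free_module R n =
     (module_vec TYPE('r) n)\<lparr>carrier := {v \<in> carrier_vec n. \<forall>i<n. vec_index v i \<in> R}\<rparr>"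

definition finitely_generated :: "'r::comm_ring_1 set \<Rightarrow> ('r, 'm) module \<Rightarrow> bool" where
  "finitely_generated R M \<longleftrightarrow>
     (\<exists>S. finite S \<and> S \<subseteq> carrier M \<and>
          LinearCombinations.module.span (ring_on R) M S = carrier M)"

definition quotient_module :: "('r, 'm) module \<Rightarrow> 'm set \<Rightarrow> ('r, 'm set) module" where
  "quotient_module M N =
     \<lparr>carrier = a_rcosets\<^bsub>M\<^esub> N, mult = undefined, one = undefined,
      zero = N, add = set_add M,
      smult = (\<lambda>r X. \<Union>x\<in>X. N +>\<^bsub>M\<^esub> (r \<odot>\<^bsub>M\<^esub> x))\<rparr>"

subsection \<open>Trace and determinant of endomorphisms of finitely generated projective modules\<close>

text \<open>
  \<open>\<theta>\<close> is an isomorphism from \<open>M \<oplus> Q\<close> onto \<open>R\<close>\<open>^n\<close>. In HOL the type of the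
  complement \<open>Q\<close> must be fixed; as \<open>Q\<close> embeds into \<open>R\<close>\<open>^n\<close>,
  modules of vectors over \<open>R\<close> suffice.
\<close>

definition free_completion ::
  "'r::comm_ring_1 set \<Rightarrow> ('r, 'm) module \<Rightarrow> ('r, 'r vec) module \<Rightarrow> nat \<Rightarrow>
     ('m \<times> 'r vec \<Rightarrow> 'r vec) \<Rightarrow> bool" where
  "free_completion R M Q n \<theta> \<longleftrightarrow>
     module (ring_on R) M \<and> module (ring_on R) Q \<and>
     \<theta> \<in> module_hom (ring_on R) (direct_sum M Q) (free_module R n) \<and>
     bij_betw \<theta> (carrier (direct_sum M Q)) (carrier (free_module R n))"

text \<open>\<open>A\<close> is the matrix of \<open>\<theta> \<circ> \<psi> \<circ> \<theta>\<close>\<open>^(-1)\<close> for an endomorphism \<open>\<psi>\<close> of \<open>M \<oplus> Q\<close>.\<close>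

definition matrix_of_endo ::
  "'r::comm_ring_1 set \<Rightarrow> ('r, 'm) module \<Rightarrow> ('r, 'r vec) module \<Rightarrow> nat \<Rightarrow>
     ('m \<times> 'r vec \<Rightarrow> 'r vec) \<Rightarrow> ('m \<times> 'r vec \<Rightarrow> 'm \<times> 'r vec) \<Rightarrow> 'r mat \<Rightarrow> bool" where
  "matrix_of_endo R M Q n \<theta> \<psi> A \<longleftrightarrow>
     A \<in> carrier_mat n n \<and> elements_mat A \<subseteq> R \<and>
     (\<forall>z \<in> carrier (direct_sum M Q). \<theta> (\<psi> z) = A *\<^sub>v \<theta> z)"

definition proj_det :: "'r::comm_ring_1 set \<Rightarrow> ('r, 'm) module \<Rightarrow> ('m \<Rightarrow> 'm) \<Rightarrow> 'r" where
  "proj_det R M \<phi> =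
     (THE d. \<exists>Q n \<theta> A. free_completion R M Q n \<theta> \<and>
        matrix_of_endo R M Q n \<theta> (\<lambda>(x, q). (\<phi> x, q)) A \<and> d = det A)"

definition proj_trace :: "'r::comm_ring_1 set \<Rightarrow> ('r, 'm) module \<Rightarrow> ('m \<Rightarrow> 'm) \<Rightarrow> 'r" where
  "proj_trace R M \<phi> =
     (THE d. \<exists>Q n \<theta> A. free_completion R M Q n \<theta> \<and>
        matrix_of_endo R M Q n \<theta> (\<lambda>(x, q). (\<phi> x, \<zero>\<^bsub>Q\<^esub>)) A \<and> d = (\<Sum>i<n. A $$ (i, i)))"

text \<open>
  The Hattori--Stallings rank is the trace of the identity. It lives in \<open>R / [R, R]\<close>, which is
  \<open>R\<close> here.
\<close>

definition hs_rank :: "'r::comm_ring_1 set \<Rightarrow> ('r, 'm) module \<Rightarrow> 'r" where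
  "hs_rank R M = proj_trace R M (\<lambda>x. x)"

subsection \<open>Extension of scalars\<close>

text \<open>
  \<open>S \<otimes>\<^sub>R M\<close> for a subring \<open>R\<close> of \<open>S\<close>: the free abelian group on \<open>S \<times> M\<close> modulo the
  bilinearity and balancing relations, with \<open>S\<close> acting on the left factor. The scalar
  multiplication on the free group is not additive in \<open>S\<close>; it becomes so on the quotient.
\<close>

definition tensor_generators ::
  "'r::comm_ring_1 set \<Rightarrow> ('r, 'm) module \<Rightarrow> ('r, ('r \<times> 'm) \<Rightarrow>\<^sub>0 int) module" where
  "tensor_generators S M =
     \<lparr>carrier = {c. Poly_Mapping.keys c \<subseteq> S \<times> carrier M},
      mult = undefined, one = undefined, zero = 0, add = (+),
      smult = (\<lambda>r c. \<Sum>(s, x)\<in>Poly_Mapping.keys c.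
                 Poly_Mapping.single (r * s, x) (Poly_Mapping.lookup c (s, x)))\<rparr>"

definition tensor_relations ::
  "'r::comm_ring_1 set \<Rightarrow> 'r set \<Rightarrow> ('r, 'm) module \<Rightarrow> (('r \<times> 'm) \<Rightarrow>\<^sub>0 int) set" where
  "tensor_relations S R M =
     (let g = (\<lambda>s x. Poly_Mapping.single (s, x) 1) in
      {g (s + s') x - g s x - g s' x | s s' x. s \<in> S \<and> s' \<in> S \<and> x \<in> carrier M} \<union>
      {g s (x \<oplus>\<^bsub>M\<^esub> x') - g s x - g s x' | s x x'. s \<in> S \<and> x \<in> carrier M \<and> x' \<in> carrier M} \<union>
      {g (s * r) x - g s (r \<odot>\<^bsub>M\<^esub> x) | s r x. s \<in> S \<and> r \<in> R \<and> x \<in> carrier M})"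

definition extend_scalars ::
  "'r::comm_ring_1 set \<Rightarrow> 'r set \<Rightarrow> ('r, 'm) module \<Rightarrow>
     ('r, (('r \<times> 'm) \<Rightarrow>\<^sub>0 int) set) module" where
  "extend_scalars S R M =
     quotient_module (tensor_generators S M) (group_closure (tensor_relations S R M))"

subsection \<open>Polynomials and power series with coefficients in a module\<close>

text \<open>
  An element \<open>\<Sum> x\<^sub>i u\<close>\<open>^i\<close> of \<open>M[u]\<close> or \<open>M[[u]]\<close> is the sequence of its coefficients.
  \<open>series_endo M \<Phi>\<close> is the map \<open>\<Sum> \<Phi>\<^sub>i u\<close>\<open>^i\<close> on such elements, for maps \<open>\<Phi>\<^sub>i\<close> on \<open>M\<close>.
\<close>

definition series_endo ::
  "('r, 'm) module \<Rightarrow> (nat \<Rightarrow> 'm \<Rightarrow> 'm) \<Rightarrow> (nat \<Rightarrow> 'm) \<Rightarrow> (nat \<Rightarrow> 'm)" where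
  "series_endo M \<Phi> f = (\<lambda>n. \<Oplus>\<^bsub>M\<^esub> i\<in>{..n}. \<Phi> i (f (n - i)))"

definition poly_module :: "('r::comm_ring_1, 'm) module \<Rightarrow> ('r poly, nat \<Rightarrow> 'm) module" where
  "poly_module M =
     \<lparr>carrier = {f. (\<forall>n. f n \<in> carrier M) \<and> finite {n. f n \<noteq> \<zero>\<^bsub>M\<^esub>}},
      mult = undefined, one = undefined,
      zero = (\<lambda>_. \<zero>\<^bsub>M\<^esub>), add = (\<lambda>f g n. f n \<oplus>\<^bsub>M\<^esub> g n),
      smult = (\<lambda>p. series_endo M (\<lambda>i x. Polynomial.coeff p i \<odot>\<^bsub>M\<^esub> x))\<rparr>"

section \<open>Group algebras of finite abelian groups\<close>

definition additive_group :: "'g::ab_group_add set \<Rightarrow> 'g monoid" where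
  "additive_group K = \<lparr>carrier = K, mult = (+), one = 0\<rparr>"

text \<open>
  With the convolution product of \<open>HOL-Library.Poly_Mapping\<close>, the type \<open>'g \<Rightarrow>\<^sub>0 complex\<close> is the
  complex group algebra of the additive group \<open>'g\<close>; \<open>group_alg K\<close> is the group algebra of \<open>K\<close>.
\<close>

definition group_alg :: "'g::ab_group_add set \<Rightarrow> ('g \<Rightarrow>\<^sub>0 complex) set" where
  "group_alg K = {a. Poly_Mapping.keys a \<subseteq> K}"

definition group_alg_poly :: "'g::ab_group_add set \<Rightarrow> ('g \<Rightarrow>\<^sub>0 complex) poly set" where
  "group_alg_poly K = {p. \<forall>i. Polynomial.coeff p i \<in> group_alg K}"

definition group_alg_fps :: "'g::ab_group_add set \<Rightarrow> ('g \<Rightarrow>\<^sub>0 complex) fps set" where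
  "group_alg_fps K = {F. \<forall>i. fps_nth F i \<in> group_alg K}"

abbreviation scalar :: "complex \<Rightarrow> ('g::ab_group_add \<Rightarrow>\<^sub>0 complex)" where
  "scalar z \<equiv> Poly_Mapping.single 0 z"

definition scalar_fps :: "complex fps \<Rightarrow> ('g::ab_group_add \<Rightarrow>\<^sub>0 complex) fps" where
  "scalar_fps F = Abs_fps (\<lambda>i. scalar (fps_nth F i))"

definition artin_rep ::
  "'g::ab_group_add set \<Rightarrow> ('g \<Rightarrow>\<^sub>0 complex, 'm) module \<Rightarrow> bool" where
  "artin_rep K V \<longleftrightarrow>
     module (ring_on (group_alg K)) V \<and> finitely_generated (group_alg K) V"

definition induced_rep ::
  "'g::ab_group_add set \<Rightarrow> 'g set \<Rightarrow> ('g \<Rightarrow>\<^sub>0 complex, 'm) module \<Rightarrow>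
     ('g \<Rightarrow>\<^sub>0 complex, ((('g \<Rightarrow>\<^sub>0 complex) \<times> 'm) \<Rightarrow>\<^sub>0 int) set) module" where
  "induced_rep G H V = extend_scalars (group_alg G) (group_alg H) V"

definition fps_module ::
  "('g::ab_group_add \<Rightarrow>\<^sub>0 complex, 'm) module \<Rightarrow> (complex fps, nat \<Rightarrow> 'm) module" where
  "fps_module V =
     \<lparr>carrier = {f. \<forall>n. f n \<in> carrier V}, mult = undefined, one = undefined,
      zero = (\<lambda>_. \<zero>\<^bsub>V\<^esub>), add = (\<lambda>f g n. f n \<oplus>\<^bsub>V\<^esub> g n),
      smult = (\<lambda>c. series_endo V (\<lambda>i x. scalar (fps_nth c i) \<odot>\<^bsub>V\<^esub> x))\<rparr>"

definition sigma_rep ::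
  "('g::ab_group_add \<Rightarrow>\<^sub>0 complex, 'm) module \<Rightarrow> ('g \<Rightarrow>\<^sub>0 complex) fps \<Rightarrow> complex fps" where
  "sigma_rep V \<Lambda> =
     proj_det UNIV (fps_module V) (series_endo V (\<lambda>i x. fps_nth \<Lambda> i \<odot>\<^bsub>V\<^esub> x))"

definition perm_module ::
  "'x set \<Rightarrow> ('g::ab_group_add \<Rightarrow> 'x \<Rightarrow> 'x) \<Rightarrow> ('g \<Rightarrow>\<^sub>0 complex, 'x \<Rightarrow>\<^sub>0 complex) module" where
  "perm_module X \<sigma> =
     \<lparr>carrier = {c. Poly_Mapping.keys c \<subseteq> X}, mult = undefined, one = undefined,
      zero = 0, add = (+),
      smult = (\<lambda>a c. \<Sum>k\<in>Poly_Mapping.keys a. \<Sum>x\<in>Poly_Mapping.keys c.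
                 Poly_Mapping.single (\<sigma> k x) (Poly_Mapping.lookup a k * Poly_Mapping.lookup c x))\<rparr>"

section \<open>Graphs in the sense of Serre\<close>

record ('v, 'e) serre_graph =
  verts :: "'v set"
  edges :: "'e set"
  org :: "'e \<Rightarrow> 'v"
  ter :: "'e \<Rightarrow> 'v"
  opp :: "'e \<Rightarrow> 'e"

locale finite_serre_graph =
  fixes Y :: "('v, 'e) serre_graph"
  assumes finite_verts: "finite (verts Y)"
    and finite_edges: "finite (edges Y)"
    and org_closed: "e \<in> edges Y \<Longrightarrow> org Y e \<in> verts Y"
    and ter_closed: "e \<in> edges Y \<Longrightarrow> ter Y e \<in> verts Y"
    and opp_closed: "e \<in> edges Y \<Longrightarrow> opp Y e \<in> edges Y"
    and opp_opp: "e \<in> edges Y \<Longrightarrow> opp Y (opp Y e) = e"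
    and opp_neq: "e \<in> edges Y \<Longrightarrow> opp Y e \<noteq> e"
    and org_opp: "e \<in> edges Y \<Longrightarrow> org Y (opp Y e) = ter Y e"

definition valency :: "('v, 'e) serre_graph \<Rightarrow> 'v \<Rightarrow> nat" where
  "valency Y w = card {e \<in> edges Y. org Y e = w}"

locale action_without_inversion = finite_serre_graph Y
  for Y :: "('v, 'e) serre_graph" +
  fixes K :: "'g::ab_group_add set"
    and \<sigma>V :: "'g \<Rightarrow> 'v \<Rightarrow> 'v" and \<sigma>E :: "'g \<Rightarrow> 'e \<Rightarrow> 'e"
  assumes action_verts: "group_action (additive_group K) (verts Y) \<sigma>V"
    and action_edges: "group_action (additive_group K) (edges Y) \<sigma>E"
    and org_equivariant: "k \<in> K \<Longrightarrow> e \<in> edges Y \<Longrightarrow> org Y (\<sigma>E k e) = \<sigma>V k (org Y e)"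
    and ter_equivariant: "k \<in> K \<Longrightarrow> e \<in> edges Y \<Longrightarrow> ter Y (\<sigma>E k e) = \<sigma>V k (ter Y e)"
    and opp_equivariant: "k \<in> K \<Longrightarrow> e \<in> edges Y \<Longrightarrow> opp Y (\<sigma>E k e) = \<sigma>E k (opp Y e)"
    and no_inversion: "k \<in> K \<Longrightarrow> e \<in> edges Y \<Longrightarrow> \<sigma>E k e \<noteq> opp Y e"

definition chains0 ::
  "('v, 'e) serre_graph \<Rightarrow> ('g::ab_group_add \<Rightarrow> 'v \<Rightarrow> 'v) \<Rightarrow>
     ('g \<Rightarrow>\<^sub>0 complex, 'v \<Rightarrow>\<^sub>0 complex) module" where
  "chains0 Y \<sigma>V = perm_module (verts Y) \<sigma>V"

definition orientation_relations :: "('v, 'e) serre_graph \<Rightarrow> ('e \<Rightarrow>\<^sub>0 complex) set" where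
  "orientation_relations Y =
     {\<Sum>e\<in>edges Y. Poly_Mapping.single e (z e) + Poly_Mapping.single (opp Y e) (z e) | z. True}"

definition chains1 ::
  "('v, 'e) serre_graph \<Rightarrow> ('g::ab_group_add \<Rightarrow> 'e \<Rightarrow> 'e) \<Rightarrow>
     ('g \<Rightarrow>\<^sub>0 complex, ('e \<Rightarrow>\<^sub>0 complex) set) module" where
  "chains1 Y \<sigma>E = quotient_module (perm_module (edges Y) \<sigma>E) (orientation_relations Y)"

definition adjacency_op ::
  "('v, 'e) serre_graph \<Rightarrow> ('v \<Rightarrow>\<^sub>0 complex) \<Rightarrow> ('v \<Rightarrow>\<^sub>0 complex)" where
  "adjacency_op Y c =
     (\<Sum>w\<in>Poly_Mapping.keys c. \<Sum>e\<in>{e \<in> edges Y. org Y e = w}.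
        Poly_Mapping.single (ter Y e) (Poly_Mapping.lookup c w))"

definition valency_op ::
  "('v, 'e) serre_graph \<Rightarrow> ('v \<Rightarrow>\<^sub>0 complex) \<Rightarrow> ('v \<Rightarrow>\<^sub>0 complex)" where
  "valency_op Y c =
     (\<Sum>w\<in>Poly_Mapping.keys c.
        Poly_Mapping.single w (of_nat (valency Y w) * Poly_Mapping.lookup c w))"

text \<open>The coefficients of \<open>I - A u + (D - I) u\<^sup>2\<close>.\<close>

definition ihara_coeff ::
  "('v, 'e) serre_graph \<Rightarrow> nat \<Rightarrow> ('v \<Rightarrow>\<^sub>0 complex) \<Rightarrow> ('v \<Rightarrow>\<^sub>0 complex)" where
  "ihara_coeff Y i c =
     (if i = 0 then c
      else if i = 1 then - adjacency_op Y c
      else if i = 2 then valency_op Y c - c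
      else 0)"

section \<open>Equivariant Ihara functions and Artin--Ihara L-functions\<close>

definition equiv_euler_char ::
  "'g::ab_group_add set \<Rightarrow> ('v, 'e) serre_graph \<Rightarrow> ('g \<Rightarrow> 'v \<Rightarrow> 'v) \<Rightarrow> ('g \<Rightarrow> 'e \<Rightarrow> 'e) \<Rightarrow>
     ('g \<Rightarrow>\<^sub>0 complex)" where
  "equiv_euler_char K Y \<sigma>V \<sigma>E =
     hs_rank (group_alg K) (chains0 Y \<sigma>V) - hs_rank (group_alg K) (chains1 Y \<sigma>E)"

text \<open>
  The library's \<open>fps_exp 1\<close> and \<open>fps_ln 1\<close>, the series of \<open>exp u\<close> and \<open>log (1 + u)\<close>, are available
  over fields only, hence the passage through \<open>scalar_fps\<close>.
\<close>

definition equiv_gamma ::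
  "'g::ab_group_add set \<Rightarrow> ('v, 'e) serre_graph \<Rightarrow> ('g \<Rightarrow> 'v \<Rightarrow> 'v) \<Rightarrow> ('g \<Rightarrow> 'e \<Rightarrow> 'e) \<Rightarrow>
     ('g \<Rightarrow>\<^sub>0 complex) fps" where
  "equiv_gamma K Y \<sigma>V \<sigma>E =
     fps_compose (scalar_fps (fps_exp 1))
       (- fps_const (equiv_euler_char K Y \<sigma>V \<sigma>E) *
          scalar_fps (fps_compose (fps_ln 1) (- (fps_X ^ 2))))"

definition equiv_eta ::
  "'g::ab_group_add set \<Rightarrow> ('v, 'e) serre_graph \<Rightarrow> ('g \<Rightarrow> 'v \<Rightarrow> 'v) \<Rightarrow>
     ('g \<Rightarrow>\<^sub>0 complex) poly" where
  "equiv_eta K Y \<sigma>V =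
     proj_det (group_alg_poly K) (poly_module (chains0 Y \<sigma>V))
       (series_endo (chains0 Y \<sigma>V) (ihara_coeff Y))"

definition equiv_theta ::
  "'g::ab_group_add set \<Rightarrow> ('v, 'e) serre_graph \<Rightarrow> ('g \<Rightarrow> 'v \<Rightarrow> 'v) \<Rightarrow> ('g \<Rightarrow> 'e \<Rightarrow> 'e) \<Rightarrow>
     ('g \<Rightarrow>\<^sub>0 complex) fps" where
  "equiv_theta K Y \<sigma>V \<sigma>E =
     inv\<^bsub>ring_on (group_alg_fps K)\<^esub>
       (equiv_gamma K Y \<sigma>V \<sigma>E * fps_of_poly (equiv_eta K Y \<sigma>V))"

definition c_fun ::
  "'g::ab_group_add set \<Rightarrow> ('v, 'e) serre_graph \<Rightarrow> ('g \<Rightarrow> 'v \<Rightarrow> 'v) \<Rightarrow> ('g \<Rightarrow> 'e \<Rightarrow> 'e) \<Rightarrow>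
     ('g \<Rightarrow>\<^sub>0 complex, 'm) module \<Rightarrow> complex fps" where
  "c_fun K Y \<sigma>V \<sigma>E V = sigma_rep V (equiv_gamma K Y \<sigma>V \<sigma>E)"

definition h_fun ::
  "'g::ab_group_add set \<Rightarrow> ('v, 'e) serre_graph \<Rightarrow> ('g \<Rightarrow> 'v \<Rightarrow> 'v) \<Rightarrow>
     ('g \<Rightarrow>\<^sub>0 complex, 'm) module \<Rightarrow> complex fps" where
  "h_fun K Y \<sigma>V V = sigma_rep V (fps_of_poly (equiv_eta K Y \<sigma>V))"

definition L_fun ::
  "'g::ab_group_add set \<Rightarrow> ('v, 'e) serre_graph \<Rightarrow> ('g \<Rightarrow> 'v \<Rightarrow> 'v) \<Rightarrow> ('g \<Rightarrow> 'e \<Rightarrow> 'e) \<Rightarrow>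
     ('g \<Rightarrow>\<^sub>0 complex, 'm) module \<Rightarrow> complex fps" where
  "L_fun K Y \<sigma>V \<sigma>E V = sigma_rep V (equiv_theta K Y \<sigma>V \<sigma>E)"

end

theory Submission
  imports Defs "HOL-Library.Countable_Set"
begin

text \<open>
  Characters of the finite abelian groups diagonalise everything. A representation of \<open>K\<close> has a basis
  of simultaneous eigenvectors, so \<open>\<sigma>\<^sub>V(\<Lambda>)\<close> is the product of the values \<open>\<chi>\<^sub>j(\<Lambda>)\<close> at their
  characters, and inducing from \<open>H\<close> to \<open>G\<close> replaces each \<open>\<chi>\<^sub>j\<close> by all its extensions to \<open>G\<close>. It
  therefore suffices that for each character \<open>\<chi>\<close> of \<open>H\<close> the product of \<open>\<psi>(\<gamma>\<^sub>G)\<close>, and of \<open>\<psi>(\<eta>\<^sub>G)\<close>,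
  over the extensions \<open>\<psi>\<close> of \<open>\<chi>\<close> is \<open>\<chi>(\<gamma>\<^sub>H)\<close>, respectively \<open>\<chi>(\<eta>\<^sub>H)\<close>. The chain modules are images
  of explicit idempotent matrices over \<open>\<complex>[K]\<close>. Hence the Euler characteristic at \<open>\<psi>\<close> is the average
  over \<open>K\<close> of \<open>\<psi>\<close> times a Lefschetz number that does not depend on \<open>K\<close>, while \<open>\<psi>(\<eta>\<^sub>K)\<close> is
  \<open>det (1 + N P\<^sub>\<psi>)\<close>, where \<open>1 + N\<close> is the matrix of \<open>I - A u + (D - I) u\<^sup>2\<close> and \<open>P\<^sub>\<psi>\<close>, the isotypic
  projection, commutes with \<open>N\<close>. The projections of the extensions of \<open>\<chi>\<close> are orthogonal and add up
  to \<open>P\<^sub>\<chi>\<close>, so that \<open>1 + N P\<^sub>\<chi>\<close> is the product of the \<open>1 + N P\<^sub>\<psi>\<close>.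
\<close>

abbreviation lookup :: "('a \<Rightarrow>\<^sub>0 'b::zero) \<Rightarrow> 'a \<Rightarrow> 'b" where
  "lookup \<equiv> Poly_Mapping.lookup"

abbreviation single :: "'a \<Rightarrow> 'b::zero \<Rightarrow> 'a \<Rightarrow>\<^sub>0 'b" where
  "single \<equiv> Poly_Mapping.single"

abbreviation keys :: "('a \<Rightarrow>\<^sub>0 'b::zero) \<Rightarrow> 'a set" where
  "keys \<equiv> Poly_Mapping.keys"

section \<open>Subrings\<close>

locale comm_subring =
  fixes R :: "'r::comm_ring_1 set"
  assumes zero_mem [simp, intro]: "0 \<in> R" and one_mem [simp, intro]: "1 \<in> R"
    and add_mem [intro]: "a \<in> R \<Longrightarrow> b \<in> R \<Longrightarrow> a + b \<in> R"
    and mult_mem [intro]: "a \<in> R \<Longrightarrow> b \<in> R \<Longrightarrow> a * b \<in> R"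
    and uminus_mem [intro]: "a \<in> R \<Longrightarrow> - a \<in> R"
begin

lemma diff_mem [intro]: "a \<in> R \<Longrightarrow> b \<in> R \<Longrightarrow> a - b \<in> R"
  using add_mem[of a "- b"] by auto

lemma sum_mem [intro]: "(\<And>i. i \<in> I \<Longrightarrow> f i \<in> R) \<Longrightarrow> sum f I \<in> R"
  by (induction I rule: infinite_finite_induct) auto

lemma prod_mem [intro]: "(\<And>i. i \<in> I \<Longrightarrow> f i \<in> R) \<Longrightarrow> prod f I \<in> R"
  by (induction I rule: infinite_finite_induct) auto

lemma power_mem [intro]: "a \<in> R \<Longrightarrow> a ^ n \<in> R"
  by (induction n) auto

lemma cring_ring_on: "cring (ring_on R)"
proof (rule cringI)
  show "abelian_group (ring_on R)"
  proof (rule abelian_groupI)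
    show "\<exists>y\<in>carrier (ring_on R). y \<oplus>\<^bsub>ring_on R\<^esub> x = \<zero>\<^bsub>ring_on R\<^esub>"
      if "x \<in> carrier (ring_on R)" for x
      using that by (intro bexI[of _ "- x"]) auto
  qed (auto simp: algebra_simps)
  show "comm_monoid (ring_on R)"
    by (rule comm_monoidI) (auto simp: algebra_simps)
qed (auto simp: algebra_simps)

lemma inv_ring_on_eqI:
  assumes "a \<in> R" and "b \<in> R" and "a * b = 1"
  shows "inv\<^bsub>ring_on R\<^esub> a = b"
proof -
  interpret cring "ring_on R" by (rule cring_ring_on)
  show ?thesis using assms by (intro comm_inv_char) auto
qed

end

lemma comm_subring_if_cring_ring_on:
  assumes "cring (ring_on R)"
  shows "comm_subring R"
proof -
  interpret cring "ring_on R" by fact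
  show ?thesis
  proof
    show "- a \<in> R" if "a \<in> R" for a
    proof -
      have "\<exists>y\<in>R. a + y = 0"
        using a_inv_closed[of a] r_neg[of a] that by auto
      then show ?thesis by (metis add_eq_0_iff)
    qed
  qed (use a_closed m_closed zero_closed one_closed in auto)
qed

lemma comm_subring_UNIV: "comm_subring UNIV"
  by unfold_locales auto

definition polys_over :: "'r::comm_ring_1 set \<Rightarrow> 'r poly set" where
  "polys_over R = {p. \<forall>i. coeff p i \<in> R}"

definition fps_over :: "'r::comm_ring_1 set \<Rightarrow> 'r fps set" where
  "fps_over R = {F. \<forall>i. fps_nth F i \<in> R}"

context comm_subring
begin

lemma comm_subring_polys_over: "comm_subring (polys_over R)"
proof
  show "1 \<in> polys_over R" by (auto simp: polys_over_def coeff_1)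
qed (auto simp: polys_over_def coeff_mult)

lemma comm_subring_fps_over: "comm_subring (fps_over R)"
proof
  show "1 \<in> fps_over R" by (auto simp: fps_over_def)
qed (auto simp: fps_over_def fps_mult_nth)

lemma const_poly_mem_polys_over: "a \<in> R \<Longrightarrow> [:a:] \<in> polys_over R"
  by (auto simp: polys_over_def coeff_pCons split: nat.splits)

lemma fps_const_mem_fps_over: "a \<in> R \<Longrightarrow> fps_const a \<in> fps_over R"
  by (auto simp: fps_over_def)

lemma fps_compose_mem_fps_over:
  assumes "F \<in> fps_over R" and "G \<in> fps_over R"
  shows "fps_compose F G \<in> fps_over R"
proof -
  interpret S: comm_subring "fps_over R" by (rule comm_subring_fps_over)
  show ?thesis
    using assms S.power_mem[OF assms(2)]
    by (auto simp: fps_over_def fps_compose_nth intro!: sum_mem mult_mem)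
qed

lemma fps_right_inverse_mem_fps_over:
  assumes "F \<in> fps_over R" and "b \<in> R"
  shows "fps_right_inverse F b \<in> fps_over R"
proof -
  have "fps_right_inverse_constructor F b n \<in> R" for n
  proof (induction n rule: less_induct)
    case (less n)
    show ?case
    proof (cases "n = 0")
      case False
      then show ?thesis
        using less assms
        by (subst fps_right_inverse_constructor_rec)
          (auto simp: fps_over_def intro!: mult_mem sum_mem uminus_mem)
    qed (use assms(2) in auto)
  qed
  then show ?thesis by (simp add: fps_over_def)
qed

lemma inv_ring_on_fps_over:
  assumes F: "F \<in> fps_over R" and F_0: "fps_nth F 0 = 1"
  shows "inv\<^bsub>ring_on (fps_over R)\<^esub> F \<in> fps_over R"
    and "F * inv\<^bsub>ring_on (fps_over R)\<^esub> F = 1"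
proof -
  have mem: "fps_right_inverse F 1 \<in> fps_over R"
    using F by (rule fps_right_inverse_mem_fps_over) simp
  moreover have prod: "F * fps_right_inverse F 1 = 1"
    by (rule fps_right_inverse) (simp add: F_0)
  ultimately have "inv\<^bsub>ring_on (fps_over R)\<^esub> F = fps_right_inverse F 1"
    by (intro comm_subring.inv_ring_on_eqI comm_subring_fps_over F)
  with mem prod show "inv\<^bsub>ring_on (fps_over R)\<^esub> F \<in> fps_over R"
    and "F * inv\<^bsub>ring_on (fps_over R)\<^esub> F = 1" by simp_all
qed

end

section \<open>Determinants\<close>

lemma det_last_rows_identity:
  fixes A :: "'a::comm_ring_1 mat"
  assumes "A \<in> carrier_mat (n + m) (n + m)"
    and "\<And>i j. n \<le> i \<Longrightarrow> i < n + m \<Longrightarrow> j < n + m \<Longrightarrow> A $$ (i, j) = (if i = j then 1 else 0)"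
  shows "det A = det (mat n n (\<lambda>ij. A $$ ij))"
  using assms
proof (induction m arbitrary: A)
  case 0
  then have "A = mat n n (\<lambda>ij. A $$ ij)" by (intro eq_matI) auto
  then show ?case by simp
next
  case (Suc m)
  let ?k = "n + m"
  have A: "A \<in> carrier_mat (Suc ?k) (Suc ?k)" using Suc.prems(1) by simp
  have "det A = (\<Sum>j<Suc ?k. A $$ (?k, j) * cofactor A ?k j)"
    by (rule laplace_expansion_row[OF A]) simp
  also have "\<dots> = (\<Sum>j<Suc ?k. if j = ?k then cofactor A ?k ?k else 0)"
    using Suc.prems(2)[of ?k] by (intro sum.cong) auto
  also have "\<dots> = det (mat_delete A ?k ?k)" by (simp add: cofactor_def)
  also have "\<dots> = det (mat n n (\<lambda>ij. mat_delete A ?k ?k $$ ij))"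
    using A Suc.prems(2) by (intro Suc.IH) (auto simp: mat_delete_def)
  also have "mat n n (\<lambda>ij. mat_delete A ?k ?k $$ ij) = mat n n (\<lambda>ij. A $$ ij)"
    using A by (intro eq_matI) (auto simp: mat_delete_def)
  finally show ?case .
qed

lemma det_first_columns_identity:
  fixes A :: "'a::comm_ring_1 mat"
  assumes "A \<in> carrier_mat (n + m) (n + m)"
    and "\<And>i j. j < n \<Longrightarrow> i < n + m \<Longrightarrow> A $$ (i, j) = (if i = j then 1 else 0)"
  shows "det A = det (mat m m (\<lambda>(i, j). A $$ (n + i, n + j)))"
  using assms
proof (induction n arbitrary: A)
  case 0
  then have "A = mat m m (\<lambda>(i, j). A $$ (0 + i, 0 + j))" by (intro eq_matI) auto
  then show ?case by simp
next
  case (Suc n)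
  have A: "A \<in> carrier_mat (Suc (n + m)) (Suc (n + m))" using Suc.prems(1) by simp
  have "det A = (\<Sum>i<Suc (n + m). A $$ (i, 0) * cofactor A i 0)"
    by (rule laplace_expansion_column[OF A]) simp
  also have "\<dots> = (\<Sum>i<Suc (n + m). if i = 0 then cofactor A 0 0 else 0)"
    using Suc.prems(2)[of 0] by (intro sum.cong) auto
  also have "\<dots> = det (mat_delete A 0 0)" by (simp add: cofactor_def)
  also have "\<dots> = det (mat m m (\<lambda>(i, j). mat_delete A 0 0 $$ (n + i, n + j)))"
    using A Suc.prems(2) by (intro Suc.IH) (auto simp: mat_delete_def)
  also have "mat m m (\<lambda>(i, j). mat_delete A 0 0 $$ (n + i, n + j)) =
      mat m m (\<lambda>(i, j). A $$ (Suc n + i, Suc n + j))"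
    using A by (intro eq_matI) (auto simp: mat_delete_def)
  finally show ?case .
qed

lemma det_one_plus_mult_commute:
  fixes P S :: "'a::comm_ring_1 mat"
  assumes P: "P \<in> carrier_mat n m" and S: "S \<in> carrier_mat m n"
  shows "det (1\<^sub>m n + P * S) = det (1\<^sub>m m + S * P)"
proof -
  define M where "M = four_block_mat (1\<^sub>m n) P (- S) (1\<^sub>m m)"
  define L where "L = four_block_mat (1\<^sub>m n) (0\<^sub>m n m) S (1\<^sub>m m)"
  have M: "M \<in> carrier_mat (n + m) (n + m)" and L: "L \<in> carrier_mat (n + m) (n + m)"
    using P S by (auto simp: M_def L_def)
  have "M * L = four_block_mat (1\<^sub>m n * 1\<^sub>m n + P * S) (1\<^sub>m n * 0\<^sub>m n m + P * 1\<^sub>m m)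
      (- S * 1\<^sub>m n + 1\<^sub>m m * S) (- S * 0\<^sub>m n m + 1\<^sub>m m * 1\<^sub>m m)"
    unfolding M_def L_def using P S by (intro mult_four_block_mat) auto
  also have "\<dots> = four_block_mat (1\<^sub>m n + P * S) P (0\<^sub>m m n) (1\<^sub>m m)"
    using P S by (intro cong_four_block_mat) (auto simp: uminus_l_inv_mat)
  finally have prod_ML: "M * L = \<dots>" .
  have "L * M = four_block_mat (1\<^sub>m n * 1\<^sub>m n + 0\<^sub>m n m * (- S)) (1\<^sub>m n * P + 0\<^sub>m n m * 1\<^sub>m m)
      (S * 1\<^sub>m n + 1\<^sub>m m * (- S)) (S * P + 1\<^sub>m m * 1\<^sub>m m)"
    unfolding M_def L_def using P S by (intro mult_four_block_mat) auto
  also have "\<dots> = four_block_mat (1\<^sub>m n) P (0\<^sub>m m n) (1\<^sub>m m + S * P)"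
    using P S by (intro cong_four_block_mat) (auto simp: comm_add_mat[of "S * P" m m])
  finally have prod_LM: "L * M = \<dots>" .
  have "det (1\<^sub>m n + P * S) = det (mat n n (\<lambda>ij. (M * L) $$ ij))"
    unfolding prod_ML using P S by (intro arg_cong[of _ _ det] eq_matI) auto
  also have "\<dots> = det (M * L)"
    unfolding prod_ML using P S by (intro det_last_rows_identity[where m = m, symmetric]) auto
  also have "\<dots> = det (L * M)"
    using M L by (simp add: det_mult mult.commute)
  also have "\<dots> = det (mat m m (\<lambda>(i, j). (L * M) $$ (n + i, n + j)))"
    unfolding prod_LM using P S by (intro det_first_columns_identity) auto
  also have "\<dots> = det (1\<^sub>m m + S * P)"
    unfolding prod_LM using P S by (intro arg_cong[of _ _ det] eq_matI) auto
  finally show ?thesis .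
qed

lemma trace_mult_commute:
  fixes P S :: "'a::comm_ring_1 mat"
  assumes "P \<in> carrier_mat n m" and "S \<in> carrier_mat m n"
  shows "(\<Sum>i<n. (P * S) $$ (i, i)) = (\<Sum>j<m. (S * P) $$ (j, j))"
proof -
  have "(\<Sum>i<n. (P * S) $$ (i, i)) = (\<Sum>i<n. \<Sum>j<m. P $$ (i, j) * S $$ (j, i))"
    using assms by (intro sum.cong) (auto simp: scalar_prod_def atLeast0LessThan)
  also have "\<dots> = (\<Sum>j<m. \<Sum>i<n. S $$ (j, i) * P $$ (i, j))"
    by (subst sum.swap) (simp add: mult.commute)
  also have "\<dots> = (\<Sum>j<m. (S * P) $$ (j, j))"
    using assms by (intro sum.cong) (auto simp: scalar_prod_def atLeast0LessThan)
  finally show ?thesis .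
qed

subsection \<open>Entries in a subring\<close>

definition vecs_over :: "'r::comm_ring_1 set \<Rightarrow> nat \<Rightarrow> 'r vec set" where
  "vecs_over R n = {v \<in> carrier_vec n. \<forall>i<n. v $ i \<in> R}"

definition mats_over :: "'r::comm_ring_1 set \<Rightarrow> nat \<Rightarrow> nat \<Rightarrow> 'r mat set" where
  "mats_over R n m = {A \<in> carrier_mat n m. \<forall>i<n. \<forall>j<m. A $$ (i, j) \<in> R}"

lemma mats_over_iff_elements_mat:
  "A \<in> mats_over R n m \<longleftrightarrow> A \<in> carrier_mat n m \<and> elements_mat A \<subseteq> R"
  by (fastforce simp: mats_over_def elements_mat_def subset_iff)

lemma vecs_over_carrier: "v \<in> vecs_over R n \<Longrightarrow> v \<in> carrier_vec n"
  by (simp add: vecs_over_def)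

lemma mats_over_carrier: "A \<in> mats_over R n m \<Longrightarrow> A \<in> carrier_mat n m"
  by (simp add: mats_over_def)

context comm_subring
begin

lemma add_vec_mem [intro]: "v \<in> vecs_over R n \<Longrightarrow> w \<in> vecs_over R n \<Longrightarrow> v + w \<in> vecs_over R n"
  by (auto simp: vecs_over_def intro!: add_mem)

lemma minus_vec_mem [intro]: "v \<in> vecs_over R n \<Longrightarrow> w \<in> vecs_over R n \<Longrightarrow> v - w \<in> vecs_over R n"
  by (auto simp: vecs_over_def intro!: diff_mem)

lemma smult_vec_mem [intro]: "r \<in> R \<Longrightarrow> v \<in> vecs_over R n \<Longrightarrow> r \<cdot>\<^sub>v v \<in> vecs_over R n"
  by (auto simp: vecs_over_def intro!: mult_mem)

lemma unit_vec_mem [intro]: "i < n \<Longrightarrow> unit_vec n i \<in> vecs_over R n"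
  by (auto simp: vecs_over_def unit_vec_def)

lemma minus_one_mat_mem: "A \<in> mats_over R n n \<Longrightarrow> A - 1\<^sub>m n \<in> mats_over R n n"
  by (auto simp: mats_over_def)

lemma linear_functional_expansion:
  fixes T :: "'r vec \<Rightarrow> 'r"
  assumes add: "\<And>v w. v \<in> vecs_over R m \<Longrightarrow> w \<in> vecs_over R m \<Longrightarrow> T (v + w) = T v + T w"
    and smult: "\<And>r v. r \<in> R \<Longrightarrow> v \<in> vecs_over R m \<Longrightarrow> T (r \<cdot>\<^sub>v v) = r * T v"
    and v: "v \<in> vecs_over R m"
  shows "T v = (\<Sum>j<m. v $ j * T (unit_vec m j))"
proof -
  define truncate where "truncate k = vec m (\<lambda>i. if i < k then v $ i else 0)" for k
  have truncate_mem: "truncate k \<in> vecs_over R m" for k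
    using v by (auto simp: truncate_def vecs_over_def)
  have "T (truncate k) = (\<Sum>j<k. v $ j * T (unit_vec m j))" if "k \<le> m" for k
    using that
  proof (induction k)
    case 0
    have "truncate 0 = 0 \<cdot>\<^sub>v truncate 0" by (auto simp: truncate_def)
    then have "T (truncate 0) = 0 * T (truncate 0)"
      using smult[OF zero_mem truncate_mem] by metis
    then show ?case by simp
  next
    case (Suc k)
    have unit: "unit_vec m k \<in> vecs_over R m" and v_k: "v $ k \<in> R"
      using Suc.prems v by (auto simp: vecs_over_def)
    have "truncate (Suc k) = truncate k + v $ k \<cdot>\<^sub>v unit_vec m k"
      using Suc.prems by (intro eq_vecI) (auto simp: truncate_def unit_vec_def less_Suc_eq)
    then have "T (truncate (Suc k)) = T (truncate k) + v $ k * T (unit_vec m k)"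
      by (simp add: add[OF truncate_mem smult_vec_mem[OF v_k unit]] smult[OF v_k unit])
    then show ?case using Suc by simp
  qed
  moreover have "truncate m = v"
    using v by (intro eq_vecI) (auto simp: truncate_def vecs_over_def)
  ultimately show ?thesis by (metis order_refl)
qed

lemma linear_map_matrix:
  fixes T :: "'r vec \<Rightarrow> 'r vec"
  assumes T: "\<And>v. v \<in> vecs_over R m \<Longrightarrow> T v \<in> vecs_over R n"
    and add: "\<And>v w. v \<in> vecs_over R m \<Longrightarrow> w \<in> vecs_over R m \<Longrightarrow> T (v + w) = T v + T w"
    and smult: "\<And>r v. r \<in> R \<Longrightarrow> v \<in> vecs_over R m \<Longrightarrow> T (r \<cdot>\<^sub>v v) = r \<cdot>\<^sub>v T v"
  obtains A where "A \<in> mats_over R n m" and "\<And>v. v \<in> vecs_over R m \<Longrightarrow> T v = A *\<^sub>v v"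
proof
  define A where "A = mat n m (\<lambda>(i, j). T (unit_vec m j) $ i)"
  show "A \<in> mats_over R n m"
    using T[OF unit_vec_mem] by (auto simp: A_def mats_over_def vecs_over_def)
  fix v assume v: "v \<in> vecs_over R m"
  have carrier: "T w \<in> carrier_vec n" if "w \<in> vecs_over R m" for w
    using T[OF that] by (rule vecs_over_carrier)
  show "T v = A *\<^sub>v v"
  proof (rule eq_vecI)
    fix i assume "i < dim_vec (A *\<^sub>v v)"
    then have i: "i < n" by (simp add: A_def)
    have "T v $ i = (\<Sum>j<m. v $ j * T (unit_vec m j) $ i)"
      using i v carrier
      by (intro linear_functional_expansion[of m "\<lambda>w. T w $ i"])
        (auto simp: add smult carrier_vecD[OF carrier])
    also have "\<dots> = (A *\<^sub>v v) $ i"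
      using i v by (auto simp: A_def vecs_over_def scalar_prod_def mult.commute atLeast0LessThan intro!: sum.cong)
    finally show "T v $ i = (A *\<^sub>v v) $ i" .
  qed (use carrier[OF v] in \<open>simp add: A_def\<close>)
qed

lemma mat_eqI_mult_vec:
  assumes A: "A \<in> carrier_mat n m" and B: "B \<in> carrier_mat n m"
    and eq: "\<And>v. v \<in> vecs_over R m \<Longrightarrow> A *\<^sub>v v = B *\<^sub>v v"
  shows "A = B"
proof (rule eq_matI)
  fix i j assume "i < dim_row B" and "j < dim_col B"
  then have ij: "i < n" "j < m" using B by auto
  have "(A *\<^sub>v unit_vec m j) $ i = (B *\<^sub>v unit_vec m j) $ i"
    using eq[OF unit_vec_mem[OF ij(2)]] by simp
  then show "A $$ (i, j) = B $$ (i, j)" using A B ij by simp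
qed (use A B in auto)

lemma det_mem:
  assumes "A \<in> mats_over R n n"
  shows "det A \<in> R"
proof -
  have "A $$ (i, p i) \<in> R" if "p permutes {0..<n}" "i < n" for p i
    using assms that permutes_in_image[OF that(1), of i] by (auto simp: mats_over_def)
  then show ?thesis
    unfolding det_def'[OF mats_over_carrier[OF assms]] by (auto simp: sign_def intro!: sum_mem mult_mem prod_mem uminus_mem)
qed

lemma det_map_mat:
  fixes h :: "'r \<Rightarrow> 's::comm_ring_1"
  assumes h_add: "\<And>a b. a \<in> R \<Longrightarrow> b \<in> R \<Longrightarrow> h (a + b) = h a + h b"
    and h_mult: "\<And>a b. a \<in> R \<Longrightarrow> b \<in> R \<Longrightarrow> h (a * b) = h a * h b"
    and h_one: "h 1 = 1" and A: "A \<in> mats_over R n n"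
  shows "h (det A) = det (map_mat h A)"
proof -
  have h_zero: "h 0 = 0" using h_add[of 0 0] by simp
  have h_neg_one: "h (- 1) = - 1"
    using h_add[of 1 "- 1"] by (simp add: h_zero h_one eq_neg_iff_add_eq_0 add.commute uminus_mem)
  have h_sum: "h (sum f I) = (\<Sum>i\<in>I. h (f i))" if "\<And>i. i \<in> I \<Longrightarrow> f i \<in> R" for f and I :: "'i set"
    using that by (induction I rule: infinite_finite_induct) (auto simp: h_zero h_add sum_mem)
  have h_prod: "h (prod f I) = (\<Prod>i\<in>I. h (f i))" if "\<And>i. i \<in> I \<Longrightarrow> f i \<in> R" for f and I :: "'i set"
    using that by (induction I rule: infinite_finite_induct) (auto simp: h_one h_mult prod_mem)
  have entry: "A $$ (i, p i) \<in> R" "map_mat h A $$ (i, p i) = h (A $$ (i, p i))"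
    if "p permutes {0..<n}" "i < n" for p i
    using A that permutes_in_image[OF that(1), of i] by (auto simp: mats_over_def)
  have sign_mem: "signof p \<in> R" for p :: "nat \<Rightarrow> nat" by (auto simp: sign_def)
  have h_sign: "h (signof p) = signof p" for p :: "nat \<Rightarrow> nat"
    by (simp add: sign_def h_one h_neg_one)
  have "h (det A) = (\<Sum>p | p permutes {0..<n}. h (signof p * (\<Prod>i = 0..<n. A $$ (i, p i))))"
    unfolding det_def'[OF mats_over_carrier[OF A]]
    using entry sign_mem by (intro h_sum mult_mem prod_mem) auto
  also have "\<dots> = (\<Sum>p | p permutes {0..<n}. signof p * (\<Prod>i = 0..<n. map_mat h A $$ (i, p i)))"
  proof (rule sum.cong[OF refl], clarify)
    fix p :: "nat \<Rightarrow> nat" assume p: "p permutes {0..<n}"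
    have mem: "A $$ (i, p i) \<in> R" if "i \<in> {0..<n}" for i using entry(1)[OF p] that by simp
    have "h (signof p * (\<Prod>i = 0..<n. A $$ (i, p i))) = signof p * (\<Prod>i = 0..<n. h (A $$ (i, p i)))"
      by (simp only: h_mult[OF sign_mem prod_mem[OF mem]] h_sign h_prod[OF mem])
    then show "h (signof p * (\<Prod>i = 0..<n. A $$ (i, p i))) =
        signof p * (\<Prod>i = 0..<n. map_mat h A $$ (i, p i))"
      using entry(2)[OF p] by simp
  qed
  also have "\<dots> = det (map_mat h A)"
    by (rule det_def'[symmetric]) (use mats_over_carrier[OF A] in simp)
  finally show ?thesis .
qed

end

subsection \<open>Vectors and matrices indexed by finite sets\<close>

lemma from_nat_into_mem_if_less_card: "finite X \<Longrightarrow> r < card X \<Longrightarrow> from_nat_into X r \<in> X"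
  by (metis card.empty from_nat_into not_less_zero)

lemma sum_from_nat_into: "finite X \<Longrightarrow> (\<Sum>r<card X. F (from_nat_into X r)) = sum F X"
  by (rule sum.reindex_bij_betw) (rule bij_betw_from_nat_into_finite)

lemma prod_from_nat_into: "finite X \<Longrightarrow> (\<Prod>r<card X. F (from_nat_into X r)) = prod F X"
  by (rule prod.reindex_bij_betw) (rule bij_betw_from_nat_into_finite)

lemma all_less_card_iff: "finite X \<Longrightarrow> (\<forall>r<card X. P (from_nat_into X r)) \<longleftrightarrow> (\<forall>x\<in>X. P x)"
  using bij_betw_imp_surj_on[OF bij_betw_from_nat_into_finite, of X] by (metis imageE imageI lessThan_iff)

definition vec_on :: "'x set \<Rightarrow> ('x \<Rightarrow> 'a) \<Rightarrow> 'a vec" where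
  "vec_on X z = vec (card X) (\<lambda>r. z (from_nat_into X r))"

definition mat_on :: "'x set \<Rightarrow> ('x \<Rightarrow> 'x \<Rightarrow> 'a) \<Rightarrow> 'a mat" where
  "mat_on X F = mat (card X) (card X) (\<lambda>(r, s). F (from_nat_into X r) (from_nat_into X s))"

definition det_on :: "'x set \<Rightarrow> ('x \<Rightarrow> 'x \<Rightarrow> 'a::comm_ring_1) \<Rightarrow> 'a" where
  "det_on X F = det (mat_on X F)"

definition kronecker :: "'x \<Rightarrow> 'x \<Rightarrow> 'a::zero_neq_one" where
  "kronecker x y = (if x = y then 1 else 0)"

definition kernel_mult ::
  "'x set \<Rightarrow> ('x \<Rightarrow> 'x \<Rightarrow> 'a::comm_ring_1) \<Rightarrow> ('x \<Rightarrow> 'x \<Rightarrow> 'a) \<Rightarrow> 'x \<Rightarrow> 'x \<Rightarrow> 'a" where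
  "kernel_mult X F G x y = (\<Sum>z\<in>X. F x z * G z y)"

lemma mat_on_carrier [simp]: "mat_on X F \<in> carrier_mat (card X) (card X)"
  by (simp add: mat_on_def)

lemma dim_mat_on [simp]: "dim_row (mat_on X F) = card X" "dim_col (mat_on X F) = card X"
  by (simp_all add: mat_on_def)

lemma vec_on_add: "vec_on X (\<lambda>x. z x + w x) = vec_on X z + vec_on X w"
  by (auto simp: vec_on_def)

lemma vec_on_smult: "vec_on X (\<lambda>x. r * z x) = r \<cdot>\<^sub>v vec_on X z"
  by (auto simp: vec_on_def)

lemma vec_on_eq_iff: "finite X \<Longrightarrow> vec_on X z = vec_on X w \<longleftrightarrow> (\<forall>x\<in>X. z x = w x)"
  using all_less_card_iff[of X "\<lambda>x. z x = w x"] by (simp add: vec_on_def vec_eq_iff)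

lemma vec_on_mem_iff: "finite X \<Longrightarrow> vec_on X z \<in> vecs_over R (card X) \<longleftrightarrow> (\<forall>x\<in>X. z x \<in> R)"
  using all_less_card_iff[of X "\<lambda>x. z x \<in> R"] by (simp add: vecs_over_def vec_on_def)

lemma vecs_over_card_cases:
  assumes "finite X" and "v \<in> vecs_over R (card X)"
  obtains z where "v = vec_on X z" and "\<And>x. x \<in> X \<Longrightarrow> z x \<in> R"
proof
  define z where "z x = v $ inv_into {..<card X} (from_nat_into X) x" for x
  have "z (from_nat_into X r) = v $ r" if "r < card X" for r
    using bij_betw_from_nat_into_finite[OF assms(1)] that
    by (simp add: z_def bij_betw_def inv_into_f_f)
  then show eq: "v = vec_on X z"
    using assms(2) by (intro eq_vecI) (auto simp: vecs_over_def vec_on_def)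
  show "z x \<in> R" if "x \<in> X" for x
    using assms(2) that unfolding eq vec_on_mem_iff[OF assms(1)] by blast
qed

lemma mat_on_cong:
  "finite X \<Longrightarrow> (\<And>x y. x \<in> X \<Longrightarrow> y \<in> X \<Longrightarrow> F x y = G x y) \<Longrightarrow> mat_on X F = mat_on X G"
  by (auto simp: mat_on_def from_nat_into_mem_if_less_card intro!: eq_matI)

lemma mat_on_mem:
  "finite X \<Longrightarrow> (\<And>x y. x \<in> X \<Longrightarrow> y \<in> X \<Longrightarrow> F x y \<in> R) \<Longrightarrow> mat_on X F \<in> mats_over R (card X) (card X)"
  by (auto simp: mats_over_def mat_on_def from_nat_into_mem_if_less_card)

lemma mat_on_mult_vec_on:
  assumes "finite X"
  shows "mat_on X F *\<^sub>v vec_on X z = vec_on X (\<lambda>x. \<Sum>y\<in>X. F x y * z y)"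
  by (intro eq_vecI)
    (auto simp: mat_on_def vec_on_def scalar_prod_def atLeast0LessThan sum_from_nat_into[OF assms, symmetric])

lemma mat_on_mult:
  assumes "finite X"
  shows "mat_on X F * mat_on X G = mat_on X (kernel_mult X F G)"
  by (intro eq_matI)
    (auto simp: mat_on_def kernel_mult_def scalar_prod_def atLeast0LessThan
      sum_from_nat_into[OF assms, symmetric])

lemma mat_on_kronecker: "finite X \<Longrightarrow> mat_on X kronecker = 1\<^sub>m (card X)"
  using bij_betw_from_nat_into_finite[of X]
  by (intro eq_matI) (auto simp: mat_on_def kronecker_def bij_betw_def inj_on_def)

lemma trace_mat_on: "finite X \<Longrightarrow> (\<Sum>r<card X. mat_on X F $$ (r, r)) = (\<Sum>x\<in>X. F x x)"
  using sum_from_nat_into[of X "\<lambda>x. F x x"] by (simp add: mat_on_def)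

lemma sum_kronecker_mult [simp]:
  "finite X \<Longrightarrow> x \<in> X \<Longrightarrow> (\<Sum>y\<in>X. kronecker x y * z y) = (z x :: 'a::comm_ring_1)"
  by (simp add: kronecker_def if_distrib[of "\<lambda>t. t * _"] cong: if_cong)

lemma sum_mult_kronecker [simp]:
  "finite X \<Longrightarrow> y \<in> X \<Longrightarrow> (\<Sum>x\<in>X. z x * kronecker x y) = (z y :: 'a::comm_ring_1)"
  by (simp add: kronecker_def if_distrib[of "\<lambda>t. _ * t"] cong: if_cong)

lemma det_on_cong:
  "finite X \<Longrightarrow> (\<And>x y. x \<in> X \<Longrightarrow> y \<in> X \<Longrightarrow> F x y = G x y) \<Longrightarrow> det_on X F = det_on X G"
  unfolding det_on_def by (simp cong: mat_on_cong)

lemma det_on_mult: "finite X \<Longrightarrow> det_on X (kernel_mult X F G) = det_on X F * det_on X G"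
  unfolding det_on_def mat_on_mult[symmetric] by (rule det_mult[OF mat_on_carrier mat_on_carrier])

lemma det_on_kronecker: "finite X \<Longrightarrow> det_on X kronecker = 1"
  by (simp add: det_on_def mat_on_kronecker)

lemma det_on_diagonal:
  assumes "finite X"
  shows "det_on X (\<lambda>x y. kronecker x y * d x) = prod d X"
proof -
  have "upper_triangular (mat_on X (\<lambda>x y. kronecker x y * d x))"
    using bij_betw_from_nat_into_finite[OF assms]
    by (fastforce simp: mat_on_def kronecker_def bij_betw_def inj_on_def upper_triangular_def)
  then have "det_on X (\<lambda>x y. kronecker x y * d x) = (\<Prod>r<card X. d (from_nat_into X r))"
    unfolding det_on_def
    by (subst det_upper_triangular[OF _ mat_on_carrier])
      (auto simp: prod_list_diag_prod mat_on_def kronecker_def atLeast0LessThan)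
  then show ?thesis by (simp add: prod_from_nat_into[OF assms])
qed

lemma (in comm_subring) det_on_mem:
  "finite X \<Longrightarrow> (\<And>x y. x \<in> X \<Longrightarrow> y \<in> X \<Longrightarrow> F x y \<in> R) \<Longrightarrow> det_on X F \<in> R"
  unfolding det_on_def by (rule det_mem[OF mat_on_mem])

lemma (in comm_subring) det_on_hom:
  fixes h :: "'r \<Rightarrow> 's::comm_ring_1"
  assumes "\<And>a b. a \<in> R \<Longrightarrow> b \<in> R \<Longrightarrow> h (a + b) = h a + h b"
    and "\<And>a b. a \<in> R \<Longrightarrow> b \<in> R \<Longrightarrow> h (a * b) = h a * h b"
    and "h 1 = 1" and "finite X" and "\<And>x y. x \<in> X \<Longrightarrow> y \<in> X \<Longrightarrow> F x y \<in> R"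
  shows "h (det_on X F) = det_on X (\<lambda>x y. h (F x y))"
proof -
  have "map_mat h (mat_on X F) = mat_on X (\<lambda>x y. h (F x y))"
    by (intro eq_matI) (auto simp: mat_on_def)
  then show ?thesis
    unfolding det_on_def using det_map_mat[OF assms(1-3) mat_on_mem[OF assms(4,5)]] by simp
qed

lemma kernel_mult_cong:
  "(\<And>z. z \<in> X \<Longrightarrow> F x z = F' x z) \<Longrightarrow> (\<And>z. z \<in> X \<Longrightarrow> G z y = G' z y) \<Longrightarrow>
    kernel_mult X F G x y = kernel_mult X F' G' x y"
  by (simp add: kernel_mult_def)

lemma kernel_mult_assoc:
  "kernel_mult X (kernel_mult X F G) H = kernel_mult X F (kernel_mult X G H)"
  unfolding kernel_mult_def sum_distrib_left sum_distrib_right mult.assoc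
  by (intro ext) (rule sum.swap)

lemma det_on_one_plus_orthogonal_add:
  fixes N E F :: "'x \<Rightarrow> 'x \<Rightarrow> 'a::comm_ring_1"
  assumes X: "finite X"
    and comm: "\<And>x y. x \<in> X \<Longrightarrow> y \<in> X \<Longrightarrow> kernel_mult X E N x y = kernel_mult X N E x y"
    and orth: "\<And>x y. x \<in> X \<Longrightarrow> y \<in> X \<Longrightarrow> kernel_mult X E F x y = 0"
  shows "det_on X (\<lambda>x y. kronecker x y + kernel_mult X N (\<lambda>x y. E x y + F x y) x y) =
    det_on X (\<lambda>x y. kronecker x y + kernel_mult X N E x y) *
    det_on X (\<lambda>x y. kronecker x y + kernel_mult X N F x y)"
proof -
  let ?NE = "kernel_mult X N E" and ?NF = "kernel_mult X N F"
  have E_NF: "kernel_mult X E ?NF x y = 0" if "x \<in> X" "y \<in> X" for x y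
  proof -
    have "kernel_mult X E ?NF x y = kernel_mult X (kernel_mult X E N) F x y"
      by (simp only: kernel_mult_assoc)
    also have "\<dots> = kernel_mult X ?NE F x y"
      by (rule kernel_mult_cong) (use comm that in auto)
    also have "\<dots> = kernel_mult X N (kernel_mult X E F) x y"
      by (simp only: kernel_mult_assoc)
    also have "\<dots> = 0"
      using orth that by (simp add: kernel_mult_def[of X N])
    finally show ?thesis .
  qed
  have "kernel_mult X (\<lambda>x y. kronecker x y + ?NE x y) (\<lambda>x y. kronecker x y + ?NF x y) x y =
      kronecker x y + kernel_mult X N (\<lambda>x y. E x y + F x y) x y" if xy: "x \<in> X" "y \<in> X" for x y
  proof -
    have "kernel_mult X (\<lambda>x y. kronecker x y + ?NE x y) (\<lambda>x y. kronecker x y + ?NF x y) x y =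
        kronecker x y + ?NF x y + ?NE x y + kernel_mult X ?NE ?NF x y"
      unfolding kernel_mult_def[of X "\<lambda>x y. kronecker x y + ?NE x y"] kernel_mult_def[of X ?NE ?NF]
      using X xy by (simp add: distrib_left distrib_right sum.distrib add_ac)
    moreover have "kernel_mult X ?NE ?NF x y = 0"
      using E_NF xy by (simp add: kernel_mult_assoc kernel_mult_def[of X N "kernel_mult X E ?NF"])
    ultimately show ?thesis by (simp add: kernel_mult_def algebra_simps sum.distrib)
  qed
  then show ?thesis
    unfolding det_on_mult[OF X, symmetric] by (intro det_on_cong[OF X]) simp
qed

lemma det_on_one_plus_orthogonal_sum:
  fixes N :: "'x \<Rightarrow> 'x \<Rightarrow> 'a::comm_ring_1"
  assumes X: "finite X" and "finite S"
    and "\<And>p x y. p \<in> S \<Longrightarrow> x \<in> X \<Longrightarrow> y \<in> X \<Longrightarrow>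
      kernel_mult X (E p) N x y = kernel_mult X N (E p) x y"
    and "\<And>p q x y. p \<in> S \<Longrightarrow> q \<in> S \<Longrightarrow> p \<noteq> q \<Longrightarrow> x \<in> X \<Longrightarrow> y \<in> X \<Longrightarrow>
      kernel_mult X (E p) (E q) x y = 0"
  shows "det_on X (\<lambda>x y. kronecker x y + kernel_mult X N (\<lambda>x y. \<Sum>p\<in>S. E p x y) x y) =
    (\<Prod>p\<in>S. det_on X (\<lambda>x y. kronecker x y + kernel_mult X N (E p) x y))"
  using assms(2-)
proof (induction S)
  case empty
  then show ?case by (simp add: kernel_mult_def det_on_kronecker[OF X])
next
  case (insert p S)
  have "kernel_mult X (E p) (\<lambda>x y. \<Sum>q\<in>S. E q x y) x y = 0" if "x \<in> X" "y \<in> X" for x y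
  proof -
    have "kernel_mult X (E p) (\<lambda>x y. \<Sum>q\<in>S. E q x y) x y = (\<Sum>q\<in>S. kernel_mult X (E p) (E q) x y)"
      unfolding kernel_mult_def sum_distrib_left by (rule sum.swap)
    also have "\<dots> = 0"
      using insert.hyps insert.prems(2) that by (intro sum.neutral ballI) auto
    finally show ?thesis .
  qed
  moreover have "kernel_mult X (E p) N x y = kernel_mult X N (E p) x y" if "x \<in> X" "y \<in> X" for x y
    using insert.prems(1) that by simp
  ultimately show ?case
    using insert by (simp add: det_on_one_plus_orthogonal_add[OF X])
qed

section \<open>Modules described by coordinates\<close>

text \<open>
  The operations of \<open>M\<close> inherit the module axioms from the values of the functionals \<open>f x\<close>, so these
  axioms need not be assumed.
\<close>

locale coordinates =
  fixes R :: "'r set" and M :: "('r, 'm) module" and X :: "'x set"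
    and f :: "'x \<Rightarrow> 'm \<Rightarrow> 'u::comm_monoid_add"
  assumes zero_closed: "\<zero>\<^bsub>M\<^esub> \<in> carrier M"
    and add_closed: "m \<in> carrier M \<Longrightarrow> m' \<in> carrier M \<Longrightarrow> m \<oplus>\<^bsub>M\<^esub> m' \<in> carrier M"
    and smult_closed: "r \<in> R \<Longrightarrow> m \<in> carrier M \<Longrightarrow> r \<odot>\<^bsub>M\<^esub> m \<in> carrier M"
    and f_zero: "x \<in> X \<Longrightarrow> f x \<zero>\<^bsub>M\<^esub> = 0"
    and f_add: "x \<in> X \<Longrightarrow> m \<in> carrier M \<Longrightarrow> m' \<in> carrier M \<Longrightarrow>
      f x (m \<oplus>\<^bsub>M\<^esub> m') = f x m + f x m'"
    and f_eqI: "m \<in> carrier M \<Longrightarrow> m' \<in> carrier M \<Longrightarrow> (\<And>x. x \<in> X \<Longrightarrow> f x m = f x m') \<Longrightarrow> m = m'"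
begin

lemma abelian_monoid_M: "abelian_monoid M"
proof (rule abelian_monoidI)
  fix m m' m'' assume "m \<in> carrier M" "m' \<in> carrier M" "m'' \<in> carrier M"
  then show "m \<oplus>\<^bsub>M\<^esub> m' \<oplus>\<^bsub>M\<^esub> m'' = m \<oplus>\<^bsub>M\<^esub> (m' \<oplus>\<^bsub>M\<^esub> m'')"
    by (intro f_eqI) (simp_all add: f_add add_closed add.assoc)
next
  fix m m' assume "m \<in> carrier M" "m' \<in> carrier M"
  then show "m \<oplus>\<^bsub>M\<^esub> m' = m' \<oplus>\<^bsub>M\<^esub> m"
    by (intro f_eqI) (simp_all add: f_add add_closed add.commute)
next
  fix m assume "m \<in> carrier M"
  then show "\<zero>\<^bsub>M\<^esub> \<oplus>\<^bsub>M\<^esub> m = m"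
    by (intro f_eqI) (simp_all add: f_add f_zero add_closed zero_closed)
qed (auto intro: zero_closed add_closed)

lemma finsum_closed: "(\<And>i. i \<in> I \<Longrightarrow> m i \<in> carrier M) \<Longrightarrow> (\<Oplus>\<^bsub>M\<^esub>i\<in>I. m i) \<in> carrier M"
  by (rule abelian_monoid.finsum_closed[OF abelian_monoid_M]) auto

lemma f_finsum:
  assumes x: "x \<in> X" and "finite I" and "\<And>i. i \<in> I \<Longrightarrow> m i \<in> carrier M"
  shows "f x (\<Oplus>\<^bsub>M\<^esub>i\<in>I. m i) = (\<Sum>i\<in>I. f x (m i))"
  using assms(2,3)
proof (induction I)
  case empty
  then show ?case
    using x by (simp add: abelian_monoid.finsum_empty[OF abelian_monoid_M] f_zero)
next
  case (insert i I)
  have "(\<Oplus>\<^bsub>M\<^esub>i\<in>insert i I. m i) = m i \<oplus>\<^bsub>M\<^esub> (\<Oplus>\<^bsub>M\<^esub>i\<in>I. m i)"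
    using insert by (intro abelian_monoid.finsum_insert[OF abelian_monoid_M]) auto
  then show ?case
    using insert x finsum_closed[of I m] by (simp add: f_add)
qed

lemma series_endo_closed:
  assumes "\<And>i m. m \<in> carrier M \<Longrightarrow> \<Phi> i m \<in> carrier M" and "\<And>n. F n \<in> carrier M"
  shows "series_endo M \<Phi> F n \<in> carrier M"
  unfolding series_endo_def using assms by (auto intro: finsum_closed)

lemma f_series_endo:
  assumes "x \<in> X" and "\<And>i m. m \<in> carrier M \<Longrightarrow> \<Phi> i m \<in> carrier M" and "\<And>n. F n \<in> carrier M"
  shows "f x (series_endo M \<Phi> F n) = (\<Sum>i\<le>n. f x (\<Phi> i (F (n - i))))"
  unfolding series_endo_def using assms by (intro f_finsum) auto

end

locale linear_coordinates = comm_subring R + coordinates R M X f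
  for R :: "'r::comm_ring_1 set" and M :: "('r, 'm) module" and X :: "'x set" and f :: "'x \<Rightarrow> 'm \<Rightarrow> 'r" +
  assumes f_smult: "x \<in> X \<Longrightarrow> r \<in> R \<Longrightarrow> m \<in> carrier M \<Longrightarrow> f x (r \<odot>\<^bsub>M\<^esub> m) = r * f x m"
begin

lemma module_M: "module (ring_on R) M"
proof (rule moduleI)
  show "cring (ring_on R)" by (rule cring_ring_on)
  interpret abelian_monoid M by (rule abelian_monoid_M)
  show "abelian_group M"
  proof (rule abelian_groupI)
    show "\<exists>m'\<in>carrier M. m' \<oplus>\<^bsub>M\<^esub> m = \<zero>\<^bsub>M\<^esub>" if "m \<in> carrier M" for m
    proof (intro bexI f_eqI)
      show "(-1) \<odot>\<^bsub>M\<^esub> m \<in> carrier M" using that by (auto intro: smult_closed)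
      show "f x ((-1) \<odot>\<^bsub>M\<^esub> m \<oplus>\<^bsub>M\<^esub> m) = f x \<zero>\<^bsub>M\<^esub>" if "x \<in> X" for x
        using that \<open>m \<in> carrier M\<close> by (simp add: f_add f_smult f_zero smult_closed uminus_mem)
    qed (use that in \<open>auto intro!: add_closed smult_closed\<close>)
  qed (simp_all add: a_ac)
  fix r m assume "r \<in> carrier (ring_on R)" and m: "m \<in> carrier M"
  then have r: "r \<in> R" by simp
  show "r \<odot>\<^bsub>M\<^esub> m \<in> carrier M" using r m by (rule smult_closed)
  show "r \<odot>\<^bsub>M\<^esub> (m \<oplus>\<^bsub>M\<^esub> m') = r \<odot>\<^bsub>M\<^esub> m \<oplus>\<^bsub>M\<^esub> r \<odot>\<^bsub>M\<^esub> m'" if "m' \<in> carrier M" for m'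
    using r m that by (intro f_eqI) (simp_all add: smult_closed f_add f_smult distrib_left)
  fix s assume "s \<in> carrier (ring_on R)"
  then have s: "s \<in> R" by simp
  show "(r \<oplus>\<^bsub>ring_on R\<^esub> s) \<odot>\<^bsub>M\<^esub> m = r \<odot>\<^bsub>M\<^esub> m \<oplus>\<^bsub>M\<^esub> s \<odot>\<^bsub>M\<^esub> m"
    using r s m by (intro f_eqI) (simp_all add: smult_closed add_mem f_add f_smult distrib_right)
  show "(r \<otimes>\<^bsub>ring_on R\<^esub> s) \<odot>\<^bsub>M\<^esub> m = r \<odot>\<^bsub>M\<^esub> (s \<odot>\<^bsub>M\<^esub> m)"
    using r s m by (intro f_eqI) (simp_all add: smult_closed mult_mem f_smult mult.assoc)
next
  show "\<one>\<^bsub>ring_on R\<^esub> \<odot>\<^bsub>M\<^esub> m = m" if "m \<in> carrier M" for m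
    using that by (intro f_eqI) (simp_all add: smult_closed f_smult)
qed

end

section \<open>Traces and determinants on finitely generated projective modules\<close>

lemma free_module_simps [simp]:
  "carrier (free_module R n) = vecs_over R n"
  "zero (free_module R n) = 0\<^sub>v n"
  "add (free_module R n) = (+)"
  "smult (free_module R n) = (\<cdot>\<^sub>v)"
  by (simp_all add: free_module_def vecs_over_def module_vec_def)

lemma direct_sum_simps [simp]:
  "carrier (direct_sum M Q) = carrier M \<times> carrier Q"
  "add (direct_sum M Q) (x, q) (x', q') = (x \<oplus>\<^bsub>M\<^esub> x', q \<oplus>\<^bsub>Q\<^esub> q')"
  "smult (direct_sum M Q) r (x, q) = (r \<odot>\<^bsub>M\<^esub> x, r \<odot>\<^bsub>Q\<^esub> q)"
  by (simp_all add: direct_sum_def)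

locale completed_module =
  fixes R :: "'r::comm_ring_1 set" and M :: "('r, 'm) module" and Q n \<theta>
  assumes completion: "free_completion R M Q n \<theta>"
begin

sublocale M: Module.module "ring_on R" M
  using completion by (simp add: free_completion_def)

sublocale Q: Module.module "ring_on R" Q
  using completion by (simp add: free_completion_def)

sublocale comm_subring R
  by (rule comm_subring_if_cring_ring_on) (rule M.R.cring_axioms)

lemma \<theta>_hom: "\<theta> \<in> module_hom (ring_on R) (direct_sum M Q) (free_module R n)"
  and \<theta>_bij: "bij_betw \<theta> (carrier M \<times> carrier Q) (vecs_over R n)"
  using completion by (simp_all add: free_completion_def)

lemma \<theta>_mem: "x \<in> carrier M \<Longrightarrow> q \<in> carrier Q \<Longrightarrow> \<theta> (x, q) \<in> vecs_over R n"
  using \<theta>_bij by (auto simp: bij_betw_def)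

lemma \<theta>_add:
  "x \<in> carrier M \<Longrightarrow> x' \<in> carrier M \<Longrightarrow> q \<in> carrier Q \<Longrightarrow> q' \<in> carrier Q \<Longrightarrow>
    \<theta> (x \<oplus>\<^bsub>M\<^esub> x', q \<oplus>\<^bsub>Q\<^esub> q') = \<theta> (x, q) + \<theta> (x', q')"
  using LinearCombinations.module_hom_add[OF \<theta>_hom, of "(x, q)" "(x', q')"] by simp

lemma \<theta>_smult:
  "r \<in> R \<Longrightarrow> x \<in> carrier M \<Longrightarrow> q \<in> carrier Q \<Longrightarrow> \<theta> (r \<odot>\<^bsub>M\<^esub> x, r \<odot>\<^bsub>Q\<^esub> q) = r \<cdot>\<^sub>v \<theta> (x, q)"
  using LinearCombinations.module_hom_smult[OF \<theta>_hom, of r "(x, q)"] by simp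

lemma \<theta>_cases:
  assumes "v \<in> vecs_over R n"
  obtains x q where "x \<in> carrier M" and "q \<in> carrier Q" and "v = \<theta> (x, q)"
  using assms unfolding bij_betw_imp_surj_on[OF \<theta>_bij, symmetric] by blast

lemma matrix_extending_by_zero:
  assumes T: "\<And>x. x \<in> carrier M \<Longrightarrow> T x \<in> vecs_over R m"
    and add: "\<And>x y. x \<in> carrier M \<Longrightarrow> y \<in> carrier M \<Longrightarrow> T (x \<oplus>\<^bsub>M\<^esub> y) = T x + T y"
    and smult: "\<And>r x. r \<in> R \<Longrightarrow> x \<in> carrier M \<Longrightarrow> T (r \<odot>\<^bsub>M\<^esub> x) = r \<cdot>\<^sub>v T x"
  obtains B where "B \<in> mats_over R m n"
    and "\<And>x q. x \<in> carrier M \<Longrightarrow> q \<in> carrier Q \<Longrightarrow> B *\<^sub>v \<theta> (x, q) = T x"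
proof -
  define \<pi> where "\<pi> v = fst (inv_into (carrier M \<times> carrier Q) \<theta> v)" for v
  have \<pi>_\<theta>: "\<pi> (\<theta> (x, q)) = x" if "x \<in> carrier M" "q \<in> carrier Q" for x q
    using \<theta>_bij that by (simp add: \<pi>_def bij_betw_def inv_into_f_f)
  obtain B where B: "B \<in> mats_over R m n" "\<And>v. v \<in> vecs_over R n \<Longrightarrow> T (\<pi> v) = B *\<^sub>v v"
  proof (rule linear_map_matrix[of n "\<lambda>v. T (\<pi> v)" m])
    fix v assume "v \<in> vecs_over R n"
    then obtain x q where v: "x \<in> carrier M" "q \<in> carrier Q" "v = \<theta> (x, q)" by (rule \<theta>_cases)
    show "T (\<pi> v) \<in> vecs_over R m" using v T by (simp add: \<pi>_\<theta>)
    show "T (\<pi> (r \<cdot>\<^sub>v v)) = r \<cdot>\<^sub>v T (\<pi> v)" if "r \<in> R" for r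
      using v that M.smult_closed[of r x] Q.smult_closed[of r q]
      by (simp add: \<theta>_smult[symmetric] \<pi>_\<theta> smult)
    fix w assume "w \<in> vecs_over R n"
    then obtain y p where w: "y \<in> carrier M" "p \<in> carrier Q" "w = \<theta> (y, p)" by (rule \<theta>_cases)
    show "T (\<pi> (v + w)) = T (\<pi> v) + T (\<pi> w)"
      using v w by (simp add: \<theta>_add[symmetric] \<pi>_\<theta> add)
  qed blast
  show ?thesis
  proof (rule that[OF B(1)])
    show "B *\<^sub>v \<theta> (x, q) = T x" if "x \<in> carrier M" "q \<in> carrier Q" for x q
      using B(2)[OF \<theta>_mem[OF that]] \<pi>_\<theta>[OF that] by simp
  qed
qed

lemma comparison_matrix:
  assumes "free_completion R M Q' m \<theta>'"
  obtains B where "B \<in> mats_over R m n"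
    and "\<And>x q. x \<in> carrier M \<Longrightarrow> q \<in> carrier Q \<Longrightarrow> B *\<^sub>v \<theta> (x, q) = \<theta>' (x, \<zero>\<^bsub>Q'\<^esub>)"
proof -
  interpret other: completed_module R M Q' m \<theta>' by unfold_locales fact
  show ?thesis
  proof (rule matrix_extending_by_zero[of "\<lambda>x. \<theta>' (x, \<zero>\<^bsub>Q'\<^esub>)" m])
    show "\<theta>' (x \<oplus>\<^bsub>M\<^esub> y, \<zero>\<^bsub>Q'\<^esub>) = \<theta>' (x, \<zero>\<^bsub>Q'\<^esub>) + \<theta>' (y, \<zero>\<^bsub>Q'\<^esub>)"
      if "x \<in> carrier M" "y \<in> carrier M" for x y
      using other.\<theta>_add[OF that, of "\<zero>\<^bsub>Q'\<^esub>" "\<zero>\<^bsub>Q'\<^esub>"] by simp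
    show "\<theta>' (r \<odot>\<^bsub>M\<^esub> x, \<zero>\<^bsub>Q'\<^esub>) = r \<cdot>\<^sub>v \<theta>' (x, \<zero>\<^bsub>Q'\<^esub>)" if "r \<in> R" "x \<in> carrier M" for r x
      using other.\<theta>_smult[OF that, of "\<zero>\<^bsub>Q'\<^esub>"] other.Q.smult_r_null[of r] that by simp
  qed (auto intro: other.\<theta>_mem that)
qed

lemma mat_eqI_completion:
  assumes "A \<in> carrier_mat k n" and "B \<in> carrier_mat k n"
    and "\<And>x q. x \<in> carrier M \<Longrightarrow> q \<in> carrier Q \<Longrightarrow> A *\<^sub>v \<theta> (x, q) = B *\<^sub>v \<theta> (x, q)"
  shows "A = B"
  using assms(1,2)
proof (rule mat_eqI_mult_vec)
  show "A *\<^sub>v v = B *\<^sub>v v" if "v \<in> vecs_over R n" for v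
    using \<theta>_cases[OF that] assms(3) by metis
qed

text \<open>
  The comparison matrices \<open>B\<close> and \<open>C\<close> of the two completions are the identity on \<open>M\<close> and vanish on the
  complements. Hence \<open>D = (C D') B\<close> and \<open>D' = B (C D')\<close>.
\<close>

lemma completion_factorisation:
  assumes completion': "free_completion R M Q' m \<theta>'"
    and \<delta>: "\<And>x. x \<in> carrier M \<Longrightarrow> \<delta> x \<in> carrier M"
    and D: "D \<in> mats_over R n n" and D': "D' \<in> mats_over R m m"
    and D_\<theta>: "\<And>x q. x \<in> carrier M \<Longrightarrow> q \<in> carrier Q \<Longrightarrow> D *\<^sub>v \<theta> (x, q) = \<theta> (\<delta> x, \<zero>\<^bsub>Q\<^esub>)"
    and D'_\<theta>': "\<And>x q. x \<in> carrier M \<Longrightarrow> q \<in> carrier Q' \<Longrightarrow> D' *\<^sub>v \<theta>' (x, q) = \<theta>' (\<delta> x, \<zero>\<^bsub>Q'\<^esub>)"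
  obtains P S where "P \<in> carrier_mat n m" and "S \<in> carrier_mat m n" and "D = P * S" and "D' = S * P"
proof -
  interpret other: completed_module R M Q' m \<theta>' by unfold_locales fact
  obtain B where B: "B \<in> mats_over R m n"
    and B_\<theta>: "\<And>x q. x \<in> carrier M \<Longrightarrow> q \<in> carrier Q \<Longrightarrow> B *\<^sub>v \<theta> (x, q) = \<theta>' (x, \<zero>\<^bsub>Q'\<^esub>)"
    using comparison_matrix[OF completion'] by blast
  obtain C where C: "C \<in> mats_over R n m"
    and C_\<theta>': "\<And>x q. x \<in> carrier M \<Longrightarrow> q \<in> carrier Q' \<Longrightarrow> C *\<^sub>v \<theta>' (x, q) = \<theta> (x, \<zero>\<^bsub>Q\<^esub>)"
    using other.comparison_matrix[OF completion] by blast
  note carriers = B[THEN mats_over_carrier] C[THEN mats_over_carrier]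
    D[THEN mats_over_carrier] D'[THEN mats_over_carrier]
  show thesis
  proof (rule that[of "C * D'" B])
    show "D = (C * D') * B"
    proof (rule mat_eqI_completion)
      fix x q assume xq: "x \<in> carrier M" "q \<in> carrier Q"
      have "(C * D') * B *\<^sub>v \<theta> (x, q) = C *\<^sub>v (D' *\<^sub>v (B *\<^sub>v \<theta> (x, q)))"
        using carriers \<theta>_mem[OF xq] by (simp add: vecs_over_def assoc_mult_mat_vec[of _ n m _ m]
            assoc_mult_mat_vec[of _ n m _ n])
      then show "D *\<^sub>v \<theta> (x, q) = (C * D') * B *\<^sub>v \<theta> (x, q)"
        using xq \<delta> by (simp add: B_\<theta> C_\<theta>' D_\<theta> D'_\<theta>')
    qed (use carriers in auto)
    show "D' = B * (C * D')"
    proof (rule other.mat_eqI_completion)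
      fix x q assume xq: "x \<in> carrier M" "q \<in> carrier Q'"
      have "B * (C * D') *\<^sub>v \<theta>' (x, q) = B *\<^sub>v (C *\<^sub>v (D' *\<^sub>v \<theta>' (x, q)))"
        using carriers other.\<theta>_mem[OF xq] by (simp add: vecs_over_def assoc_mult_mat_vec[of _ m n _ m]
            assoc_mult_mat_vec[of _ n m _ m])
      then show "D' *\<^sub>v \<theta>' (x, q) = B * (C * D') *\<^sub>v \<theta>' (x, q)"
        using xq \<delta> by (simp add: B_\<theta> C_\<theta>' D'_\<theta>')
    qed (use carriers in auto)
  qed (use carriers in auto)
qed

lemma proj_trace_eqI:
  assumes A: "matrix_of_endo R M Q n \<theta> (\<lambda>(x, q). (\<phi> x, \<zero>\<^bsub>Q\<^esub>)) A"
    and \<phi>: "\<And>x. x \<in> carrier M \<Longrightarrow> \<phi> x \<in> carrier M"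
  shows "proj_trace R M \<phi> = (\<Sum>i<n. A $$ (i, i))"
  unfolding proj_trace_def
proof (rule the_equality)
  show "\<exists>Q k \<theta> A'. free_completion R M Q k \<theta> \<and>
      matrix_of_endo R M Q k \<theta> (\<lambda>(x, q). (\<phi> x, \<zero>\<^bsub>Q\<^esub>)) A' \<and>
      (\<Sum>i<n. A $$ (i, i)) = (\<Sum>i<k. A' $$ (i, i))"
    using completion A by blast
next
  fix d
  assume "\<exists>Q n \<theta> A. free_completion R M Q n \<theta> \<and>
      matrix_of_endo R M Q n \<theta> (\<lambda>(x, q). (\<phi> x, \<zero>\<^bsub>Q\<^esub>)) A \<and> d = (\<Sum>i<n. A $$ (i, i))"
  then obtain Q' m \<theta>' A' where completion': "free_completion R M Q' m \<theta>'"
    and A': "matrix_of_endo R M Q' m \<theta>' (\<lambda>(x, q). (\<phi> x, \<zero>\<^bsub>Q'\<^esub>)) A'"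
    and d: "d = (\<Sum>i<m. A' $$ (i, i))" by blast
  obtain P S where "P \<in> carrier_mat n m" "S \<in> carrier_mat m n" "A = P * S" "A' = S * P"
  proof (rule completion_factorisation[OF completion', of \<phi> A A'])
    show "A *\<^sub>v \<theta> (x, q) = \<theta> (\<phi> x, \<zero>\<^bsub>Q\<^esub>)" if "x \<in> carrier M" "q \<in> carrier Q" for x q
      using A that by (force simp: matrix_of_endo_def)
    show "A' *\<^sub>v \<theta>' (x, q) = \<theta>' (\<phi> x, \<zero>\<^bsub>Q'\<^esub>)" if "x \<in> carrier M" "q \<in> carrier Q'" for x q
      using A' that by (force simp: matrix_of_endo_def)
  qed (use A A' \<phi> in \<open>simp_all add: matrix_of_endo_def mats_over_iff_elements_mat\<close>)
  then show "d = (\<Sum>i<n. A $$ (i, i))" using trace_mult_commute[of P n m S] d by metis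
qed

lemma matrix_of_endo_minus_one:
  assumes A: "matrix_of_endo R M Q n \<theta> (\<lambda>(x, q). (\<phi> x, q)) A"
    and \<phi>: "\<And>x. x \<in> carrier M \<Longrightarrow> \<phi> x \<in> carrier M"
    and x: "x \<in> carrier M" and q: "q \<in> carrier Q"
  shows "(A - 1\<^sub>m n) *\<^sub>v \<theta> (x, q) = \<theta> (\<phi> x \<ominus>\<^bsub>M\<^esub> x, \<zero>\<^bsub>Q\<^esub>)"
proof -
  have carriers: "\<theta> (\<phi> x \<ominus>\<^bsub>M\<^esub> x, \<zero>\<^bsub>Q\<^esub>) \<in> carrier_vec n" "\<theta> (x, q) \<in> carrier_vec n"
    using \<theta>_mem x q \<phi> by (auto simp: vecs_over_def)
  have "\<phi> x = (\<phi> x \<ominus>\<^bsub>M\<^esub> x) \<oplus>\<^bsub>M\<^esub> x"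
    using x \<phi> by (simp add: M.minus_eq M.a_assoc M.l_neg)
  then have "A *\<^sub>v \<theta> (x, q) = \<theta> (\<phi> x \<ominus>\<^bsub>M\<^esub> x, \<zero>\<^bsub>Q\<^esub>) + \<theta> (x, q)"
    using A x q \<phi> \<theta>_add[of "\<phi> x \<ominus>\<^bsub>M\<^esub> x" x "\<zero>\<^bsub>Q\<^esub>" q] by (force simp: matrix_of_endo_def)
  moreover have "(A - 1\<^sub>m n) *\<^sub>v \<theta> (x, q) = A *\<^sub>v \<theta> (x, q) - \<theta> (x, q)"
    using A carriers by (subst minus_mult_distrib_mat_vec) (auto simp: matrix_of_endo_def)
  ultimately show ?thesis using carriers by (auto intro!: eq_vecI)
qed

lemma proj_det_eqI:
  assumes A: "matrix_of_endo R M Q n \<theta> (\<lambda>(x, q). (\<phi> x, q)) A"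
    and \<phi>: "\<And>x. x \<in> carrier M \<Longrightarrow> \<phi> x \<in> carrier M"
  shows "proj_det R M \<phi> = det A"
  unfolding proj_det_def
proof (rule the_equality)
  show "\<exists>Q n \<theta> A'. free_completion R M Q n \<theta> \<and>
      matrix_of_endo R M Q n \<theta> (\<lambda>(x, q). (\<phi> x, q)) A' \<and> det A = det A'"
    using completion A by blast
next
  fix d
  assume "\<exists>Q n \<theta> A. free_completion R M Q n \<theta> \<and>
      matrix_of_endo R M Q n \<theta> (\<lambda>(x, q). (\<phi> x, q)) A \<and> d = det A"
  then obtain Q' m \<theta>' A' where completion': "free_completion R M Q' m \<theta>'"
    and A': "matrix_of_endo R M Q' m \<theta>' (\<lambda>(x, q). (\<phi> x, q)) A'"
    and d: "d = det A'" by blast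
  interpret other: completed_module R M Q' m \<theta>' by unfold_locales fact
  obtain P S where PS: "P \<in> carrier_mat n m" "S \<in> carrier_mat m n"
      "A - 1\<^sub>m n = P * S" "A' - 1\<^sub>m m = S * P"
  proof (rule completion_factorisation[OF completion', of "\<lambda>x. \<phi> x \<ominus>\<^bsub>M\<^esub> x"])
    show "A - 1\<^sub>m n \<in> mats_over R n n" "A' - 1\<^sub>m m \<in> mats_over R m m"
      using A A' by (intro minus_one_mat_mem; simp add: matrix_of_endo_def mats_over_iff_elements_mat)+
  qed (use \<phi> matrix_of_endo_minus_one[OF A \<phi>] other.matrix_of_endo_minus_one[OF A' \<phi>] in auto)
  have "A = 1\<^sub>m n + P * S" "A' = 1\<^sub>m m + S * P"
    using A A' unfolding PS(3,4)[symmetric] by (auto simp: matrix_of_endo_def intro!: eq_matI)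
  then show "d = det A" using det_one_plus_mult_commute[OF PS(1,2)] d by simp
qed

end

definition kernel_module :: "'r::comm_ring_1 set \<Rightarrow> nat \<Rightarrow> 'r mat \<Rightarrow> ('r, 'r vec) module" where
  "kernel_module R n A = (free_module R n)\<lparr>carrier := {v \<in> vecs_over R n. A *\<^sub>v v = 0\<^sub>v (dim_row A)}\<rparr>"

lemma kernel_module_simps [simp]:
  "carrier (kernel_module R n A) = {v \<in> vecs_over R n. A *\<^sub>v v = 0\<^sub>v (dim_row A)}"
  "zero (kernel_module R n A) = 0\<^sub>v n"
  "add (kernel_module R n A) = (+)"
  "smult (kernel_module R n A) = (\<cdot>\<^sub>v)"
  by (simp_all add: kernel_module_def)

lemma (in comm_subring) module_kernel_module:
  assumes A: "A \<in> carrier_mat k n"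
  shows "module (ring_on R) (kernel_module R n A)"
proof -
  have A_smult: "A *\<^sub>v (r \<cdot>\<^sub>v v) = r \<cdot>\<^sub>v (A *\<^sub>v v)" if "v \<in> carrier_vec n" for r v
    using A that by (intro eq_vecI) (auto simp: scalar_prod_def sum_distrib_left algebra_simps)
  interpret linear_coordinates R "kernel_module R n A" "{..<n}" "\<lambda>i v. v $ i"
  proof
    show "r \<odot>\<^bsub>kernel_module R n A\<^esub> v \<in> carrier (kernel_module R n A)"
      if "r \<in> R" "v \<in> carrier (kernel_module R n A)" for r v
      using that A by (auto simp: vecs_over_carrier A_smult smult_vec_mem)
    fix v w assume vw: "v \<in> carrier (kernel_module R n A)" "w \<in> carrier (kernel_module R n A)"
    then show "v \<oplus>\<^bsub>kernel_module R n A\<^esub> w \<in> carrier (kernel_module R n A)"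
      using A by (auto simp: vecs_over_carrier mult_add_distrib_mat_vec[OF A])
    show "v = w" if "\<And>i. i \<in> {..<n} \<Longrightarrow> v $ i = w $ i"
      using vw that by (intro eq_vecI) (auto simp: vecs_over_def)
  qed (use A in \<open>auto simp: vecs_over_def\<close>)
  show ?thesis by (rule module_M)
qed

text \<open>The coordinates identify \<open>M\<close> with the image of the idempotent matrix \<open>E\<close>.\<close>

locale projective_coordinates = linear_coordinates R M X f
  for R :: "'r::comm_ring_1 set" and M :: "('r, 'm) module" and X :: "'x set" and f :: "'x \<Rightarrow> 'm \<Rightarrow> 'r" +
  fixes E :: "'x \<Rightarrow> 'x \<Rightarrow> 'r"
  assumes finite_X: "finite X"
    and f_mem: "x \<in> X \<Longrightarrow> m \<in> carrier M \<Longrightarrow> f x m \<in> R"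
    and E_mem: "x \<in> X \<Longrightarrow> y \<in> X \<Longrightarrow> E x y \<in> R"
    and E_f: "x \<in> X \<Longrightarrow> m \<in> carrier M \<Longrightarrow> (\<Sum>y\<in>X. E x y * f y m) = f x m"
    and E_surj: "(\<And>x. x \<in> X \<Longrightarrow> z x \<in> R) \<Longrightarrow> \<exists>m\<in>carrier M. \<forall>x\<in>X. f x m = (\<Sum>y\<in>X. E x y * z y)"
begin

definition coord_vec :: "'m \<Rightarrow> 'r vec" where
  "coord_vec m = vec_on X (\<lambda>x. f x m)"

abbreviation complement :: "('r, 'r vec) module" where
  "complement \<equiv> kernel_module R (card X) (mat_on X E)"

definition complete :: "'m \<times> 'r vec \<Rightarrow> 'r vec" where
  "complete = (\<lambda>(m, q). coord_vec m + q)"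

lemma coord_vec_mem: "m \<in> carrier M \<Longrightarrow> coord_vec m \<in> vecs_over R (card X)"
  by (simp add: coord_vec_def vec_on_mem_iff[OF finite_X] f_mem)

lemma coord_vec_eqD: "m \<in> carrier M \<Longrightarrow> m' \<in> carrier M \<Longrightarrow> coord_vec m = coord_vec m' \<Longrightarrow> m = m'"
  by (intro f_eqI) (simp_all add: coord_vec_def vec_on_eq_iff[OF finite_X])

lemma coord_vec_add:
  "m \<in> carrier M \<Longrightarrow> m' \<in> carrier M \<Longrightarrow> coord_vec (m \<oplus>\<^bsub>M\<^esub> m') = coord_vec m + coord_vec m'"
  by (simp add: coord_vec_def vec_on_add[symmetric] vec_on_eq_iff[OF finite_X] f_add)

lemma coord_vec_smult: "r \<in> R \<Longrightarrow> m \<in> carrier M \<Longrightarrow> coord_vec (r \<odot>\<^bsub>M\<^esub> m) = r \<cdot>\<^sub>v coord_vec m"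
  by (simp add: coord_vec_def vec_on_smult[symmetric] vec_on_eq_iff[OF finite_X] f_smult)

lemma mat_on_E_coord_vec: "m \<in> carrier M \<Longrightarrow> mat_on X E *\<^sub>v coord_vec m = coord_vec m"
  by (simp add: coord_vec_def mat_on_mult_vec_on[OF finite_X] vec_on_eq_iff[OF finite_X] E_f)

lemma mat_on_E_image:
  assumes "v \<in> vecs_over R (card X)"
  obtains m where "m \<in> carrier M" and "mat_on X E *\<^sub>v v = coord_vec m"
proof -
  obtain z where z: "v = vec_on X z" "\<And>x. x \<in> X \<Longrightarrow> z x \<in> R"
    using vecs_over_card_cases[OF finite_X assms] by blast
  then obtain m where "m \<in> carrier M" "\<And>x. x \<in> X \<Longrightarrow> f x m = (\<Sum>y\<in>X. E x y * z y)"
    using E_surj[of z] by blast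
  then show ?thesis
    by (intro that[of m])
      (simp_all add: z(1) coord_vec_def mat_on_mult_vec_on[OF finite_X] vec_on_eq_iff[OF finite_X])
qed

lemma complete_simps:
  assumes "m \<in> carrier M" and "q \<in> carrier complement"
  shows "complete (m, q) \<in> vecs_over R (card X)"
    and "mat_on X E *\<^sub>v complete (m, q) = coord_vec m"
proof -
  have vecs: "coord_vec m \<in> vecs_over R (card X)" "q \<in> vecs_over R (card X)"
    using assms coord_vec_mem by auto
  then show "complete (m, q) \<in> vecs_over R (card X)"
    by (auto simp: complete_def)
  show "mat_on X E *\<^sub>v complete (m, q) = coord_vec m"
    using assms vecs[THEN vecs_over_carrier] mult_add_distrib_mat_vec[OF mat_on_carrier, of "coord_vec m" X q E]
    by (simp add: complete_def mat_on_E_coord_vec)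
qed

lemma bij_betw_complete: "bij_betw complete (carrier M \<times> carrier complement) (vecs_over R (card X))"
  unfolding bij_betw_def
proof (intro conjI inj_onI equalityI subsetI)
  fix p p' assume p: "p \<in> carrier M \<times> carrier complement" "p' \<in> carrier M \<times> carrier complement"
    and eq: "complete p = complete p'"
  obtain m q m' q' where mq: "p = (m, q)" "p' = (m', q')" by (metis surj_pair)
  have "coord_vec m = coord_vec m'"
    using complete_simps(2)[of m q] complete_simps(2)[of m' q'] p eq mq by simp
  then have m: "m = m'" using p mq coord_vec_eqD by auto
  have "q = (coord_vec m + q) - coord_vec m" "q' = (coord_vec m + q') - coord_vec m"
    using p mq m coord_vec_mem[of m] by (auto simp: vecs_over_def)
  then show "p = p'" using eq mq m by (simp add: complete_def)
next
  fix v assume "v \<in> complete ` (carrier M \<times> carrier complement)"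
  then show "v \<in> vecs_over R (card X)" using complete_simps(1) by blast
next
  fix v assume v: "v \<in> vecs_over R (card X)"
  obtain m where m: "m \<in> carrier M" "mat_on X E *\<^sub>v v = coord_vec m" by (rule mat_on_E_image[OF v])
  note vecs = v coord_vec_mem[OF m(1)]
  note carriers = vecs[THEN vecs_over_carrier]
  have "mat_on X E *\<^sub>v (v - coord_vec m) = 0\<^sub>v (card X)"
    using m carriers by (simp add: mult_minus_distrib_mat_vec[OF mat_on_carrier] mat_on_E_coord_vec)
  moreover have "v - coord_vec m \<in> vecs_over R (card X)"
    using vecs by (rule minus_vec_mem)
  ultimately have "v - coord_vec m \<in> carrier complement"
    by simp
  moreover have "v = complete (m, v - coord_vec m)"
    using carriers by (auto simp: complete_def)
  ultimately show "v \<in> complete ` (carrier M \<times> carrier complement)" using m(1) by blast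
qed

lemma complete_hom:
  "complete \<in> module_hom (ring_on R) (direct_sum M complement) (free_module R (card X))"
proof -
  have carrier: "coord_vec m \<in> carrier_vec (card X)" if "m \<in> carrier M" for m
    using coord_vec_mem[OF that] by (rule vecs_over_carrier)
  have "complete (m \<oplus>\<^bsub>M\<^esub> m', q + q') = complete (m, q) + complete (m', q')"
    if "m \<in> carrier M" "m' \<in> carrier M" "q \<in> vecs_over R (card X)" "q' \<in> vecs_over R (card X)" for m m' q q'
    using that that(1,2)[THEN carrier] by (auto simp: complete_def coord_vec_add vecs_over_def)
  moreover have "complete (r \<odot>\<^bsub>M\<^esub> m, r \<cdot>\<^sub>v q) = r \<cdot>\<^sub>v complete (m, q)"
    if "r \<in> R" "m \<in> carrier M" "q \<in> vecs_over R (card X)" for r m q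
    using that that(2)[THEN carrier]
    by (simp add: complete_def coord_vec_smult vecs_over_def smult_add_distrib_vec)
  ultimately show ?thesis
    using complete_simps(1) by (auto simp: LinearCombinations.module_hom_def)
qed

sublocale completed_module R M complement "card X" complete
proof
  have "module (ring_on R) complement" by (rule module_kernel_module[OF mat_on_carrier])
  then show "free_completion R M complement (card X) complete"
    using module_M complete_hom bij_betw_complete by (simp add: free_completion_def)
qed

context
  fixes \<phi> :: "'m \<Rightarrow> 'm" and B :: "'x \<Rightarrow> 'x \<Rightarrow> 'r"
  assumes \<phi>_closed: "\<And>m. m \<in> carrier M \<Longrightarrow> \<phi> m \<in> carrier M"
    and B_mem: "\<And>x y. x \<in> X \<Longrightarrow> y \<in> X \<Longrightarrow> B x y \<in> R"
    and f_\<phi>: "\<And>x m. x \<in> X \<Longrightarrow> m \<in> carrier M \<Longrightarrow> f x (\<phi> m) = (\<Sum>y\<in>X. B x y * f y m)"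
begin

lemma proj_trace_eq_sum: "proj_trace R M \<phi> = (\<Sum>x\<in>X. kernel_mult X B E x x)"
proof -
  let ?A = "mat_on X (kernel_mult X B E)"
  have "?A *\<^sub>v complete (m, q) = coord_vec (\<phi> m)" if "m \<in> carrier M" "q \<in> carrier complement" for m q
  proof -
    note v = complete_simps[OF that]
    have "?A *\<^sub>v complete (m, q) = mat_on X B *\<^sub>v coord_vec m"
      using assoc_mult_mat_vec[OF mat_on_carrier mat_on_carrier v(1)[THEN vecs_over_carrier]] v(2)
      by (simp add: mat_on_mult[OF finite_X, symmetric])
    then show ?thesis
      using that(1)
      by (simp add: coord_vec_def mat_on_mult_vec_on[OF finite_X] vec_on_eq_iff[OF finite_X] f_\<phi>)
  qed
  moreover have "?A \<in> mats_over R (card X) (card X)"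
    by (intro mat_on_mem finite_X) (auto simp: kernel_mult_def B_mem E_mem intro!: sum_mem mult_mem)
  ultimately have "matrix_of_endo R M complement (card X) complete (\<lambda>(m, q). (\<phi> m, \<zero>\<^bsub>complement\<^esub>)) ?A"
    using \<phi>_closed[THEN coord_vec_mem, THEN vecs_over_carrier]
    by (auto simp: matrix_of_endo_def mats_over_iff_elements_mat complete_def)
  from proj_trace_eqI[OF this \<phi>_closed] show ?thesis by (simp add: trace_mat_on[OF finite_X])
qed

lemma proj_det_eq_det_on:
  "proj_det R M \<phi> = det_on X (\<lambda>x y. kronecker x y + kernel_mult X (\<lambda>x y. B x y - kronecker x y) E x y)"
proof -
  let ?N = "\<lambda>x y. B x y - kronecker x y"
  let ?A = "mat_on X (\<lambda>x y. kronecker x y + kernel_mult X ?N E x y)"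
  have "?A *\<^sub>v complete (m, q) = coord_vec (\<phi> m) + q"
    if m: "m \<in> carrier M" and q: "q \<in> carrier complement" for m q
  proof -
    note v = complete_simps[OF m q]
    note carrier = v(1)[THEN vecs_over_carrier]
    have "?A = 1\<^sub>m (card X) + mat_on X ?N * mat_on X E"
      unfolding mat_on_kronecker[OF finite_X, symmetric] mat_on_mult[OF finite_X]
      by (intro eq_matI) (auto simp: mat_on_def)
    then have "?A *\<^sub>v complete (m, q) = complete (m, q) + (mat_on X ?N * mat_on X E) *\<^sub>v complete (m, q)"
      using add_mult_distrib_mat_vec[OF one_carrier_mat mult_carrier_mat[OF mat_on_carrier mat_on_carrier] carrier]
        carrier by simp
    also have "(mat_on X ?N * mat_on X E) *\<^sub>v complete (m, q) = mat_on X ?N *\<^sub>v coord_vec m"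
      using assoc_mult_mat_vec[OF mat_on_carrier mat_on_carrier carrier] v(2) by simp
    also have "\<dots> = coord_vec (\<phi> m) - coord_vec m"
    proof -
      have "mat_on X ?N *\<^sub>v coord_vec m = vec_on X (\<lambda>x. f x (\<phi> m) - f x m)"
        using m finite_X
        by (simp add: coord_vec_def mat_on_mult_vec_on vec_on_eq_iff f_\<phi> left_diff_distrib sum_subtractf)
      then show ?thesis by (auto simp: coord_vec_def vec_on_def)
    qed
    also have "complete (m, q) + (coord_vec (\<phi> m) - coord_vec m) = coord_vec (\<phi> m) + q"
      using q coord_vec_mem[OF m] coord_vec_mem[OF \<phi>_closed[OF m]]
      by (intro eq_vecI) (auto simp: complete_def vecs_over_def)
    finally show ?thesis .
  qed
  moreover have "?A \<in> mats_over R (card X) (card X)"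
    by (intro mat_on_mem finite_X)
      (auto simp: kronecker_def kernel_mult_def B_mem E_mem intro!: add_mem sum_mem mult_mem diff_mem)
  ultimately have "matrix_of_endo R M complement (card X) complete (\<lambda>(m, q). (\<phi> m, q)) ?A"
    by (auto simp: matrix_of_endo_def mats_over_iff_elements_mat complete_def)
  from proj_det_eqI[OF this \<phi>_closed] show ?thesis by (simp add: det_on_def)
qed

end

lemma hs_rank_eq_sum: "hs_rank R M = (\<Sum>x\<in>X. E x x)"
proof -
  have "hs_rank R M = (\<Sum>x\<in>X. kernel_mult X kronecker E x x)"
    unfolding hs_rank_def using finite_X
    by (intro proj_trace_eq_sum) (simp_all, simp add: kronecker_def)
  then show ?thesis using finite_X by (simp add: kernel_mult_def)
qed

end

section \<open>Projective modules of polynomials\<close>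

context projective_coordinates
begin

definition poly_coord :: "'x \<Rightarrow> (nat \<Rightarrow> 'm) \<Rightarrow> 'r poly" where
  "poly_coord x F = Abs_poly (\<lambda>n. f x (F n))"

lemma poly_moduleD: "F \<in> carrier (poly_module M) \<Longrightarrow> F n \<in> carrier M"
  by (simp add: poly_module_def)

lemma coeff_poly_coord:
  assumes F: "F \<in> carrier (poly_module M)" and x: "x \<in> X"
  shows "coeff (poly_coord x F) n = f x (F n)"
proof -
  obtain k where k: "\<And>n. F n \<noteq> \<zero>\<^bsub>M\<^esub> \<Longrightarrow> n \<le> k"
    using F by (auto simp: poly_module_def finite_nat_set_iff_bounded_le)
  have "f x (F n) = 0" if "k < n" for n
    using k[of n] that x f_zero by fastforce
  from coeff_Abs_poly[of k "\<lambda>n. f x (F n)", OF this] show ?thesis by (simp add: poly_coord_def)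
qed

lemma poly_moduleI:
  assumes closed: "\<And>n. F n \<in> carrier M"
    and coeff: "\<And>n x. x \<in> X \<Longrightarrow> f x (F n) = coeff (p x) n"
  shows "F \<in> carrier (poly_module M)" and "x \<in> X \<Longrightarrow> poly_coord x F = p x"
proof -
  obtain k where k: "\<And>x. x \<in> X \<Longrightarrow> degree (p x) \<le> k"
    using finite_nat_set_iff_bounded_le[of "(\<lambda>x. degree (p x)) ` X"] finite_X by auto
  have "F n = \<zero>\<^bsub>M\<^esub>" if "k < n" for n
    using closed zero_closed
  proof (rule f_eqI)
    fix x assume x: "x \<in> X"
    then have "degree (p x) < n" using k that by (meson le_less_trans)
    then show "f x (F n) = f x \<zero>\<^bsub>M\<^esub>" using x by (simp add: coeff f_zero coeff_eq_0)
  qed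
  then have "{n. F n \<noteq> \<zero>\<^bsub>M\<^esub>} \<subseteq> {..k}" by (force simp: not_less[symmetric])
  then show mem: "F \<in> carrier (poly_module M)"
    using closed finite_subset[of _ "{..k}"] by (simp add: poly_module_def)
  show "x \<in> X \<Longrightarrow> poly_coord x F = p x"
    by (rule poly_eqI) (simp add: coeff_poly_coord[OF mem] coeff)
qed

lemma poly_module_series_endo:
  assumes \<Phi>: "\<And>i m. m \<in> carrier M \<Longrightarrow> \<Phi> i m \<in> carrier M"
    and B: "\<And>i x m. x \<in> X \<Longrightarrow> m \<in> carrier M \<Longrightarrow> f x (\<Phi> i m) = (\<Sum>y\<in>X. coeff (B x y) i * f y m)"
    and F: "F \<in> carrier (poly_module M)"
  shows "series_endo M \<Phi> F \<in> carrier (poly_module M)"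
    and "x \<in> X \<Longrightarrow> poly_coord x (series_endo M \<Phi> F) = (\<Sum>y\<in>X. B x y * poly_coord y F)"
proof -
  have closed: "series_endo M \<Phi> F n \<in> carrier M" for n
    using \<Phi> F by (intro series_endo_closed) (auto dest: poly_moduleD)
  have coeff: "f x (series_endo M \<Phi> F n) = coeff (\<Sum>y\<in>X. B x y * poly_coord y F) n" if x: "x \<in> X" for x n
  proof -
    have "f x (series_endo M \<Phi> F n) = (\<Sum>i\<le>n. \<Sum>y\<in>X. coeff (B x y) i * f y (F (n - i)))"
      using x F \<Phi> by (simp add: f_series_endo poly_moduleD B)
    also have "\<dots> = (\<Sum>y\<in>X. \<Sum>i\<le>n. coeff (B x y) i * coeff (poly_coord y F) (n - i))"
      by (subst sum.swap) (simp add: coeff_poly_coord[OF F])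
    also have "\<dots> = coeff (\<Sum>y\<in>X. B x y * poly_coord y F) n"
      by (simp add: coeff_sum coeff_mult)
    finally show ?thesis .
  qed
  show "series_endo M \<Phi> F \<in> carrier (poly_module M)"
    using closed coeff by (rule poly_moduleI(1))
  show "x \<in> X \<Longrightarrow> poly_coord x (series_endo M \<Phi> F) = (\<Sum>y\<in>X. B x y * poly_coord y F)"
    using closed coeff by (rule poly_moduleI(2))
qed

lemma poly_module_smult:
  assumes p: "p \<in> polys_over R" and F: "F \<in> carrier (poly_module M)"
  shows "p \<odot>\<^bsub>poly_module M\<^esub> F \<in> carrier (poly_module M)"
    and "x \<in> X \<Longrightarrow> poly_coord x (p \<odot>\<^bsub>poly_module M\<^esub> F) = p * poly_coord x F"
proof -
  let ?B = "\<lambda>x y. kronecker x y * p"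
  have smult: "p \<odot>\<^bsub>poly_module M\<^esub> F = series_endo M (\<lambda>i m. coeff p i \<odot>\<^bsub>M\<^esub> m) F"
    by (simp add: poly_module_def)
  have closed: "coeff p i \<odot>\<^bsub>M\<^esub> m \<in> carrier M" if "m \<in> carrier M" for i m
    using p that by (simp add: polys_over_def smult_closed)
  have coord: "f x (coeff p i \<odot>\<^bsub>M\<^esub> m) = (\<Sum>y\<in>X. coeff (?B x y) i * f y m)"
    if "x \<in> X" "m \<in> carrier M" for i x m
  proof -
    have "(\<Sum>y\<in>X. coeff (?B x y) i * f y m) = (\<Sum>y\<in>X. kronecker x y * (coeff p i * f y m))"
      by (intro sum.cong) (auto simp: kronecker_def)
    then show ?thesis using p that finite_X by (simp add: f_smult polys_over_def)
  qed
  show "p \<odot>\<^bsub>poly_module M\<^esub> F \<in> carrier (poly_module M)"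
    unfolding smult by (rule poly_module_series_endo(1)[OF closed coord F])
  show "poly_coord x (p \<odot>\<^bsub>poly_module M\<^esub> F) = p * poly_coord x F" if "x \<in> X"
  proof -
    have "poly_coord x (p \<odot>\<^bsub>poly_module M\<^esub> F) = (\<Sum>y\<in>X. ?B x y * poly_coord y F)"
      unfolding smult by (rule poly_module_series_endo(2)[OF closed coord F that])
    then show ?thesis using that finite_X by (simp add: mult.assoc)
  qed
qed

lemma poly_module_add:
  assumes F: "F \<in> carrier (poly_module M)" and G: "G \<in> carrier (poly_module M)"
  shows "F \<oplus>\<^bsub>poly_module M\<^esub> G \<in> carrier (poly_module M)"
    and "x \<in> X \<Longrightarrow> poly_coord x (F \<oplus>\<^bsub>poly_module M\<^esub> G) = poly_coord x F + poly_coord x G"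
proof -
  have closed: "(F \<oplus>\<^bsub>poly_module M\<^esub> G) n \<in> carrier M" for n
    using F G by (simp add: poly_module_def add_closed)
  have coeff: "f x ((F \<oplus>\<^bsub>poly_module M\<^esub> G) n) = coeff (poly_coord x F + poly_coord x G) n"
    if "x \<in> X" for x n
    using F G that by (simp add: coeff_poly_coord) (simp add: poly_module_def f_add)
  show "F \<oplus>\<^bsub>poly_module M\<^esub> G \<in> carrier (poly_module M)"
    using closed coeff by (rule poly_moduleI(1))
  show "x \<in> X \<Longrightarrow> poly_coord x (F \<oplus>\<^bsub>poly_module M\<^esub> G) = poly_coord x F + poly_coord x G"
    using closed coeff by (rule poly_moduleI(2))
qed

lemma projective_coordinates_poly_module:
  "projective_coordinates (polys_over R) (poly_module M) X poly_coord (\<lambda>x y. [:E x y:])"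
proof -
  interpret P: comm_subring "polys_over R" by (rule comm_subring_polys_over)
  show ?thesis
  proof
    show "\<zero>\<^bsub>poly_module M\<^esub> \<in> carrier (poly_module M)"
      by (simp add: poly_module_def zero_closed)
    show "poly_coord x \<zero>\<^bsub>poly_module M\<^esub> = 0" if "x \<in> X" for x
      using that by (simp add: poly_coord_def poly_module_def f_zero zero_poly_def)
    fix F assume F: "F \<in> carrier (poly_module M)"
    show "poly_coord x F \<in> polys_over R" if "x \<in> X" for x
      using that F by (simp add: polys_over_def coeff_poly_coord f_mem poly_moduleD)
    show "(\<Sum>y\<in>X. [:E x y:] * poly_coord y F) = poly_coord x F" if "x \<in> X" for x
      using that F by (intro poly_eqI) (simp add: coeff_sum coeff_poly_coord E_f poly_moduleD)
    show "F = G" if G: "G \<in> carrier (poly_module M)"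
      and eq: "\<And>x. x \<in> X \<Longrightarrow> poly_coord x F = poly_coord x G" for G
    proof
      fix n
      show "F n = G n"
        using poly_moduleD[OF F] poly_moduleD[OF G]
        by (rule f_eqI) (simp add: coeff_poly_coord[OF F, symmetric] coeff_poly_coord[OF G, symmetric] eq)
    qed
  next
    fix z :: "'x \<Rightarrow> 'r poly" assume z: "\<And>x. x \<in> X \<Longrightarrow> z x \<in> polys_over R"
    have "\<exists>m\<in>carrier M. \<forall>x\<in>X. f x m = (\<Sum>y\<in>X. E x y * coeff (z y) n)" for n
      using z by (intro E_surj) (auto simp: polys_over_def)
    then obtain F where F: "\<And>n. F n \<in> carrier M"
      "\<And>n x. x \<in> X \<Longrightarrow> f x (F n) = (\<Sum>y\<in>X. E x y * coeff (z y) n)" by metis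
    have coeff: "f x (F n) = coeff (\<Sum>y\<in>X. [:E x y:] * z y) n" if "x \<in> X" for x n
      using F(2)[OF that] by (simp add: coeff_sum)
    show "\<exists>F\<in>carrier (poly_module M). \<forall>x\<in>X. poly_coord x F = (\<Sum>y\<in>X. [:E x y:] * z y)"
      using poly_moduleI[OF F(1) coeff] by blast
  qed (auto intro: poly_module_add poly_module_smult finite_X const_poly_mem_polys_over E_mem)
qed

lemma proj_det_series_endo:
  assumes \<Phi>: "\<And>i m. m \<in> carrier M \<Longrightarrow> \<Phi> i m \<in> carrier M"
    and B_mem: "\<And>x y. x \<in> X \<Longrightarrow> y \<in> X \<Longrightarrow> B x y \<in> polys_over R"
    and B: "\<And>i x m. x \<in> X \<Longrightarrow> m \<in> carrier M \<Longrightarrow> f x (\<Phi> i m) = (\<Sum>y\<in>X. coeff (B x y) i * f y m)"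
  shows "proj_det (polys_over R) (poly_module M) (series_endo M \<Phi>) =
    det_on X (\<lambda>x y. kronecker x y + kernel_mult X (\<lambda>x y. B x y - kronecker x y) (\<lambda>x y. [:E x y:]) x y)"
  by (rule projective_coordinates.proj_det_eq_det_on[OF projective_coordinates_poly_module])
    (auto intro: poly_module_series_endo[OF \<Phi> B] B_mem)

end

section \<open>Group algebras and characters of finite abelian groups\<close>

lemma lookup_single_mult:
  fixes b :: "'g::ab_group_add \<Rightarrow>\<^sub>0 'c::comm_ring_1"
  shows "lookup (single g c * b) k = c * lookup b (k - g)"
proof -
  have "k = l + q \<longleftrightarrow> q = k - l" for l q :: 'g by (auto simp: algebra_simps)
  then have "lookup (single g c * b) k =
      (\<Sum>l. (c when g = l) * (\<Sum>q. lookup b q when q = k - l))"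
    by (simp add: lookup_mult lookup_single)
  also have "\<dots> = (\<Sum>l. (c * lookup b (k - l) when g = l))"
    by (simp add: when_mult)
  also have "\<dots> = c * lookup b (k - g)"
    by simp
  finally show ?thesis .
qed

lemma lookup_eq_0_if_keys_subset: "keys c \<subseteq> X \<Longrightarrow> x \<notin> X \<Longrightarrow> lookup c x = 0"
  by (metis in_keys_iff subsetD)

lemma group_alg_iff: "a \<in> group_alg K \<longleftrightarrow> (\<forall>k. k \<notin> K \<longrightarrow> lookup a k = 0)"
  by (auto simp: group_alg_def in_keys_iff)

lemma group_alg_mono: "H \<subseteq> G \<Longrightarrow> a \<in> group_alg H \<Longrightarrow> a \<in> group_alg G"
  by (auto simp: group_alg_def)

lemma group_alg_eqI:
  "a \<in> group_alg K \<Longrightarrow> b \<in> group_alg K \<Longrightarrow> (\<And>k. k \<in> K \<Longrightarrow> lookup a k = lookup b k) \<Longrightarrow> a = b"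
  by (rule poly_mapping_eqI) (metis group_alg_iff)

lemma group_alg_poly_eq: "group_alg_poly K = polys_over (group_alg K)"
  by (simp add: group_alg_poly_def polys_over_def)

lemma group_alg_fps_eq: "group_alg_fps K = fps_over (group_alg K)"
  by (simp add: group_alg_fps_def fps_over_def)

definition chars :: "'g::ab_group_add set \<Rightarrow> ('g \<Rightarrow> complex) set" where
  "chars K = {\<psi> \<in> extensional K. \<psi> 0 = 1 \<and> (\<forall>g\<in>K. \<forall>h\<in>K. \<psi> (g + h) = \<psi> g * \<psi> h)}"

definition char_eval :: "'g::ab_group_add set \<Rightarrow> ('g \<Rightarrow> complex) \<Rightarrow> ('g \<Rightarrow>\<^sub>0 complex) \<Rightarrow> complex" where
  "char_eval K \<psi> a = (\<Sum>k\<in>K. lookup a k * \<psi> k)"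

definition char_eval_fps ::
  "'g::ab_group_add set \<Rightarrow> ('g \<Rightarrow> complex) \<Rightarrow> ('g \<Rightarrow>\<^sub>0 complex) fps \<Rightarrow> complex fps" where
  "char_eval_fps K \<psi> F = Abs_fps (\<lambda>n. char_eval K \<psi> (fps_nth F n))"

definition mean_element :: "'g::ab_group_add set \<Rightarrow> ('g \<Rightarrow> complex) \<Rightarrow> 'g \<Rightarrow>\<^sub>0 complex" where
  "mean_element K w = (\<Sum>k\<in>K. single k (w k / of_nat (card K)))"

definition char_idem :: "'g::ab_group_add set \<Rightarrow> ('g \<Rightarrow> complex) \<Rightarrow> 'g \<Rightarrow>\<^sub>0 complex" where
  "char_idem K \<psi> = mean_element K (\<lambda>k. \<psi> (- k))"

locale finite_add_group =
  fixes K :: "'g::ab_group_add set"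
  assumes finite_K [simp, intro]: "finite K" and zero_K [simp, intro]: "0 \<in> K"
    and add_K [intro]: "g \<in> K \<Longrightarrow> h \<in> K \<Longrightarrow> g + h \<in> K"
    and uminus_K [intro]: "g \<in> K \<Longrightarrow> - g \<in> K"
begin

lemma diff_K [intro]: "g \<in> K \<Longrightarrow> h \<in> K \<Longrightarrow> g - h \<in> K"
  using add_K[of g "- h"] by auto

lemma K_nonempty [simp]: "K \<noteq> {}"
  using zero_K by blast

lemma card_K_pos: "card K > 0"
  by (simp add: card_gt_0_iff)

lemma bij_betw_translate: "g \<in> K \<Longrightarrow> bij_betw (\<lambda>k. g + k) K K"
  by (rule bij_betw_byWitness[where f' = "\<lambda>k. k - g"]) auto

lemma sum_translate: "g \<in> K \<Longrightarrow> (\<Sum>k\<in>K. F (g + k)) = (\<Sum>k\<in>K. F k)"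
  by (rule sum.reindex_bij_betw[OF bij_betw_translate])

lemma sum_reflect:
  assumes "g \<in> K"
  shows "(\<Sum>k\<in>K. F (g - k)) = (\<Sum>k\<in>K. F k)"
proof -
  have "bij_betw (\<lambda>k. g - k) K K"
    by (rule bij_betw_byWitness[where f' = "\<lambda>k. g - k"]) (use assms in auto)
  then show ?thesis by (rule sum.reindex_bij_betw)
qed

lemma sum_uminus: "(\<Sum>k\<in>K. F (- k)) = (\<Sum>k\<in>K. F k)"
  using sum_reflect[of 0] by simp

lemma power_card_eq_one:
  fixes \<tau> :: "'g \<Rightarrow> 'a::comm_monoid_mult"
  assumes mult: "\<And>g h. g \<in> K \<Longrightarrow> h \<in> K \<Longrightarrow> \<tau> (g + h) = \<tau> g * \<tau> h" and one: "\<tau> 0 = 1"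
    and g: "g \<in> K"
  shows "\<tau> g ^ card K = 1"
proof -
  have "prod \<tau> K = (\<Prod>k\<in>K. \<tau> (g + k))"
    by (rule prod.reindex_bij_betw[OF bij_betw_translate[OF g], symmetric])
  also have "\<dots> = \<tau> g ^ card K * prod \<tau> K"
    using g by (simp add: mult prod.distrib)
  finally have "prod \<tau> K * (\<Prod>k\<in>K. \<tau> (- k)) = \<tau> g ^ card K * (prod \<tau> K * (\<Prod>k\<in>K. \<tau> (- k)))"
    by (metis mult.assoc)
  moreover have "prod \<tau> K * (\<Prod>k\<in>K. \<tau> (- k)) = 1"
    unfolding prod.distrib[symmetric] by (intro prod.neutral) (simp add: mult[symmetric] uminus_K one)
  ultimately show ?thesis by simp
qed

lemma lookup_group_alg_mult:
  assumes "a \<in> group_alg K"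
  shows "lookup (a * b) k = (\<Sum>g\<in>K. lookup a g * lookup b (k - g))"
proof -
  have "a = (\<Sum>g\<in>K. single g (lookup a g))"
    by (rule poly_mapping_eqI)
      (use assms in \<open>auto simp: lookup_sum lookup_single when_def group_alg_iff\<close>)
  then have "lookup (a * b) k = lookup ((\<Sum>g\<in>K. single g (lookup a g)) * b) k" by simp
  also have "\<dots> = (\<Sum>g\<in>K. lookup a g * lookup b (k - g))"
    by (simp add: sum_distrib_right lookup_sum lookup_single_mult)
  finally show ?thesis .
qed

sublocale A: comm_subring "group_alg K"
proof
  fix a b assume a: "a \<in> group_alg K" and b: "b \<in> group_alg K"
  have "k - g \<notin> K" if "k \<notin> K" "g \<in> K" for k g
    using that add_K[of "k - g" g] by auto
  then show "a * b \<in> group_alg K"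
    using a b by (auto simp: group_alg_iff lookup_group_alg_mult[OF a])
qed (auto simp: group_alg_iff lookup_one lookup_add when_def)

lemma single_mem [intro]: "k \<in> K \<Longrightarrow> single k c \<in> group_alg K"
  by (auto simp: group_alg_iff lookup_single when_def)

lemma scalar_mem [simp, intro]: "scalar c \<in> group_alg K"
  by (rule single_mem) simp

lemma mean_element_mem [simp, intro]: "mean_element K w \<in> group_alg K"
  unfolding mean_element_def by (intro A.sum_mem single_mem)

lemma lookup_mean_element: "lookup (mean_element K w) k = (if k \<in> K then w k / of_nat (card K) else 0)"
  by (simp add: mean_element_def lookup_sum lookup_single when_def)

lemma mean_element_cong: "(\<And>k. k \<in> K \<Longrightarrow> w k = w' k) \<Longrightarrow> mean_element K w = mean_element K w'"
  by (rule poly_mapping_eqI) (simp add: lookup_mean_element)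

lemma mean_element_sum: "(\<Sum>i\<in>I. mean_element K (w i)) = mean_element K (\<lambda>k. \<Sum>i\<in>I. w i k)"
  by (rule poly_mapping_eqI) (simp add: lookup_sum lookup_mean_element sum_divide_distrib)

subsection \<open>Characters\<close>

lemma char_mult: "\<psi> \<in> chars K \<Longrightarrow> g \<in> K \<Longrightarrow> h \<in> K \<Longrightarrow> \<psi> (g + h) = \<psi> g * \<psi> h"
  by (simp add: chars_def)

lemma char_zero: "\<psi> \<in> chars K \<Longrightarrow> \<psi> 0 = 1"
  by (simp add: chars_def)

lemma char_uminus: "\<psi> \<in> chars K \<Longrightarrow> g \<in> K \<Longrightarrow> \<psi> g * \<psi> (- g) = 1"
  using char_mult[of \<psi> g "- g"] uminus_K[of g] by (simp add: char_zero)

lemma char_eqI: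
  "\<psi> \<in> chars K \<Longrightarrow> \<phi> \<in> chars K \<Longrightarrow> (\<And>g. g \<in> K \<Longrightarrow> \<psi> g = \<phi> g) \<Longrightarrow> \<psi> = \<phi>"
  by (auto simp: chars_def intro: extensionalityI)

lemma chars_subset: "chars K \<subseteq> K \<rightarrow>\<^sub>E {z. z ^ card K = 1}"
  using power_card_eq_one by (auto simp: PiE_def chars_def)

lemma finite_roots_unity_card_K [simp, intro]: "finite {z :: complex. z ^ card K = 1}"
  using card_K_pos by (intro finite_roots_unity) simp

lemma finite_chars [simp, intro]: "finite (chars K)"
  by (rule finite_subset[OF chars_subset]) (auto intro!: finite_PiE)

lemma char_orthogonality:
  assumes \<psi>: "\<psi> \<in> chars K" and \<phi>: "\<phi> \<in> chars K"
  shows "(\<Sum>g\<in>K. \<psi> g * \<phi> (- g)) = (if \<psi> = \<phi> then of_nat (card K) else 0)"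
proof (cases "\<psi> = \<phi>")
  case True
  then show ?thesis using \<psi> by (simp add: char_uminus)
next
  case False
  then obtain h where h: "h \<in> K" "\<psi> h \<noteq> \<phi> h" using char_eqI[OF \<psi> \<phi>] by blast
  let ?S = "\<Sum>g\<in>K. \<psi> g * \<phi> (- g)"
  have shift: "\<phi> (- (h + g)) = \<phi> (- h) * \<phi> (- g)" if "g \<in> K" for g
    using char_mult[OF \<phi> uminus_K[OF h(1)] uminus_K[OF that]] by simp
  have "?S = (\<Sum>g\<in>K. \<psi> (h + g) * \<phi> (- (h + g)))"
    by (rule sum_translate[OF h(1), symmetric])
  also have "\<dots> = (\<Sum>g\<in>K. (\<psi> h * \<phi> (- h)) * (\<psi> g * \<phi> (- g)))"
    by (rule sum.cong[OF refl]) (simp add: char_mult[OF \<psi> h(1)] shift del: minus_add_distrib)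
  also have "\<dots> = (\<psi> h * \<phi> (- h)) * ?S" by (rule sum_distrib_left[symmetric])
  finally have "?S = (\<psi> h * \<phi> (- h)) * ?S" .
  moreover have "\<psi> h * \<phi> (- h) \<noteq> 1"
    using char_uminus[OF \<phi> h(1)] h(2) by (metis mult.commute mult.left_neutral mult.left_commute)
  ultimately show ?thesis using False by simp
qed

end

lemma sum_power_roots_unity:
  assumes j: "0 < j" "j < n"
  shows "(\<Sum>z | z ^ n = 1. z ^ j) = (0 :: complex)"
proof -
  let ?U = "{z :: complex. z ^ n = 1}"
  have "\<not> ?U \<subseteq> {z. z ^ j = 1}"
  proof
    assume "?U \<subseteq> {z. z ^ j = 1}"
    then have "card ?U \<le> card {z :: complex. z ^ j = 1}"
      using j by (intro card_mono finite_roots_unity) auto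
    then show False using card_roots_unity_eq[of n] card_roots_unity_eq[of j] j by simp
  qed
  then obtain w where w: "w \<in> ?U" "w ^ j \<noteq> 1" by auto
  then have "w \<noteq> 0" using j by (auto simp: power_0_left)
  then have "bij_betw (\<lambda>z. w * z) ?U ?U"
    using w by (intro bij_betw_byWitness[where f' = "\<lambda>z. z / w"])
      (auto simp: power_mult_distrib power_divide)
  from sum.reindex_bij_betw[OF this, of "\<lambda>z. z ^ j"]
  have "(\<Sum>z\<in>?U. z ^ j) = w ^ j * (\<Sum>z\<in>?U. z ^ j)"
    by (simp add: power_mult_distrib sum_distrib_left)
  with w show ?thesis by simp
qed

lemma scalar_sum: "scalar (sum f I) = (\<Sum>i\<in>I. scalar (f i))"
  by (induction I rule: infinite_finite_induct) (auto simp: single_add)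

lemma scalar_mult: "scalar (a * b) = scalar a * scalar b"
  by (simp add: mult_single)

lemma single_power: "single g c ^ j = scalar (c ^ j) * single g 1 ^ j"
  for g :: "'g::ab_group_add" and c :: complex
proof (induction j)
  case (Suc j)
  have "single g c ^ Suc j = (scalar c * single g 1) * (scalar (c ^ j) * single g 1 ^ j)"
    by (simp add: Suc mult_single)
  also have "\<dots> = (scalar c * scalar (c ^ j)) * single g 1 ^ Suc j"
    by (simp add: mult_ac)
  finally show ?case by (simp add: mult_single)
qed simp

subsection \<open>Completeness of the characters\<close>

text \<open>
  For each \<open>g\<close> the idempotents \<open>cyclic_idem g c\<close> of the cyclic group generated by \<open>g\<close> sum to \<open>1\<close>.
  Expanding the product over all \<open>g\<close> writes \<open>1\<close> as a sum of simultaneous eigenvectors, and a nonzero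
  simultaneous eigenvector determines a character.
\<close>

context finite_add_group
begin

definition cyclic_idem :: "'g \<Rightarrow> complex \<Rightarrow> 'g \<Rightarrow>\<^sub>0 complex" where
  "cyclic_idem g c = scalar (1 / of_nat (card K)) * (\<Sum>j<card K. single g c ^ j)"

definition joint_idem :: "('g \<Rightarrow> complex) \<Rightarrow> 'g \<Rightarrow>\<^sub>0 complex" where
  "joint_idem c = (\<Prod>g\<in>K. cyclic_idem g (c g))"

lemma single_mult_cyclic_idem:
  assumes g: "g \<in> K" and c: "c ^ card K = 1"
  shows "single g c * cyclic_idem g c = cyclic_idem g c"
proof -
  have "single g (1 :: complex) ^ card K = 1"
    using g by (intro power_card_eq_one) (auto simp: mult_single)
  then have "single g c ^ card K = 1"
    using c single_power[of g c "card K"] by simp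
  then have "(single g c - 1) * (\<Sum>j<card K. single g c ^ j) = 0"
    using power_diff_1_eq[of "single g c" "card K"] by (simp add: mult.commute)
  then have "single g c * (\<Sum>j<card K. single g c ^ j) = (\<Sum>j<card K. single g c ^ j)"
    by (simp add: algebra_simps)
  then show ?thesis unfolding cyclic_idem_def by (metis mult.left_commute)
qed

lemma sum_cyclic_idem: "(\<Sum>c | c ^ card K = 1. cyclic_idem g c) = 1"
proof -
  let ?U = "{c :: complex. c ^ card K = 1}"
  have "(\<Sum>c\<in>?U. cyclic_idem g c) =
      scalar (1 / of_nat (card K)) * (\<Sum>c\<in>?U. \<Sum>j<card K. scalar (c ^ j) * single g 1 ^ j)"
    unfolding cyclic_idem_def sum_distrib_left[symmetric]
    by (intro arg_cong[of _ _ "(*) _"] sum.cong refl single_power)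
  also have "(\<Sum>c\<in>?U. \<Sum>j<card K. scalar (c ^ j) * single g 1 ^ j) =
      (\<Sum>j<card K. scalar (\<Sum>c\<in>?U. c ^ j) * single g 1 ^ j)"
    by (subst sum.swap) (simp add: scalar_sum sum_distrib_right)
  also have "\<dots> = (\<Sum>j<card K. if j = 0 then scalar (of_nat (card K)) else 0)"
  proof (rule sum.cong[OF refl])
    fix j assume "j \<in> {..<card K}"
    then show "scalar (\<Sum>c\<in>?U. c ^ j) * single g 1 ^ j = (if j = 0 then scalar (of_nat (card K)) else 0)"
      using sum_power_roots_unity[of j "card K"] card_roots_unity_eq[OF card_K_pos] by (cases "j = 0") auto
  qed
  also have "\<dots> = scalar (of_nat (card K))" using card_K_pos by simp
  also have "scalar (1 / of_nat (card K)) * scalar (of_nat (card K)) = (1 :: 'g \<Rightarrow>\<^sub>0 complex)"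
    unfolding mult_single by simp
  finally show ?thesis .
qed

lemma sum_joint_idem: "(\<Sum>c\<in>K \<rightarrow>\<^sub>E {z. z ^ card K = 1}. joint_idem c) = 1"
  using prod_sum_PiE[of K "\<lambda>_. {z. z ^ card K = 1}" cyclic_idem]
  by (simp add: joint_idem_def sum_cyclic_idem)

lemma lookup_joint_idem_add:
  assumes c: "c \<in> K \<rightarrow>\<^sub>E {z. z ^ card K = 1}" and g: "g \<in> K"
  shows "lookup (joint_idem c) (h + g) = c g * lookup (joint_idem c) h"
proof -
  have "joint_idem c = cyclic_idem g (c g) * (\<Prod>k\<in>K - {g}. cyclic_idem k (c k))"
    using g by (simp add: joint_idem_def prod.remove[of K g])
  moreover have "single g (c g) * cyclic_idem g (c g) = cyclic_idem g (c g)"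
    using c g by (intro single_mult_cyclic_idem) auto
  ultimately have "single g (c g) * joint_idem c = joint_idem c" by (metis mult.assoc)
  then have "lookup (joint_idem c) (h + g) = lookup (single g (c g) * joint_idem c) (h + g)" by simp
  then show ?thesis by (simp add: lookup_single_mult)
qed

lemma char_if_joint_idem_nonzero:
  assumes c: "c \<in> K \<rightarrow>\<^sub>E {z. z ^ card K = 1}" and nz: "lookup (joint_idem c) 0 \<noteq> 0"
  shows "c \<in> chars K"
proof -
  have "c 0 = 1" using lookup_joint_idem_add[OF c zero_K, of 0] nz by simp
  moreover have "c (g + h) = c g * c h" if g: "g \<in> K" and h: "h \<in> K" for g h
    using lookup_joint_idem_add[OF c add_K[OF g h], of 0] lookup_joint_idem_add[OF c h, of g]
      lookup_joint_idem_add[OF c g, of 0] nz by (simp add: mult.commute[of "c g"])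
  ultimately show ?thesis using c by (auto simp: chars_def PiE_def)
qed

lemma delta_combination_of_chars:
  assumes "g \<in> K"
  shows "(\<Sum>\<psi>\<in>chars K. lookup (joint_idem \<psi>) 0 * \<psi> g) = (if g = 0 then 1 else 0)"
proof -
  let ?P = "K \<rightarrow>\<^sub>E {z :: complex. z ^ card K = 1}"
  have "(\<Sum>\<psi>\<in>chars K. lookup (joint_idem \<psi>) 0 * \<psi> g) = (\<Sum>c\<in>?P. lookup (joint_idem c) 0 * c g)"
    using chars_subset char_if_joint_idem_nonzero
    by (intro sum.mono_neutral_left) (auto intro!: finite_PiE)
  also have "\<dots> = (\<Sum>c\<in>?P. lookup (joint_idem c) g)"
    using lookup_joint_idem_add[OF _ assms, of _ 0] by (intro sum.cong) (auto simp: mult.commute)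
  also have "\<dots> = (if g = 0 then 1 else 0)"
    unfolding lookup_sum[symmetric] sum_joint_idem by (simp add: lookup_one when_def)
  finally show ?thesis .
qed

lemma sum_chars:
  assumes "g \<in> K"
  shows "(\<Sum>\<psi>\<in>chars K. \<psi> g) = (if g = 0 then of_nat (card K) else 0)"
proof -
  define \<alpha> where "\<alpha> \<psi> = lookup (joint_idem \<psi>) 0" for \<psi>
  have "\<alpha> \<phi> * of_nat (card K) = 1" if \<phi>: "\<phi> \<in> chars K" for \<phi>
  proof -
    have "1 = (\<Sum>g\<in>K. (if g = 0 then 1 else 0) * \<phi> (- g))"
      using char_zero[OF \<phi>] by (simp add: if_distrib[of "\<lambda>x. x * _"] cong: if_cong)
    also have "\<dots> = (\<Sum>g\<in>K. (\<Sum>\<psi>\<in>chars K. \<alpha> \<psi> * \<psi> g) * \<phi> (- g))"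
      using delta_combination_of_chars by (intro sum.cong) (auto simp: \<alpha>_def)
    also have "\<dots> = (\<Sum>\<psi>\<in>chars K. \<alpha> \<psi> * (\<Sum>g\<in>K. \<psi> g * \<phi> (- g)))"
      unfolding sum_distrib_right sum_distrib_left mult.assoc by (rule sum.swap)
    also have "\<dots> = (\<Sum>\<psi>\<in>chars K. if \<psi> = \<phi> then \<alpha> \<phi> * of_nat (card K) else 0)"
      using \<phi> by (intro sum.cong) (auto simp: char_orthogonality)
    also have "\<dots> = \<alpha> \<phi> * of_nat (card K)" using \<phi> by simp
    finally show ?thesis ..
  qed
  then have "(\<Sum>\<psi>\<in>chars K. \<psi> g) = (\<Sum>\<psi>\<in>chars K. of_nat (card K) * (\<alpha> \<psi> * \<psi> g))"
    by (intro sum.cong) (auto simp: mult.assoc[symmetric] mult.commute[of "of_nat _"])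
  also have "\<dots> = of_nat (card K) * (\<Sum>\<psi>\<in>chars K. \<alpha> \<psi> * \<psi> g)"
    by (simp add: sum_distrib_left)
  finally show ?thesis using delta_combination_of_chars[OF assms] by (simp add: \<alpha>_def)
qed

subsection \<open>Evaluation at characters\<close>

lemma char_eval_zero [simp]: "char_eval K \<psi> 0 = 0"
  by (simp add: char_eval_def)

lemma char_eval_add: "char_eval K \<psi> (a + b) = char_eval K \<psi> a + char_eval K \<psi> b"
  by (simp add: char_eval_def lookup_add algebra_simps sum.distrib)

lemma char_eval_uminus: "char_eval K \<psi> (- a) = - char_eval K \<psi> a"
  by (simp add: char_eval_def sum_negf)

lemma char_eval_diff: "char_eval K \<psi> (a - b) = char_eval K \<psi> a - char_eval K \<psi> b"
  by (simp add: char_eval_def lookup_minus algebra_simps sum_subtractf)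

lemma char_eval_sum: "char_eval K \<psi> (sum f I) = (\<Sum>i\<in>I. char_eval K \<psi> (f i))"
  by (induction I rule: infinite_finite_induct) (auto simp: char_eval_add)

lemma char_eval_single: "k \<in> K \<Longrightarrow> char_eval K \<psi> (single k c) = c * \<psi> k"
  by (simp add: char_eval_def lookup_single when_def if_distrib[of "\<lambda>x. x * _"] cong: if_cong)

lemma char_eval_scalar: "\<psi> \<in> chars K \<Longrightarrow> char_eval K \<psi> (scalar c) = c"
  by (simp add: char_eval_single char_zero)

lemma char_eval_one: "\<psi> \<in> chars K \<Longrightarrow> char_eval K \<psi> 1 = 1"
  using char_eval_scalar[of \<psi> 1] by simp

lemma char_eval_mean_element:
  "char_eval K \<psi> (mean_element K w) = (\<Sum>k\<in>K. w k * \<psi> k) / of_nat (card K)"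
  by (simp add: char_eval_def lookup_mean_element sum_divide_distrib)

lemma char_eval_mult:
  assumes \<psi>: "\<psi> \<in> chars K" and a: "a \<in> group_alg K" and b: "b \<in> group_alg K"
  shows "char_eval K \<psi> (a * b) = char_eval K \<psi> a * char_eval K \<psi> b"
proof -
  have shift: "(\<Sum>k\<in>K. lookup b (k - g) * \<psi> k) = \<psi> g * char_eval K \<psi> b" if g: "g \<in> K" for g
  proof -
    have "(\<Sum>k\<in>K. lookup b (k - g) * \<psi> k) = (\<Sum>k\<in>K. lookup b (g + k - g) * \<psi> (g + k))"
      by (rule sum_translate[OF g, symmetric])
    also have "\<dots> = \<psi> g * char_eval K \<psi> b"
      using g by (simp add: char_mult[OF \<psi>] char_eval_def sum_distrib_left mult_ac)
    finally show ?thesis .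
  qed
  have "char_eval K \<psi> (a * b) = (\<Sum>g\<in>K. lookup a g * (\<Sum>k\<in>K. lookup b (k - g) * \<psi> k))"
    unfolding char_eval_def lookup_group_alg_mult[OF a]
    by (simp add: sum_distrib_right sum_distrib_left mult.assoc) (rule sum.swap)
  also have "\<dots> = (\<Sum>g\<in>K. lookup a g * \<psi> g) * char_eval K \<psi> b"
    by (simp add: shift sum_distrib_right mult.assoc)
  finally show ?thesis by (simp add: char_eval_def)
qed

lemma char_idem_mem [simp, intro]: "char_idem K \<psi> \<in> group_alg K"
  by (simp add: char_idem_def)

lemma lookup_char_idem: "lookup (char_idem K \<psi>) k = (if k \<in> K then \<psi> (- k) / of_nat (card K) else 0)"
  by (simp add: char_idem_def lookup_mean_element)

lemma sum_char_idem: "(\<Sum>\<psi>\<in>chars K. char_idem K \<psi>) = 1"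
proof (rule group_alg_eqI)
  show "(\<Sum>\<psi>\<in>chars K. char_idem K \<psi>) \<in> group_alg K" by auto
  fix k assume k: "k \<in> K"
  then show "lookup (\<Sum>\<psi>\<in>chars K. char_idem K \<psi>) k = lookup 1 k"
    using sum_chars[OF uminus_K[OF k]]
    by (simp add: lookup_sum lookup_char_idem sum_divide_distrib[symmetric] lookup_one when_def)
qed simp

lemma mult_char_idem:
  assumes \<psi>: "\<psi> \<in> chars K" and a: "a \<in> group_alg K"
  shows "a * char_idem K \<psi> = scalar (char_eval K \<psi> a) * char_idem K \<psi>"
proof (rule group_alg_eqI)
  fix k assume k: "k \<in> K"
  have "lookup (a * char_idem K \<psi>) k = (\<Sum>g\<in>K. lookup a g * (\<psi> g * \<psi> (- k) / of_nat (card K)))"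
    unfolding lookup_group_alg_mult[OF a]
  proof (rule sum.cong[OF refl])
    fix g assume g: "g \<in> K"
    have "\<psi> (- (k - g)) = \<psi> g * \<psi> (- k)"
      using char_mult[OF \<psi> g uminus_K[OF k]] by (simp add: algebra_simps)
    then show "lookup a g * lookup (char_idem K \<psi>) (k - g) =
        lookup a g * (\<psi> g * \<psi> (- k) / of_nat (card K))"
      using lookup_char_idem diff_K[OF k g] by simp
  qed
  then show "lookup (a * char_idem K \<psi>) k = lookup (scalar (char_eval K \<psi> a) * char_idem K \<psi>) k"
    using k by (simp add: lookup_single_mult lookup_char_idem char_eval_def sum_distrib_right
        sum_divide_distrib mult.assoc)
qed (use a in auto)

lemma char_eval_char_idem:
  "\<psi> \<in> chars K \<Longrightarrow> \<phi> \<in> chars K \<Longrightarrow> char_eval K \<psi> (char_idem K \<phi>) = (if \<psi> = \<phi> then 1 else 0)"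
  using char_orthogonality[of \<psi> \<phi>]
  by (simp add: char_idem_def char_eval_mean_element mult.commute)

lemma char_idem_orthogonal:
  "\<psi> \<in> chars K \<Longrightarrow> \<phi> \<in> chars K \<Longrightarrow> \<psi> \<noteq> \<phi> \<Longrightarrow> char_idem K \<psi> * char_idem K \<phi> = 0"
  using mult_char_idem[of \<phi> "char_idem K \<psi>"] by (simp add: char_eval_char_idem)

subsection \<open>Power series over group algebras\<close>

lemma char_eval_fps_nth [simp]: "fps_nth (char_eval_fps K \<psi> F) n = char_eval K \<psi> (fps_nth F n)"
  by (simp add: char_eval_fps_def)

lemma char_eval_fps_one: "\<psi> \<in> chars K \<Longrightarrow> char_eval_fps K \<psi> 1 = 1"
  by (simp add: fps_eq_iff char_eval_one)

lemma char_eval_fps_add: "char_eval_fps K \<psi> (F + G) = char_eval_fps K \<psi> F + char_eval_fps K \<psi> G"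
  by (simp add: fps_eq_iff char_eval_add)

lemma char_eval_fps_uminus: "char_eval_fps K \<psi> (- F) = - char_eval_fps K \<psi> F"
  by (simp add: fps_eq_iff char_eval_uminus)

lemma char_eval_fps_const: "char_eval_fps K \<psi> (fps_const a) = fps_const (char_eval K \<psi> a)"
  by (simp add: fps_eq_iff)

lemma char_eval_fps_mult:
  assumes "\<psi> \<in> chars K" "F \<in> group_alg_fps K" "G \<in> group_alg_fps K"
  shows "char_eval_fps K \<psi> (F * G) = char_eval_fps K \<psi> F * char_eval_fps K \<psi> G"
  using assms by (auto simp: fps_eq_iff fps_mult_nth group_alg_fps_def char_eval_sum char_eval_mult)

lemma scalar_fps_mem: "scalar_fps F \<in> group_alg_fps K"
  by (simp add: scalar_fps_def group_alg_fps_def)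

lemma char_eval_fps_scalar_fps: "\<psi> \<in> chars K \<Longrightarrow> char_eval_fps K \<psi> (scalar_fps F) = F"
  by (simp add: fps_eq_iff scalar_fps_def char_eval_scalar)

sublocale AF: comm_subring "group_alg_fps K"
  unfolding group_alg_fps_eq by (rule A.comm_subring_fps_over)

lemma char_eval_fps_power:
  assumes "\<psi> \<in> chars K" "F \<in> group_alg_fps K"
  shows "char_eval_fps K \<psi> (F ^ n) = char_eval_fps K \<psi> F ^ n"
  using assms by (induction n) (auto simp: char_eval_fps_one char_eval_fps_mult AF.power_mem)

lemma char_eval_fps_compose:
  assumes \<psi>: "\<psi> \<in> chars K" and F: "F \<in> group_alg_fps K" and G: "G \<in> group_alg_fps K"
  shows "char_eval_fps K \<psi> (fps_compose F G) = fps_compose (char_eval_fps K \<psi> F) (char_eval_fps K \<psi> G)"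
proof -
  have "fps_nth (G ^ i) n \<in> group_alg K" "fps_nth F i \<in> group_alg K" for i n
    using AF.power_mem[OF G] F by (auto simp: group_alg_fps_def)
  moreover have "char_eval K \<psi> (fps_nth (G ^ i) n) = fps_nth (char_eval_fps K \<psi> G ^ i) n" for i n
    unfolding char_eval_fps_power[OF \<psi> G, symmetric] by simp
  ultimately show ?thesis
    using \<psi> by (simp add: fps_eq_iff fps_compose_nth char_eval_sum char_eval_mult)
qed

sublocale AP: comm_subring "group_alg_poly K"
  unfolding group_alg_poly_eq by (rule A.comm_subring_polys_over)

lemma char_eval_fps_sum: "char_eval_fps K \<psi> (sum F I) = (\<Sum>i\<in>I. char_eval_fps K \<psi> (F i))"
  by (simp add: fps_eq_iff fps_sum_nth char_eval_sum)

lemma fps_of_poly_mem: "p \<in> group_alg_poly K \<Longrightarrow> fps_of_poly p \<in> group_alg_fps K"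
  by (simp add: group_alg_poly_def group_alg_fps_def)

end

subsection \<open>Extensions of characters\<close>

definition char_extensions ::
  "'g::ab_group_add set \<Rightarrow> 'g set \<Rightarrow> ('g \<Rightarrow> complex) \<Rightarrow> ('g \<Rightarrow> complex) set" where
  "char_extensions G H \<chi> = {\<psi> \<in> chars G. \<forall>h\<in>H. \<psi> h = \<chi> h}"

lemma char_extensionsD: "\<psi> \<in> char_extensions G H \<chi> \<Longrightarrow> \<psi> \<in> chars G"
  by (simp add: char_extensions_def)

locale finite_add_subgroup = G: finite_add_group G + H: finite_add_group H
  for G H :: "'g::ab_group_add set" +
  assumes H_subset: "H \<subseteq> G"
begin

lemma finite_char_extensions [simp, intro]: "finite (char_extensions G H \<chi>)"
  by (simp add: char_extensions_def)

lemma char_eval_extension: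
  assumes \<psi>: "\<psi> \<in> char_extensions G H \<chi>" and a: "a \<in> group_alg H"
  shows "char_eval G \<psi> a = char_eval H \<chi> a"
proof -
  have "char_eval G \<psi> a = (\<Sum>h\<in>H. lookup a h * \<psi> h)"
    unfolding char_eval_def using H_subset a
    by (intro sum.mono_neutral_right) (auto simp: group_alg_iff)
  also have "\<dots> = char_eval H \<chi> a"
    unfolding char_eval_def using \<psi> by (intro sum.cong) (auto simp: char_extensions_def)
  finally show ?thesis .
qed

lemma sum_restricted_char_mult:
  assumes \<psi>: "\<psi> \<in> chars G" and \<chi>: "\<chi> \<in> chars H"
  shows "(\<Sum>h\<in>H. \<psi> h * \<chi> (- h)) = (if \<psi> \<in> char_extensions G H \<chi> then of_nat (card H) else 0)"
proof -
  have restrict: "restrict \<psi> H \<in> chars H"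
    using \<psi> H_subset by (auto simp: chars_def)
  have "(\<Sum>h\<in>H. \<psi> h * \<chi> (- h)) = (\<Sum>h\<in>H. restrict \<psi> H h * \<chi> (- h))" by simp
  also have "\<dots> = (if restrict \<psi> H = \<chi> then of_nat (card H) else 0)"
    by (rule H.char_orthogonality[OF restrict \<chi>])
  also have "restrict \<psi> H = \<chi> \<longleftrightarrow> \<psi> \<in> char_extensions G H \<chi>"
    using \<psi> H.char_eqI[OF restrict \<chi>] by (auto simp: char_extensions_def)
  finally show ?thesis .
qed

lemma sum_char_extensions:
  assumes \<chi>: "\<chi> \<in> chars H" and g: "g \<in> G"
  shows "(\<Sum>\<psi>\<in>char_extensions G H \<chi>. \<psi> g) =
    (if g \<in> H then of_nat (card G) / of_nat (card H) * \<chi> g else 0)"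
proof -
  have "of_nat (card H) * (\<Sum>\<psi>\<in>char_extensions G H \<chi>. \<psi> g) =
      (\<Sum>\<psi>\<in>chars G. \<psi> g * (if \<psi> \<in> char_extensions G H \<chi> then of_nat (card H) else 0))"
    unfolding sum_distrib_left by (rule sum.mono_neutral_cong_left) (auto simp: char_extensions_def)
  also have "\<dots> = (\<Sum>\<psi>\<in>chars G. \<psi> g * (\<Sum>h\<in>H. \<psi> h * \<chi> (- h)))"
    by (simp add: sum_restricted_char_mult[OF _ \<chi>])
  also have "\<dots> = (\<Sum>h\<in>H. \<chi> (- h) * (\<Sum>\<psi>\<in>chars G. \<psi> g * \<psi> h))"
    by (simp add: sum_distrib_left mult_ac) (rule sum.swap)
  also have "\<dots> = (\<Sum>h\<in>H. if h = - g then \<chi> g * of_nat (card G) else 0)"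
  proof (rule sum.cong[OF refl])
    fix h assume "h \<in> H"
    then have h: "h \<in> G" using H_subset by auto
    have "(\<Sum>\<psi>\<in>chars G. \<psi> g * \<psi> h) = (\<Sum>\<psi>\<in>chars G. \<psi> (g + h))"
      using g h by (simp add: G.char_mult)
    also have "\<dots> = (if h = - g then of_nat (card G) else 0)"
      using G.sum_chars[OF G.add_K[OF g h]] by (simp add: add_eq_0_iff)
    finally show "\<chi> (- h) * (\<Sum>\<psi>\<in>chars G. \<psi> g * \<psi> h) =
        (if h = - g then \<chi> g * of_nat (card G) else 0)" by simp
  qed
  also have "\<dots> = (if g \<in> H then \<chi> g * of_nat (card G) else 0)"
    using H.uminus_K[of g] H.uminus_K[of "- g"] by auto
  finally show ?thesis by (simp add: field_simps split: if_splits)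
qed

lemma sum_char_eval_mean_element:
  assumes \<chi>: "\<chi> \<in> chars H"
  shows "(\<Sum>\<psi>\<in>char_extensions G H \<chi>. char_eval G \<psi> (mean_element G w)) =
    char_eval H \<chi> (mean_element H w)"
proof -
  have "(\<Sum>\<psi>\<in>char_extensions G H \<chi>. char_eval G \<psi> (mean_element G w)) =
      (\<Sum>g\<in>G. w g / of_nat (card G) * (\<Sum>\<psi>\<in>char_extensions G H \<chi>. \<psi> g))"
    unfolding G.char_eval_mean_element sum_divide_distrib sum_distrib_left by (subst sum.swap) simp
  also have "\<dots> = (\<Sum>h\<in>H. w h * \<chi> h / of_nat (card H))"
    using H_subset
    by (intro sum.mono_neutral_cong_right) (auto simp: sum_char_extensions[OF \<chi>] subset_iff)
  finally show ?thesis by (simp add: H.char_eval_mean_element sum_divide_distrib)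
qed

lemma sum_char_idem_extensions:
  assumes \<chi>: "\<chi> \<in> chars H"
  shows "(\<Sum>\<psi>\<in>char_extensions G H \<chi>. char_idem G \<psi>) = char_idem H \<chi>"
proof (rule group_alg_eqI)
  show "(\<Sum>\<psi>\<in>char_extensions G H \<chi>. char_idem G \<psi>) \<in> group_alg G" by auto
  show "char_idem H \<chi> \<in> group_alg G" by (rule group_alg_mono[OF H_subset]) simp
  fix g assume g: "g \<in> G"
  have "- g \<in> H \<longleftrightarrow> g \<in> H" using H.uminus_K[of g] H.uminus_K[of "- g"] by auto
  then show "lookup (\<Sum>\<psi>\<in>char_extensions G H \<chi>. char_idem G \<psi>) g = lookup (char_idem H \<chi>) g"
    using g sum_char_extensions[OF \<chi> G.uminus_K[OF g]]
    by (simp add: lookup_sum G.lookup_char_idem H.lookup_char_idem sum_divide_distrib[symmetric])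
qed

end

section \<open>Diagonalisation of representations\<close>

locale diagonalised_rep = finite_add_group K + coordinates "group_alg K" V J f
  for K :: "'g::ab_group_add set" and V :: "('g \<Rightarrow>\<^sub>0 complex, 'm) module" and J :: "'j set"
    and f :: "'j \<Rightarrow> 'm \<Rightarrow> complex" +
  fixes \<chi> :: "'j \<Rightarrow> 'g \<Rightarrow> complex"
  assumes finite_J: "finite J"
    and chars: "j \<in> J \<Longrightarrow> \<chi> j \<in> chars K"
    and f_smult: "j \<in> J \<Longrightarrow> a \<in> group_alg K \<Longrightarrow> v \<in> carrier V \<Longrightarrow>
      f j (a \<odot>\<^bsub>V\<^esub> v) = char_eval K (\<chi> j) a * f j v"
    and f_surj: "\<exists>v\<in>carrier V. \<forall>j\<in>J. f j v = z j"
begin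

definition fps_coord :: "'j \<Rightarrow> (nat \<Rightarrow> 'm) \<Rightarrow> complex fps" where
  "fps_coord j F = Abs_fps (\<lambda>n. f j (F n))"

lemma fps_module_series_endo:
  assumes a: "\<And>i. a i \<in> group_alg K" and F: "F \<in> carrier (fps_module V)"
  shows "series_endo V (\<lambda>i v. a i \<odot>\<^bsub>V\<^esub> v) F \<in> carrier (fps_module V)"
    and "j \<in> J \<Longrightarrow> fps_coord j (series_endo V (\<lambda>i v. a i \<odot>\<^bsub>V\<^esub> v) F) =
      Abs_fps (\<lambda>i. char_eval K (\<chi> j) (a i)) * fps_coord j F"
proof -
  have F': "F n \<in> carrier V" for n using F by (simp add: fps_module_def)
  show "series_endo V (\<lambda>i v. a i \<odot>\<^bsub>V\<^esub> v) F \<in> carrier (fps_module V)"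
    using a F' by (simp add: fps_module_def series_endo_closed smult_closed)
  show "j \<in> J \<Longrightarrow> fps_coord j (series_endo V (\<lambda>i v. a i \<odot>\<^bsub>V\<^esub> v) F) =
      Abs_fps (\<lambda>i. char_eval K (\<chi> j) (a i)) * fps_coord j F"
    using a F' by (simp add: fps_eq_iff fps_coord_def fps_mult_nth f_series_endo smult_closed f_smult
        atMost_atLeast0)
qed

lemma projective_coordinates_fps_module:
  "projective_coordinates UNIV (fps_module V) J fps_coord kronecker"
proof -
  interpret comm_subring "UNIV :: complex fps set" by (rule comm_subring_UNIV)
  show ?thesis
  proof
    show "\<zero>\<^bsub>fps_module V\<^esub> \<in> carrier (fps_module V)"
      by (simp add: fps_module_def zero_closed)
    show "fps_coord j \<zero>\<^bsub>fps_module V\<^esub> = 0" if "j \<in> J" for j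
      using that by (simp add: fps_eq_iff fps_coord_def fps_module_def f_zero)
    fix F assume F: "F \<in> carrier (fps_module V)"
    have smult: "c \<odot>\<^bsub>fps_module V\<^esub> F = series_endo V (\<lambda>i v. scalar (fps_nth c i) \<odot>\<^bsub>V\<^esub> v) F" for c
      by (simp add: fps_module_def)
    show "c \<odot>\<^bsub>fps_module V\<^esub> F \<in> carrier (fps_module V)" for c
      unfolding smult using F by (intro fps_module_series_endo(1)) simp
    show "fps_coord j (c \<odot>\<^bsub>fps_module V\<^esub> F) = c * fps_coord j F" if "j \<in> J" for j c
      unfolding smult using F that
      by (simp add: fps_module_series_endo(2) char_eval_scalar[OF chars] fps_nth_inverse)
    fix G assume G: "G \<in> carrier (fps_module V)"
    show "F \<oplus>\<^bsub>fps_module V\<^esub> G \<in> carrier (fps_module V)"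
      using F G by (simp add: fps_module_def add_closed)
    show "fps_coord j (F \<oplus>\<^bsub>fps_module V\<^esub> G) = fps_coord j F + fps_coord j G" if "j \<in> J" for j
      using F G that by (simp add: fps_eq_iff fps_coord_def fps_module_def f_add)
    assume eq: "\<And>j. j \<in> J \<Longrightarrow> fps_coord j F = fps_coord j G"
    show "F = G"
    proof
      fix n
      show "F n = G n"
        using F G eq by (intro f_eqI) (auto simp: fps_module_def fps_coord_def fps_eq_iff)
    qed
  next
    fix z :: "'j \<Rightarrow> complex fps"
    have "\<exists>v\<in>carrier V. \<forall>j\<in>J. f j v = fps_nth (z j) n" for n by (rule f_surj)
    then obtain F where F: "\<And>n. F n \<in> carrier V" "\<And>n j. j \<in> J \<Longrightarrow> f j (F n) = fps_nth (z j) n"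
      by metis
    then show "\<exists>F\<in>carrier (fps_module V). \<forall>j\<in>J. fps_coord j F = (\<Sum>i\<in>J. kronecker j i * z i)"
      using finite_J by (intro bexI[of _ F]) (auto simp: fps_module_def fps_coord_def fps_eq_iff)
  qed (auto simp: finite_J)
qed

lemma sigma_rep_eq_prod:
  assumes \<Lambda>: "\<Lambda> \<in> group_alg_fps K"
  shows "sigma_rep V \<Lambda> = (\<Prod>j\<in>J. char_eval_fps K (\<chi> j) \<Lambda>)"
proof -
  let ?B = "\<lambda>i j. kronecker i j * char_eval_fps K (\<chi> i) \<Lambda>"
  have \<Lambda>': "fps_nth \<Lambda> i \<in> group_alg K" for i using \<Lambda> by (simp add: group_alg_fps_def)
  interpret F: projective_coordinates UNIV "fps_module V" J fps_coord kronecker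
    by (rule projective_coordinates_fps_module)
  have "fps_coord j (series_endo V (\<lambda>i v. fps_nth \<Lambda> i \<odot>\<^bsub>V\<^esub> v) F) = (\<Sum>i\<in>J. ?B j i * fps_coord i F)"
    if "j \<in> J" "F \<in> carrier (fps_module V)" for j F
    unfolding fps_module_series_endo(2)[OF \<Lambda>' that(2,1)]
    using that(1) finite_J by (simp add: mult.assoc char_eval_fps_def)
  then have "sigma_rep V \<Lambda> =
      det_on J (\<lambda>i j. kronecker i j + kernel_mult J (\<lambda>i j. ?B i j - kronecker i j) kronecker i j)"
    unfolding sigma_rep_def
    by (intro F.proj_det_eq_det_on) (auto intro: fps_module_series_endo(1)[OF \<Lambda>'])
  also have "\<dots> = det_on J ?B"
    using finite_J by (intro det_on_cong) (simp_all add: kernel_mult_def)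
  also have "\<dots> = (\<Prod>j\<in>J. char_eval_fps K (\<chi> j) \<Lambda>)"
    by (rule det_on_diagonal[OF finite_J])
  finally show ?thesis .
qed

end

lemma (in comm_subring) finsum_ring_on:
  assumes "finite I" and "\<And>i. i \<in> I \<Longrightarrow> x i \<in> R"
  shows "(\<Oplus>\<^bsub>ring_on R\<^esub>i\<in>I. x i) = (\<Sum>i\<in>I. x i)"
proof -
  interpret cring "ring_on R" by (rule cring_ring_on)
  from assms show ?thesis
  proof (induction I)
    case (insert i I)
    then show ?case by (subst finsum_insert) auto
  qed (use finsum_empty in simp)
qed

locale group_alg_module = finite_add_group K + V: Module.module "ring_on (group_alg K)" V
  for K :: "'g::ab_group_add set" and V :: "('g \<Rightarrow>\<^sub>0 complex, 'm) module"
begin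

lemmas smult_simps =
  V.smult_closed[simplified] V.smult_l_distr[simplified] V.smult_r_distr[simplified]
  V.smult_assoc1[simplified] V.smult_one[simplified]

lemma char_idem_decomposition:
  assumes "v \<in> carrier V"
  shows "(\<Oplus>\<^bsub>V\<^esub>\<psi>\<in>chars K. char_idem K \<psi> \<odot>\<^bsub>V\<^esub> v) = v"
proof -
  have "(\<Oplus>\<^bsub>V\<^esub>\<psi>\<in>chars K. char_idem K \<psi> \<odot>\<^bsub>V\<^esub> v) =
      (\<Oplus>\<^bsub>ring_on (group_alg K)\<^esub>\<psi>\<in>chars K. char_idem K \<psi>) \<odot>\<^bsub>V\<^esub> v"
    using assms by (intro V.finsum_smult_r[symmetric]) auto
  also have "(\<Oplus>\<^bsub>ring_on (group_alg K)\<^esub>\<psi>\<in>chars K. char_idem K \<psi>) = 1"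
    by (subst A.finsum_ring_on) (auto simp: sum_char_idem)
  finally show ?thesis using assms by (simp add: smult_simps)
qed

lemma smult_char_idem_smult:
  assumes "\<psi> \<in> chars K" and "a \<in> group_alg K" and "v \<in> carrier V"
  shows "a \<odot>\<^bsub>V\<^esub> (char_idem K \<psi> \<odot>\<^bsub>V\<^esub> v) = scalar (char_eval K \<psi> a) \<odot>\<^bsub>V\<^esub> (char_idem K \<psi> \<odot>\<^bsub>V\<^esub> v)"
  using assms by (simp add: V.smult_assoc1[simplified, symmetric] mult_char_idem[of \<psi> a])

definition complex_space :: "(complex, 'm) module" where
  "complex_space = \<lparr>carrier = carrier V, mult = mult V, one = one V, zero = zero V, add = add V,
     smult = (\<lambda>z v. scalar z \<odot>\<^bsub>V\<^esub> v)\<rparr>"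

lemma complex_space_simps [simp]:
  "carrier complex_space = carrier V" "zero complex_space = zero V" "add complex_space = add V"
  "z \<odot>\<^bsub>complex_space\<^esub> v = scalar z \<odot>\<^bsub>V\<^esub> v"
  by (simp_all add: complex_space_def)

lemma finsum_complex_space [simp]: "finsum complex_space = finsum V"
  by (intro ext) (simp add: finsum_def finprod_def)

sublocale C: vectorspace class_ring complex_space
proof (intro vectorspace.intro class_field)
  show "module class_ring complex_space"
  proof (rule moduleI)
    show "cring (class_ring :: complex ring)"
      using class_field[where 'a = complex] by (simp add: field_def domain_def)
    show "abelian_group complex_space"
      by (rule abelian_groupI) (auto simp: V.a_ac intro: V.l_neg V.a_inv_closed bexI)
  qed (simp_all add: smult_simps single_add scalar_mult)
qed

lemma C_lincomb: "C.lincomb z B = (\<Oplus>\<^bsub>V\<^esub>b\<in>B. scalar (z b) \<odot>\<^bsub>V\<^esub> b)"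
  by (simp add: C.lincomb_def)

lemma C_span_finsum:
  assumes U: "U \<subseteq> carrier V" and "finite I" and "\<And>i. i \<in> I \<Longrightarrow> v i \<in> C.span U"
  shows "(\<Oplus>\<^bsub>V\<^esub>i\<in>I. v i) \<in> C.span U"
  using assms(2,3)
proof (induction I)
  case empty
  then show ?case using C.span_zero[of U] by simp
next
  case (insert i I)
  have "v k \<in> carrier V" if "k \<in> insert i I" for k
    using C.span_closed[of U "v k"] insert.prems[OF that] U by simp
  then have "(\<Oplus>\<^bsub>V\<^esub>k\<in>insert i I. v k) = v i \<oplus>\<^bsub>V\<^esub> (\<Oplus>\<^bsub>V\<^esub>k\<in>I. v k)"
    using insert.hyps by (intro V.finsum_insert) auto
  then show ?case
    using insert C.span_add1[of U "v i" "\<Oplus>\<^bsub>V\<^esub>k\<in>I. v k"] U by simp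
qed

lemma C_span_char_idem_smult:
  assumes S: "S \<subseteq> carrier V" "V.span S = carrier V"
  shows "C.span ((\<lambda>(v, \<psi>). char_idem K \<psi> \<odot>\<^bsub>V\<^esub> v) ` (S \<times> chars K)) = carrier V"
    (is "C.span ?W = _")
proof
  have W: "?W \<subseteq> carrier V" using S by (auto simp: smult_simps)
  then show "C.span ?W \<subseteq> carrier V" using C.span_closed[of ?W] by auto
  have smult_mem: "a \<odot>\<^bsub>V\<^esub> v \<in> C.span ?W" if v: "v \<in> S" and a: "a \<in> group_alg K" for a v
  proof -
    have vV: "v \<in> carrier V" using v S by auto
    have "char_idem K \<psi> \<odot>\<^bsub>V\<^esub> (a \<odot>\<^bsub>V\<^esub> v) \<in> C.span ?W" if \<psi>: "\<psi> \<in> chars K" for \<psi>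
    proof -
      have "char_idem K \<psi> \<odot>\<^bsub>V\<^esub> (a \<odot>\<^bsub>V\<^esub> v) = a \<odot>\<^bsub>V\<^esub> (char_idem K \<psi> \<odot>\<^bsub>V\<^esub> v)"
        using a vV by (simp add: V.smult_assoc1[simplified, symmetric] mult.commute)
      also have "\<dots> = char_eval K \<psi> a \<odot>\<^bsub>complex_space\<^esub> (char_idem K \<psi> \<odot>\<^bsub>V\<^esub> v)"
        by (simp add: smult_char_idem_smult[OF \<psi> a vV])
      also have "\<dots> \<in> C.span ?W"
      proof (rule LinearCombinations.submodule.smult_closed)
        show "LinearCombinations.submodule class_ring (C.span ?W) complex_space"
          using C.span_is_submodule[of ?W] W by simp
        show "char_idem K \<psi> \<odot>\<^bsub>V\<^esub> v \<in> C.span ?W"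
          using W v \<psi> by (intro C.span_mem) auto
      qed simp
      finally show ?thesis .
    qed
    then have "(\<Oplus>\<^bsub>V\<^esub>\<psi>\<in>chars K. char_idem K \<psi> \<odot>\<^bsub>V\<^esub> (a \<odot>\<^bsub>V\<^esub> v)) \<in> C.span ?W"
      by (intro C_span_finsum[OF W]) auto
    then show ?thesis
      using a vV by (simp add: char_idem_decomposition smult_simps)
  qed
  show "carrier V \<subseteq> C.span ?W"
  proof
    fix v assume "v \<in> carrier V"
    then have "v \<in> V.span S" using S by simp
    then obtain a A where v: "v = V.lincomb a A" "finite A" "A \<subseteq> S" "a \<in> A \<rightarrow> group_alg K"
      unfolding V.span_def by auto
    then show "v \<in> C.span ?W"
      unfolding v(1) V.lincomb_def by (intro C_span_finsum[OF W] smult_mem) auto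
  qed
qed

lemma eigenbasis_exists:
  assumes fg: "finitely_generated (group_alg K) V"
  obtains B \<chi> where "finite B" and "C.basis B"
    and "\<And>b. b \<in> B \<Longrightarrow> \<chi> b \<in> chars K"
    and "\<And>b a. b \<in> B \<Longrightarrow> a \<in> group_alg K \<Longrightarrow> a \<odot>\<^bsub>V\<^esub> b = scalar (char_eval K (\<chi> b) a) \<odot>\<^bsub>V\<^esub> b"
proof -
  obtain S where S: "finite S" "S \<subseteq> carrier V" "V.span S = carrier V"
    using fg by (auto simp: finitely_generated_def)
  let ?W = "(\<lambda>(v, \<psi>). char_idem K \<psi> \<odot>\<^bsub>V\<^esub> v) ` (S \<times> chars K)"
  have "finite ?W" using S by auto
  moreover have "?W \<subseteq> carrier complex_space" using S by (auto simp: smult_simps)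
  ultimately obtain B where B: "B \<subseteq> ?W" "minimal B (\<lambda>U. U \<subseteq> carrier complex_space \<and> C.gen_set U)"
    using minimal_exists[of ?W "\<lambda>U. U \<subseteq> carrier complex_space \<and> C.gen_set U"] C_span_char_idem_smult[OF S(2,3)]
    by auto
  have "\<exists>\<psi>\<in>chars K. \<forall>a\<in>group_alg K. a \<odot>\<^bsub>V\<^esub> b = scalar (char_eval K \<psi> a) \<odot>\<^bsub>V\<^esub> b" if "b \<in> B" for b
  proof -
    from that B(1) obtain v \<psi> where "b = char_idem K \<psi> \<odot>\<^bsub>V\<^esub> v" "v \<in> S" "\<psi> \<in> chars K" by auto
    then show ?thesis using S(2) smult_char_idem_smult[of \<psi> _ v] by blast
  qed
  then obtain \<chi> where "\<And>b. b \<in> B \<Longrightarrow> \<chi> b \<in> chars K"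
    "\<And>b a. b \<in> B \<Longrightarrow> a \<in> group_alg K \<Longrightarrow> a \<odot>\<^bsub>V\<^esub> b = scalar (char_eval K (\<chi> b) a) \<odot>\<^bsub>V\<^esub> b"
    by metis
  then show ?thesis
    using that finite_subset[OF B(1) \<open>finite ?W\<close>] C.min_gen_is_basis[OF B(2)] by blast
qed

lemma smult_C_lincomb:
  assumes B: "B \<subseteq> carrier V" and a: "a \<in> group_alg K"
    and eigen: "\<And>b. b \<in> B \<Longrightarrow> a \<odot>\<^bsub>V\<^esub> b = scalar (l b) \<odot>\<^bsub>V\<^esub> b"
  shows "a \<odot>\<^bsub>V\<^esub> C.lincomb z B = C.lincomb (\<lambda>b. l b * z b) B"
proof -
  have "a \<odot>\<^bsub>V\<^esub> C.lincomb z B = (\<Oplus>\<^bsub>V\<^esub>b\<in>B. a \<odot>\<^bsub>V\<^esub> (scalar (z b) \<odot>\<^bsub>V\<^esub> b))"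
    unfolding C_lincomb using B a by (intro V.finsum_smult) (auto simp: smult_simps)
  also have "\<dots> = C.lincomb (\<lambda>b. l b * z b) B"
    unfolding C_lincomb
  proof (rule V.finsum_cong')
    fix b assume b: "b \<in> B"
    then have bV: "b \<in> carrier V" using B by auto
    have "a \<odot>\<^bsub>V\<^esub> (scalar (z b) \<odot>\<^bsub>V\<^esub> b) = scalar (z b) \<odot>\<^bsub>V\<^esub> (a \<odot>\<^bsub>V\<^esub> b)"
      using a bV by (simp add: V.smult_assoc1[simplified, symmetric] mult.commute)
    also have "\<dots> = scalar (l b * z b) \<odot>\<^bsub>V\<^esub> b"
      using bV by (simp add: eigen[OF b] V.smult_assoc1[simplified, symmetric] scalar_mult mult.commute)
    finally show "a \<odot>\<^bsub>V\<^esub> (scalar (z b) \<odot>\<^bsub>V\<^esub> b) = scalar (l b * z b) \<odot>\<^bsub>V\<^esub> b" .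
  qed (use B in \<open>auto simp: smult_simps\<close>)
  finally show ?thesis .
qed

lemma basis_coordinates_exist:
  assumes "finite B" and "C.basis B"
  obtains f where "\<And>v. v \<in> carrier V \<Longrightarrow> C.lincomb (\<lambda>b. f b v) B = v"
    and "\<And>b z. b \<in> B \<Longrightarrow> f b (C.lincomb z B) = z b"
proof -
  have BV: "B \<subseteq> carrier V" using assms(2) by (simp add: C.basis_def)
  have unique: "\<exists>!z. z \<in> B \<rightarrow>\<^sub>E UNIV \<and> C.lincomb z B = v" if "v \<in> carrier V" for v
    using C.basis_criterion[of B] assms BV that by simp
  define f where "f b v = (THE z. z \<in> B \<rightarrow>\<^sub>E UNIV \<and> C.lincomb z B = v) b" for b v
  have "C.lincomb (\<lambda>b. f b v) B = v" if "v \<in> carrier V" for v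
    using theI'[OF unique[OF that]] by (simp add: f_def)
  moreover have "f b (C.lincomb z B) = z b" if "b \<in> B" for b z
  proof -
    have "C.lincomb z B \<in> carrier V"
      using C.lincomb_closed[of B z] BV by simp
    moreover have "C.lincomb (restrict z B) B = C.lincomb z B"
      using C.lincomb_cong[of B B "restrict z B" z] BV by simp
    ultimately have "(THE z'. z' \<in> B \<rightarrow>\<^sub>E UNIV \<and> C.lincomb z' B = C.lincomb z B) = restrict z B"
      by (intro the1_equality[OF unique]) auto
    then show ?thesis using that by (simp add: f_def)
  qed
  ultimately show ?thesis by (rule that)
qed

lemma diagonalised_rep_if_finitely_generated:
  assumes "finitely_generated (group_alg K) V"
  shows "\<exists>(B :: 'm set) f \<chi>. diagonalised_rep K V B f \<chi>"
proof -
  obtain B \<chi> where B: "finite B" "C.basis B" and \<chi>: "\<And>b. b \<in> B \<Longrightarrow> \<chi> b \<in> chars K"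
    and eigen: "\<And>b a. b \<in> B \<Longrightarrow> a \<in> group_alg K \<Longrightarrow> a \<odot>\<^bsub>V\<^esub> b = scalar (char_eval K (\<chi> b) a) \<odot>\<^bsub>V\<^esub> b"
    using eigenbasis_exists[OF assms] by blast
  obtain f where lincomb_f: "\<And>v. v \<in> carrier V \<Longrightarrow> C.lincomb (\<lambda>b. f b v) B = v"
    and f_lincomb: "\<And>b z. b \<in> B \<Longrightarrow> f b (C.lincomb z B) = z b"
    using basis_coordinates_exist[OF B] by blast
  have BV: "B \<subseteq> carrier V" using B by (simp add: C.basis_def)
  have closed: "C.lincomb z B \<in> carrier V" for z
    using C.lincomb_closed[of B z] BV by simp
  have "diagonalised_rep K V B f \<chi>"
  proof
    fix v assume v: "v \<in> carrier V"
    show "f b (a \<odot>\<^bsub>V\<^esub> v) = char_eval K (\<chi> b) a * f b v" if "b \<in> B" "a \<in> group_alg K" for a b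
      using smult_C_lincomb[OF BV that(2) eigen, of "\<lambda>b. f b v"] lincomb_f[OF v] that
      by (metis (no_types, lifting) f_lincomb)
    fix w assume w: "w \<in> carrier V"
    show "f b (v \<oplus>\<^bsub>V\<^esub> w) = f b v + f b w" if "b \<in> B" for b
      using C.lincomb_sum[of B "\<lambda>b. f b v" "\<lambda>b. f b w"] B BV lincomb_f[OF v] lincomb_f[OF w]
        f_lincomb[OF that, of "\<lambda>b. f b v + f b w"] by simp
    assume "\<And>b. b \<in> B \<Longrightarrow> f b v = f b w"
    then have "C.lincomb (\<lambda>b. f b v) B = C.lincomb (\<lambda>b. f b w) B"
      using BV by (intro C.lincomb_cong) simp_all
    then show "v = w" by (simp only: lincomb_f[OF v] lincomb_f[OF w])
  next
    show "f b \<zero>\<^bsub>V\<^esub> = 0" if "b \<in> B" for b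
      using f_lincomb[OF that, of "\<lambda>_. 0"] C.lincomb_zero[of B] BV by simp
    show "\<exists>v\<in>carrier V. \<forall>b\<in>B. f b v = z b" for z
      using f_lincomb closed by (intro bexI[of _ "C.lincomb z B"]) simp_all
  qed (use B(1) \<chi> in \<open>simp_all add: smult_simps(1)\<close>)
  then show ?thesis by blast
qed

end

lemma artin_rep_diagonalised:
  fixes V :: "('g::ab_group_add \<Rightarrow>\<^sub>0 complex, 'm) module"
  assumes "finite_add_group K" and "artin_rep K V"
  shows "\<exists>(B :: 'm set) f \<chi>. diagonalised_rep K V B f \<chi>"
proof -
  interpret group_alg_module K V
    using assms by (simp add: group_alg_module_def artin_rep_def)
  show ?thesis
    using assms(2) by (intro diagonalised_rep_if_finitely_generated) (simp add: artin_rep_def)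
qed

section \<open>Quotients by the common kernel of functionals\<close>

locale kernel_quotient = abelian_group M
  for M :: "('r, 'm) module" (structure) +
  fixes R :: "'r set" and P :: "'p set" and L :: "'p \<Rightarrow> 'm \<Rightarrow> 'u::ab_group_add" and N :: "'m set"
  assumes L_add: "p \<in> P \<Longrightarrow> x \<in> carrier M \<Longrightarrow> y \<in> carrier M \<Longrightarrow> L p (x \<oplus>\<^bsub>M\<^esub> y) = L p x + L p y"
    and N_eq: "N = {x \<in> carrier M. \<forall>p\<in>P. L p x = 0}"
    and smult_closed: "r \<in> R \<Longrightarrow> x \<in> carrier M \<Longrightarrow> r \<odot>\<^bsub>M\<^esub> x \<in> carrier M"
    and L_smult_cong: "r \<in> R \<Longrightarrow> x \<in> carrier M \<Longrightarrow> y \<in> carrier M \<Longrightarrow>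
      (\<And>p. p \<in> P \<Longrightarrow> L p x = L p y) \<Longrightarrow> p \<in> P \<Longrightarrow> L p (r \<odot>\<^bsub>M\<^esub> x) = L p (r \<odot>\<^bsub>M\<^esub> y)"
begin

abbreviation quotient :: "('r, 'm set) module" where
  "quotient \<equiv> quotient_module M N"

definition cls :: "'m \<Rightarrow> 'm set" where
  "cls x = {y \<in> carrier M. \<forall>p\<in>P. L p y = L p x}"

definition lift :: "'p \<Rightarrow> 'm set \<Rightarrow> 'u" where
  "lift p X = the_elem (L p ` X)"

lemma L_zero: "p \<in> P \<Longrightarrow> L p \<zero>\<^bsub>M\<^esub> = 0"
  using L_add[of p "\<zero>\<^bsub>M\<^esub>" "\<zero>\<^bsub>M\<^esub>"] by simp

lemma L_minus: "p \<in> P \<Longrightarrow> x \<in> carrier M \<Longrightarrow> L p (\<ominus>\<^bsub>M\<^esub> x) = - L p x"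
  using L_add[of p x "\<ominus>\<^bsub>M\<^esub> x"] by (simp add: r_neg L_zero eq_neg_iff_add_eq_0 add.commute)

lemma mem_cls: "x \<in> carrier M \<Longrightarrow> x \<in> cls x"
  by (simp add: cls_def)

lemma cls_eq_iff: "x \<in> carrier M \<Longrightarrow> y \<in> carrier M \<Longrightarrow> cls x = cls y \<longleftrightarrow> (\<forall>p\<in>P. L p x = L p y)"
  by (fastforce simp: cls_def set_eq_iff)

lemma lift_cls: "p \<in> P \<Longrightarrow> x \<in> carrier M \<Longrightarrow> lift p (cls x) = L p x"
proof -
  assume "p \<in> P" and "x \<in> carrier M"
  then have "L p ` cls x = {L p x}" by (auto simp: cls_def)
  then show ?thesis by (simp add: lift_def)
qed

lemma coset_eq_cls:
  assumes x: "x \<in> carrier M"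
  shows "N +>\<^bsub>M\<^esub> x = cls x"
proof
  show "N +>\<^bsub>M\<^esub> x \<subseteq> cls x"
    using x by (auto simp: a_r_coset_def' N_eq cls_def L_add)
  show "cls x \<subseteq> N +>\<^bsub>M\<^esub> x"
  proof
    fix y assume y: "y \<in> cls x"
    then have yM: "y \<in> carrier M" by (simp add: cls_def)
    have "y \<oplus>\<^bsub>M\<^esub> (\<ominus>\<^bsub>M\<^esub> x) \<in> N"
      using x y yM by (auto simp: N_eq cls_def L_add L_minus)
    moreover have "y = (y \<oplus>\<^bsub>M\<^esub> (\<ominus>\<^bsub>M\<^esub> x)) \<oplus>\<^bsub>M\<^esub> x"
      using x yM by (simp add: a_assoc l_neg)
    ultimately show "y \<in> N +>\<^bsub>M\<^esub> x" unfolding a_r_coset_def' by blast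
  qed
qed

lemma carrier_quotient: "carrier quotient = cls ` carrier M"
  by (auto simp: quotient_module_def A_RCOSETS_def' coset_eq_cls)

lemma zero_quotient: "\<zero>\<^bsub>quotient\<^esub> = cls \<zero>\<^bsub>M\<^esub>"
  by (auto simp: quotient_module_def N_eq cls_def L_zero)

lemma add_quotient:
  assumes x: "x \<in> carrier M" and y: "y \<in> carrier M"
  shows "cls x \<oplus>\<^bsub>quotient\<^esub> cls y = cls (x \<oplus>\<^bsub>M\<^esub> y)"
proof -
  have "cls x \<oplus>\<^bsub>quotient\<^esub> cls y = (\<Union>u\<in>cls x. \<Union>v\<in>cls y. {u \<oplus>\<^bsub>M\<^esub> v})"
    by (simp add: quotient_module_def set_add_def')
  also have "\<dots> = cls (x \<oplus>\<^bsub>M\<^esub> y)"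
  proof
    show "(\<Union>u\<in>cls x. \<Union>v\<in>cls y. {u \<oplus>\<^bsub>M\<^esub> v}) \<subseteq> cls (x \<oplus>\<^bsub>M\<^esub> y)"
      using x y by (auto simp: cls_def L_add)
    show "cls (x \<oplus>\<^bsub>M\<^esub> y) \<subseteq> (\<Union>u\<in>cls x. \<Union>v\<in>cls y. {u \<oplus>\<^bsub>M\<^esub> v})"
    proof
      fix s assume s: "s \<in> cls (x \<oplus>\<^bsub>M\<^esub> y)"
      then have sM: "s \<in> carrier M" by (simp add: cls_def)
      have "s \<oplus>\<^bsub>M\<^esub> (\<ominus>\<^bsub>M\<^esub> y) \<in> cls x"
        using x y s sM by (auto simp: cls_def L_add L_minus)
      moreover have "s = (s \<oplus>\<^bsub>M\<^esub> (\<ominus>\<^bsub>M\<^esub> y)) \<oplus>\<^bsub>M\<^esub> y"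
        using y sM by (simp add: a_assoc l_neg)
      ultimately show "s \<in> (\<Union>u\<in>cls x. \<Union>v\<in>cls y. {u \<oplus>\<^bsub>M\<^esub> v})"
        using mem_cls[OF y] by blast
    qed
  qed
  finally show ?thesis .
qed

lemma smult_quotient:
  assumes r: "r \<in> R" and x: "x \<in> carrier M"
  shows "r \<odot>\<^bsub>quotient\<^esub> cls x = cls (r \<odot>\<^bsub>M\<^esub> x)"
proof -
  have "N +>\<^bsub>M\<^esub> (r \<odot>\<^bsub>M\<^esub> y) = cls (r \<odot>\<^bsub>M\<^esub> x)" if y: "y \<in> cls x" for y
  proof -
    have yM: "y \<in> carrier M" using y by (simp add: cls_def)
    have "L p (r \<odot>\<^bsub>M\<^esub> y) = L p (r \<odot>\<^bsub>M\<^esub> x)" if "p \<in> P" for p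
      by (rule L_smult_cong[OF r yM x _ that]) (use y in \<open>simp add: cls_def\<close>)
    then show ?thesis
      using r x yM by (simp add: coset_eq_cls cls_eq_iff smult_closed)
  qed
  then show ?thesis using mem_cls[OF x] by (auto simp: quotient_module_def)
qed

sublocale quotient: coordinates R quotient P lift
proof
  show "\<zero>\<^bsub>quotient\<^esub> \<in> carrier quotient"
    by (simp add: zero_quotient carrier_quotient)
  show "lift p \<zero>\<^bsub>quotient\<^esub> = 0" if "p \<in> P" for p
    using that by (simp add: zero_quotient lift_cls L_zero)
  fix X assume "X \<in> carrier quotient"
  then obtain x where X: "X = cls x" and x: "x \<in> carrier M" by (auto simp: carrier_quotient)
  show "r \<odot>\<^bsub>quotient\<^esub> X \<in> carrier quotient" if "r \<in> R" for r
    using smult_closed[OF that x] by (simp add: X smult_quotient[OF that x] carrier_quotient)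
  fix Y assume "Y \<in> carrier quotient"
  then obtain y where Y: "Y = cls y" and y: "y \<in> carrier M" by (auto simp: carrier_quotient)
  show "X \<oplus>\<^bsub>quotient\<^esub> Y \<in> carrier quotient"
    using x y by (simp add: X Y add_quotient carrier_quotient)
  show "lift p (X \<oplus>\<^bsub>quotient\<^esub> Y) = lift p X + lift p Y" if "p \<in> P" for p
    using x y that by (simp add: X Y add_quotient lift_cls L_add)
  show "X = Y" if "\<And>p. p \<in> P \<Longrightarrow> lift p X = lift p Y"
    using x y that by (simp add: X Y cls_eq_iff lift_cls)
qed

lemma lift_smult_cls:
  "p \<in> P \<Longrightarrow> r \<in> R \<Longrightarrow> x \<in> carrier M \<Longrightarrow> lift p (r \<odot>\<^bsub>quotient\<^esub> cls x) = L p (r \<odot>\<^bsub>M\<^esub> x)"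
  by (simp add: smult_quotient lift_cls smult_closed)

end

lemma abelian_group_of_type:
  fixes M :: "('r, 'm::ab_group_add) module"
  assumes "add M = (+)" and "zero M = 0" and "0 \<in> carrier M"
    and "\<And>x y. x \<in> carrier M \<Longrightarrow> y \<in> carrier M \<Longrightarrow> x + y \<in> carrier M"
    and "\<And>x. x \<in> carrier M \<Longrightarrow> - x \<in> carrier M"
  shows "abelian_group M"
  by (rule abelian_groupI) (use assms in \<open>auto simp: add_ac intro: bexI[of _ "- _"]\<close>)

section \<open>Induced representations\<close>

definition tensor_functional ::
  "('s \<Rightarrow> complex) \<Rightarrow> ('m \<Rightarrow> complex) \<Rightarrow> (('s \<times> 'm) \<Rightarrow>\<^sub>0 int) \<Rightarrow> complex" where
  "tensor_functional \<alpha> \<beta> c = (\<Sum>(s, x)\<in>keys c. of_int (lookup c (s, x)) * (\<alpha> s * \<beta> x))"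

lemma tensor_functional_superset:
  assumes "finite A" and "keys c \<subseteq> A"
  shows "tensor_functional \<alpha> \<beta> c = (\<Sum>(s, x)\<in>A. of_int (lookup c (s, x)) * (\<alpha> s * \<beta> x))"
  unfolding tensor_functional_def using assms
  by (intro sum.mono_neutral_left) (auto simp: in_keys_iff)

lemma tensor_functional_add:
  "tensor_functional \<alpha> \<beta> (c + d) = tensor_functional \<alpha> \<beta> c + tensor_functional \<alpha> \<beta> d"
proof -
  let ?A = "keys c \<union> keys d"
  have "keys (c + d) \<subseteq> ?A" by (rule keys_add)
  then show ?thesis
    by (simp add: tensor_functional_superset[of ?A] lookup_add algebra_simps sum.distrib case_prod_beta)
qed

lemma tensor_functional_zero [simp]: "tensor_functional \<alpha> \<beta> 0 = 0"
  by (simp add: tensor_functional_def)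

lemma tensor_functional_uminus: "tensor_functional \<alpha> \<beta> (- c) = - tensor_functional \<alpha> \<beta> c"
  using tensor_functional_add[of \<alpha> \<beta> c "- c"] by (simp add: eq_neg_iff_add_eq_0 add.commute)

lemma tensor_functional_diff:
  "tensor_functional \<alpha> \<beta> (c - d) = tensor_functional \<alpha> \<beta> c - tensor_functional \<alpha> \<beta> d"
  using tensor_functional_add[of \<alpha> \<beta> c "- d"] by (simp add: tensor_functional_uminus)

lemma tensor_functional_sum:
  "tensor_functional \<alpha> \<beta> (\<Sum>i\<in>I. c i) = (\<Sum>i\<in>I. tensor_functional \<alpha> \<beta> (c i))"
  by (induction I rule: infinite_finite_induct) (auto simp: tensor_functional_add)

lemma tensor_functional_single:
  "tensor_functional \<alpha> \<beta> (single (s, x) n) = of_int n * (\<alpha> s * \<beta> x)"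
  by (cases "n = 0") (auto simp: tensor_functional_def)

locale induced_diagonalised_rep = finite_add_subgroup G H + V: diagonalised_rep H V J f \<chi>
  for G H :: "'g::ab_group_add set" and V :: "('g \<Rightarrow>\<^sub>0 complex, 'm) module" and J :: "'j set"
    and f :: "'j \<Rightarrow> 'm \<Rightarrow> complex" and \<chi> :: "'j \<Rightarrow> 'g \<Rightarrow> complex"
begin

abbreviation generators :: "('g \<Rightarrow>\<^sub>0 complex, (('g \<Rightarrow>\<^sub>0 complex) \<times> 'm) \<Rightarrow>\<^sub>0 int) module" where
  "generators \<equiv> tensor_generators (group_alg G) V"

abbreviation relations :: "((('g \<Rightarrow>\<^sub>0 complex) \<times> 'm) \<Rightarrow>\<^sub>0 int) set" where
  "relations \<equiv> tensor_relations (group_alg G) (group_alg H) V"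

abbreviation pure_tensor :: "('g \<Rightarrow>\<^sub>0 complex) \<Rightarrow> 'm \<Rightarrow> (('g \<Rightarrow>\<^sub>0 complex) \<times> 'm) \<Rightarrow>\<^sub>0 int" where
  "pure_tensor s v \<equiv> single (s, v) 1"

definition extension_pairs :: "('j \<times> ('g \<Rightarrow> complex)) set" where
  "extension_pairs = (SIGMA j:J. char_extensions G H (\<chi> j))"

definition tensor_coord :: "'j \<times> ('g \<Rightarrow> complex) \<Rightarrow> ((('g \<Rightarrow>\<^sub>0 complex) \<times> 'm) \<Rightarrow>\<^sub>0 int) \<Rightarrow> complex" where
  "tensor_coord = (\<lambda>(j, \<psi>). tensor_functional (char_eval G \<psi>) (f j))"

lemma tensor_coord_zero [simp]: "tensor_coord p 0 = 0"
  by (simp add: tensor_coord_def split: prod.split)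

lemma tensor_coord_add: "tensor_coord p (c + d) = tensor_coord p c + tensor_coord p d"
  by (simp add: tensor_coord_def tensor_functional_add split: prod.split)

lemma tensor_coord_diff: "tensor_coord p (c - d) = tensor_coord p c - tensor_coord p d"
  by (simp add: tensor_coord_def tensor_functional_diff split: prod.split)

lemma tensor_coord_sum: "tensor_coord p (\<Sum>i\<in>I. c i) = (\<Sum>i\<in>I. tensor_coord p (c i))"
  by (simp add: tensor_coord_def tensor_functional_sum split: prod.split)

lemma tensor_coord_pure_tensor: "tensor_coord (j, \<psi>) (pure_tensor s v) = char_eval G \<psi> s * f j v"
  by (simp add: tensor_coord_def tensor_functional_single)

lemma extension_pairsD:
  assumes "(j, \<psi>) \<in> extension_pairs"
  shows "j \<in> J" and "\<psi> \<in> chars G" and "\<psi> \<in> char_extensions G H (\<chi> j)"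
  using assms by (auto simp: extension_pairs_def char_extensions_def)

lemma finite_extension_pairs: "finite extension_pairs"
  by (auto simp: extension_pairs_def V.finite_J)

lemma group_alg_H_subset_G: "r \<in> group_alg H \<Longrightarrow> r \<in> group_alg G"
  by (rule group_alg_mono[OF H_subset])

lemma generators_simps [simp]:
  "carrier generators = {c. keys c \<subseteq> group_alg G \<times> carrier V}"
  "zero generators = 0" "add generators = (+)"
  by (simp_all add: tensor_generators_def)

lemma pure_tensor_closed: "s \<in> group_alg G \<Longrightarrow> v \<in> carrier V \<Longrightarrow> pure_tensor s v \<in> carrier generators"
  by simp

lemma generators_add_closed:
  "c \<in> carrier generators \<Longrightarrow> d \<in> carrier generators \<Longrightarrow> c + d \<in> carrier generators"
  using keys_add[of c d] by auto

lemma generators_diff_closed: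
  "c \<in> carrier generators \<Longrightarrow> d \<in> carrier generators \<Longrightarrow> c - d \<in> carrier generators"
  using keys_diff[of c d] by auto

lemma generators_sum_closed:
  "(\<And>i. i \<in> I \<Longrightarrow> c i \<in> carrier generators) \<Longrightarrow> sum c I \<in> carrier generators"
proof (induction I rule: infinite_finite_induct)
  case (insert i I)
  then show ?case using generators_add_closed[of "c i" "sum c I"] by simp
qed simp_all

lemma smult_generators_closed:
  assumes "r \<in> group_alg G" and "c \<in> carrier generators"
  shows "r \<odot>\<^bsub>generators\<^esub> c \<in> carrier generators"
proof -
  have "(\<Sum>(s, v)\<in>keys c. single (r * s, v) (lookup c (s, v))) \<in> carrier generators"
    using assms by (intro generators_sum_closed) (auto split: if_splits intro!: G.A.mult_mem)
  then show ?thesis by (simp add: tensor_generators_def)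
qed

lemma tensor_coord_smult:
  assumes p: "(j, \<psi>) \<in> extension_pairs" and r: "r \<in> group_alg G" and c: "c \<in> carrier generators"
  shows "tensor_coord (j, \<psi>) (r \<odot>\<^bsub>generators\<^esub> c) = char_eval G \<psi> r * tensor_coord (j, \<psi>) c"
proof -
  have "char_eval G \<psi> (r * s) = char_eval G \<psi> r * char_eval G \<psi> s" if "(s, v) \<in> keys c" for s v
    using c that by (intro G.char_eval_mult extension_pairsD(2)[OF p] r) auto
  then show ?thesis
    by (auto simp: tensor_generators_def tensor_coord_def tensor_functional_sum tensor_functional_single
        tensor_functional_def[of _ _ c] sum_distrib_left intro!: sum.cong)
qed

lemma relations_in_kernel:
  assumes "c \<in> relations"
  shows "c \<in> carrier generators" and "p \<in> extension_pairs \<Longrightarrow> tensor_coord p c = 0"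
proof -
  note coords = tensor_coord_diff tensor_coord_pure_tensor
  consider (add_left) s s' v where "s \<in> group_alg G" "s' \<in> group_alg G" "v \<in> carrier V"
      "c = pure_tensor (s + s') v - pure_tensor s v - pure_tensor s' v"
    | (add_right) s v v' where "s \<in> group_alg G" "v \<in> carrier V" "v' \<in> carrier V"
      "c = pure_tensor s (v \<oplus>\<^bsub>V\<^esub> v') - pure_tensor s v - pure_tensor s v'"
    | (balanced) s r v where "s \<in> group_alg G" "r \<in> group_alg H" "v \<in> carrier V"
      "c = pure_tensor (s * r) v - pure_tensor s (r \<odot>\<^bsub>V\<^esub> v)"
    using assms by (auto simp: tensor_relations_def Let_def)
  then have "c \<in> carrier generators \<and> (\<forall>p\<in>extension_pairs. tensor_coord p c = 0)"
  proof cases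
    case add_left
    then show ?thesis
      by (auto simp: coords G.char_eval_add distrib_right simp del: generators_simps(1)
          intro!: generators_diff_closed pure_tensor_closed)
  next
    case add_right
    then show ?thesis
      by (auto simp: coords V.f_add extension_pairsD distrib_left simp del: generators_simps(1)
          intro!: generators_diff_closed pure_tensor_closed V.add_closed)
  next
    case balanced
    have "tensor_coord (j, \<psi>) c = 0" if "(j, \<psi>) \<in> extension_pairs" for j \<psi>
      using extension_pairsD[OF that] balanced group_alg_H_subset_G[OF balanced(2)]
      by (simp add: coords G.char_eval_mult V.f_smult char_eval_extension)
    moreover have "c \<in> carrier generators"
      unfolding balanced(4) using balanced(1-3) group_alg_H_subset_G[OF balanced(2)]
      by (intro generators_diff_closed pure_tensor_closed V.smult_closed G.A.mult_mem)
    ultimately show ?thesis by auto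
  qed
  then show "c \<in> carrier generators" and "p \<in> extension_pairs \<Longrightarrow> tensor_coord p c = 0" by auto
qed

lemma group_closure_subset_kernel:
  assumes "c \<in> group_closure relations"
  shows "c \<in> carrier generators" and "p \<in> extension_pairs \<Longrightarrow> tensor_coord p c = 0"
proof -
  from assms have "c \<in> carrier generators \<and> (\<forall>p\<in>extension_pairs. tensor_coord p c = 0)"
  proof induction
    case (base c)
    then show ?case using relations_in_kernel[of c] by auto
  next
    case (diff c d)
    then show ?case using generators_diff_closed[of c d] by (auto simp: tensor_coord_diff)
  qed
  then show "c \<in> carrier generators" and "p \<in> extension_pairs \<Longrightarrow> tensor_coord p c = 0" by auto
qed

subsection \<open>Normal forms of tensors\<close>

definition tensor_eq ::
  "((('g \<Rightarrow>\<^sub>0 complex) \<times> 'm) \<Rightarrow>\<^sub>0 int) \<Rightarrow> ((('g \<Rightarrow>\<^sub>0 complex) \<times> 'm) \<Rightarrow>\<^sub>0 int) \<Rightarrow> bool"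
  (infix "\<approx>" 50) where
  "c \<approx> d \<longleftrightarrow> c - d \<in> group_closure relations"

lemma tensor_eq_refl [simp]: "c \<approx> c"
  by (simp add: tensor_eq_def)

lemma tensor_eq_sym: "c \<approx> d \<Longrightarrow> d \<approx> c"
  unfolding tensor_eq_def by (metis group_closure_minus_iff minus_diff_eq)

lemma tensor_eq_trans [trans]: "c \<approx> d \<Longrightarrow> d \<approx> e \<Longrightarrow> c \<approx> e"
  using group_closure_add[of "c - d" relations "d - e"] by (simp add: tensor_eq_def)

lemma tensor_eq_add: "c \<approx> d \<Longrightarrow> c' \<approx> d' \<Longrightarrow> c + c' \<approx> d + d'"
  using group_closure_add[of "c - d" relations "c' - d'"] by (simp add: tensor_eq_def algebra_simps)

lemma tensor_eq_diff: "c \<approx> d \<Longrightarrow> c' \<approx> d' \<Longrightarrow> c - c' \<approx> d - d'"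
  using group_closure.diff[of "c - d" relations "c' - d'"] by (simp add: tensor_eq_def algebra_simps)

lemma tensor_eq_sum: "(\<And>i. i \<in> I \<Longrightarrow> c i \<approx> d i) \<Longrightarrow> sum c I \<approx> sum d I"
  by (induction I rule: infinite_finite_induct) (auto intro: tensor_eq_add)

lemma tensor_eq_zero_if_double: "c \<approx> c + c \<Longrightarrow> c \<approx> 0"
  by (simp add: tensor_eq_def)

lemma pure_tensor_add_left:
  "s \<in> group_alg G \<Longrightarrow> s' \<in> group_alg G \<Longrightarrow> v \<in> carrier V \<Longrightarrow>
    pure_tensor (s + s') v \<approx> pure_tensor s v + pure_tensor s' v"
  unfolding tensor_eq_def
  by (rule group_closure.base) (auto simp: tensor_relations_def Let_def diff_diff_add[symmetric])

lemma pure_tensor_add_right: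
  "s \<in> group_alg G \<Longrightarrow> v \<in> carrier V \<Longrightarrow> v' \<in> carrier V \<Longrightarrow>
    pure_tensor s (v \<oplus>\<^bsub>V\<^esub> v') \<approx> pure_tensor s v + pure_tensor s v'"
  unfolding tensor_eq_def
  by (rule group_closure.base) (auto simp: tensor_relations_def Let_def diff_diff_add[symmetric])

lemma pure_tensor_balanced:
  "s \<in> group_alg G \<Longrightarrow> r \<in> group_alg H \<Longrightarrow> v \<in> carrier V \<Longrightarrow>
    pure_tensor (s * r) v \<approx> pure_tensor s (r \<odot>\<^bsub>V\<^esub> v)"
  unfolding tensor_eq_def
  by (rule group_closure.base) (auto simp: tensor_relations_def Let_def)

lemma pure_tensor_zero_left: "v \<in> carrier V \<Longrightarrow> pure_tensor 0 v \<approx> 0"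
  using pure_tensor_add_left[of 0 0 v] by (intro tensor_eq_zero_if_double) simp

lemma pure_tensor_zero_right:
  assumes "s \<in> group_alg G"
  shows "pure_tensor s \<zero>\<^bsub>V\<^esub> \<approx> 0"
proof (rule tensor_eq_zero_if_double)
  interpret abelian_monoid V by (rule V.abelian_monoid_M)
  show "pure_tensor s \<zero>\<^bsub>V\<^esub> \<approx> pure_tensor s \<zero>\<^bsub>V\<^esub> + pure_tensor s \<zero>\<^bsub>V\<^esub>"
    using pure_tensor_add_right[OF assms zero_closed zero_closed] by simp
qed

lemma pure_tensor_sum_left:
  assumes v: "v \<in> carrier V" and "finite I" and "\<And>i. i \<in> I \<Longrightarrow> s i \<in> group_alg G"
  shows "pure_tensor (\<Sum>i\<in>I. s i) v \<approx> (\<Sum>i\<in>I. pure_tensor (s i) v)"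
  using assms(2,3)
proof (induction I)
  case empty
  then show ?case using pure_tensor_zero_left[OF v] by simp
next
  case (insert i I)
  have "pure_tensor (s i + (\<Sum>i\<in>I. s i)) v \<approx> pure_tensor (s i) v + pure_tensor (\<Sum>i\<in>I. s i) v"
    using insert v by (intro pure_tensor_add_left) auto
  also have "\<dots> \<approx> pure_tensor (s i) v + (\<Sum>i\<in>I. pure_tensor (s i) v)"
    using insert by (intro tensor_eq_add) auto
  finally show ?case using insert by simp
qed

lemma pure_tensor_sum_right:
  assumes s: "s \<in> group_alg G" and "finite I" and "\<And>i. i \<in> I \<Longrightarrow> v i \<in> carrier V"
  shows "pure_tensor s (\<Oplus>\<^bsub>V\<^esub>i\<in>I. v i) \<approx> (\<Sum>i\<in>I. pure_tensor s (v i))"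
  using assms(2,3)
proof (induction I)
  case empty
  then show ?case
    using pure_tensor_zero_right[OF s] by (simp add: abelian_monoid.finsum_empty[OF V.abelian_monoid_M])
next
  case (insert i I)
  have "(\<Oplus>\<^bsub>V\<^esub>i\<in>insert i I. v i) = v i \<oplus>\<^bsub>V\<^esub> (\<Oplus>\<^bsub>V\<^esub>i\<in>I. v i)"
    using insert by (intro abelian_monoid.finsum_insert[OF V.abelian_monoid_M]) auto
  then have "pure_tensor s (\<Oplus>\<^bsub>V\<^esub>i\<in>insert i I. v i) \<approx> pure_tensor s (v i) + pure_tensor s (\<Oplus>\<^bsub>V\<^esub>i\<in>I. v i)"
    using insert s pure_tensor_add_right[of s "v i"] V.finsum_closed[of I v] by simp
  also have "\<dots> \<approx> pure_tensor s (v i) + (\<Sum>i\<in>I. pure_tensor s (v i))"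
    using insert by (intro tensor_eq_add) auto
  finally show ?case using insert by simp
qed

definition basis_vector :: "'j \<Rightarrow> 'm" where
  "basis_vector j = (SOME v. v \<in> carrier V \<and> (\<forall>k\<in>J. f k v = kronecker k j))"

lemma basis_vector_closed [simp]: "basis_vector j \<in> carrier V"
  and f_basis_vector: "k \<in> J \<Longrightarrow> f k (basis_vector j) = kronecker k j"
proof -
  have "\<exists>v. v \<in> carrier V \<and> (\<forall>k\<in>J. f k v = kronecker k j)"
    using V.f_surj[of "\<lambda>k. kronecker k j"] by blast
  from someI_ex[OF this] show "basis_vector j \<in> carrier V"
    and "k \<in> J \<Longrightarrow> f k (basis_vector j) = kronecker k j"
    unfolding basis_vector_def by auto
qed

lemma basis_vector_expansion:
  assumes v: "v \<in> carrier V"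
  shows "v = (\<Oplus>\<^bsub>V\<^esub>j\<in>J. scalar (f j v) \<odot>\<^bsub>V\<^esub> basis_vector j)"
  using v
proof (rule V.f_eqI)
  show "(\<Oplus>\<^bsub>V\<^esub>j\<in>J. scalar (f j v) \<odot>\<^bsub>V\<^esub> basis_vector j) \<in> carrier V"
    by (intro V.finsum_closed V.smult_closed) simp_all
  fix k assume k: "k \<in> J"
  have "f k (\<Oplus>\<^bsub>V\<^esub>j\<in>J. scalar (f j v) \<odot>\<^bsub>V\<^esub> basis_vector j) = (\<Sum>j\<in>J. kronecker k j * f j v)"
    using k V.chars
    by (simp add: V.f_finsum V.finite_J V.smult_closed V.f_smult f_basis_vector H.char_eval_scalar mult.commute)
  also have "\<dots> = f k v"
    using k V.finite_J by simp
  finally show "f k v = f k (\<Oplus>\<^bsub>V\<^esub>j\<in>J. scalar (f j v) \<odot>\<^bsub>V\<^esub> basis_vector j)" ..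
qed

definition eigentensor :: "'j \<times> ('g \<Rightarrow> complex) \<Rightarrow> complex \<Rightarrow> (('g \<Rightarrow>\<^sub>0 complex) \<times> 'm) \<Rightarrow>\<^sub>0 int" where
  "eigentensor = (\<lambda>(j, \<psi>) z. pure_tensor (scalar z * char_idem G \<psi>) (basis_vector j))"

lemma scalar_char_idem_mem [simp]: "scalar z * char_idem G \<psi> \<in> group_alg G"
  by auto

lemma eigentensor_closed: "eigentensor p z \<in> carrier generators"
  by (cases p) (simp add: eigentensor_def)

lemma eigentensor_add: "eigentensor p (y + z) \<approx> eigentensor p y + eigentensor p z"
  using pure_tensor_add_left[OF scalar_char_idem_mem scalar_char_idem_mem basis_vector_closed]
  by (cases p) (simp add: eigentensor_def single_add distrib_right)

lemma eigentensor_zero: "eigentensor p 0 \<approx> 0"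
  using eigentensor_add[of p 0 0] by (intro tensor_eq_zero_if_double) simp

lemma eigentensor_diff: "eigentensor p (y - z) \<approx> eigentensor p y - eigentensor p z"
proof -
  have "eigentensor p y \<approx> eigentensor p (y - z) + eigentensor p z"
    using eigentensor_add[of p "y - z" z] by simp
  then have "eigentensor p y - eigentensor p z \<approx> eigentensor p (y - z) + eigentensor p z - eigentensor p z"
    by (intro tensor_eq_diff) simp_all
  then have "eigentensor p y - eigentensor p z \<approx> eigentensor p (y - z)" by simp
  then show ?thesis by (rule tensor_eq_sym)
qed

lemma tensor_coord_eigentensor:
  assumes "p \<in> extension_pairs" and "q \<in> extension_pairs"
  shows "tensor_coord p (eigentensor q z) = (if p = q then z else 0)"
  using assms extension_pairsD
  by (cases p, cases q) (auto simp: eigentensor_def tensor_coord_pure_tensor f_basis_vector kronecker_def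
      G.char_eval_mult G.char_eval_scalar G.char_eval_char_idem)

text \<open>
  If \<open>\<psi>\<close> differs from \<open>\<chi> j\<close> at \<open>h\<close>, then a combination of \<open>h\<close> and \<open>1\<close> acts as \<open>1\<close> on the idempotent
  of \<open>\<psi>\<close> and kills \<open>basis_vector j\<close>.
\<close>

lemma eigentensor_vanishes:
  assumes j: "j \<in> J" and \<psi>: "\<psi> \<in> chars G" and "\<psi> \<notin> char_extensions G H (\<chi> j)"
  shows "eigentensor (j, \<psi>) z \<approx> 0"
proof -
  obtain h where h: "h \<in> H" "\<psi> h \<noteq> \<chi> j h"
    using assms by (auto simp: char_extensions_def)
  have hG: "h \<in> G" using h H_subset by auto
  define q where "q = 1 / (\<psi> h - \<chi> j h)"
  define r where "r = single h q - scalar (q * \<chi> j h)"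
  have r: "r \<in> group_alg H" unfolding r_def using h by (intro H.A.diff_mem) auto
  have "char_eval H (\<chi> j) r = 0"
    using h V.chars[OF j] by (simp add: r_def H.char_eval_diff H.char_eval_single H.char_zero)
  then have "r \<odot>\<^bsub>V\<^esub> basis_vector j = \<zero>\<^bsub>V\<^esub>"
    using r by (intro V.f_eqI)
      (auto simp: V.f_smult V.f_zero V.smult_closed V.zero_closed f_basis_vector kronecker_def)
  moreover have "char_eval G \<psi> r = 1"
    using hG \<psi> h by (simp add: r_def G.char_eval_diff G.char_eval_single G.char_zero q_def
        diff_divide_distrib[symmetric])
  then have "r * char_idem G \<psi> = char_idem G \<psi>"
    using G.mult_char_idem[OF \<psi> group_alg_H_subset_G[OF r]] by simp
  then have "scalar z * char_idem G \<psi> = (scalar z * char_idem G \<psi>) * r"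
    by (metis mult.assoc mult.commute)
  ultimately have "eigentensor (j, \<psi>) z \<approx> pure_tensor (scalar z * char_idem G \<psi>) \<zero>\<^bsub>V\<^esub>"
    using pure_tensor_balanced[OF scalar_char_idem_mem r basis_vector_closed, of z \<psi> j]
    by (simp add: eigentensor_def)
  also have "\<dots> \<approx> 0" by (rule pure_tensor_zero_right) simp
  finally show ?thesis .
qed

lemma pure_tensor_basis_vector:
  assumes s: "s \<in> group_alg G"
  shows "pure_tensor s (basis_vector j) \<approx> (\<Sum>\<psi>\<in>chars G. eigentensor (j, \<psi>) (char_eval G \<psi> s))"
proof -
  have "s = (\<Sum>\<psi>\<in>chars G. s * char_idem G \<psi>)"
    by (simp add: sum_distrib_left[symmetric] G.sum_char_idem)
  moreover have "pure_tensor (\<Sum>\<psi>\<in>chars G. s * char_idem G \<psi>) (basis_vector j) \<approx>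
      (\<Sum>\<psi>\<in>chars G. pure_tensor (s * char_idem G \<psi>) (basis_vector j))"
    using s by (intro pure_tensor_sum_left) auto
  ultimately have "pure_tensor s (basis_vector j) \<approx> (\<Sum>\<psi>\<in>chars G. pure_tensor (s * char_idem G \<psi>) (basis_vector j))"
    by (simp only:)
  also have "\<dots> = (\<Sum>\<psi>\<in>chars G. eigentensor (j, \<psi>) (char_eval G \<psi> s))"
    by (intro sum.cong refl) (simp add: eigentensor_def G.mult_char_idem[OF _ s] del: mult_single)
  finally show ?thesis .
qed

lemma pure_tensor_normal_form:
  assumes s: "s \<in> group_alg G" and v: "v \<in> carrier V"
  shows "pure_tensor s v \<approx> (\<Sum>p\<in>extension_pairs. eigentensor p (tensor_coord p (pure_tensor s v)))"
proof -
  let ?z = "\<lambda>p. tensor_coord p (pure_tensor s v)"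
  have "pure_tensor s v \<approx> (\<Sum>j\<in>J. pure_tensor s (scalar (f j v) \<odot>\<^bsub>V\<^esub> basis_vector j))"
    using pure_tensor_sum_right[OF s V.finite_J, of "\<lambda>j. scalar (f j v) \<odot>\<^bsub>V\<^esub> basis_vector j"]
    unfolding basis_vector_expansion[OF v, symmetric] by (simp add: V.smult_closed)
  also have "\<dots> \<approx> (\<Sum>j\<in>J. pure_tensor (s * scalar (f j v)) (basis_vector j))"
    using s by (intro tensor_eq_sum tensor_eq_sym[OF pure_tensor_balanced]) auto
  also have "\<dots> \<approx> (\<Sum>j\<in>J. \<Sum>\<psi>\<in>chars G. eigentensor (j, \<psi>) (char_eval G \<psi> (s * scalar (f j v))))"
    using s by (intro tensor_eq_sum pure_tensor_basis_vector) auto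
  also have "\<dots> = (\<Sum>j\<in>J. \<Sum>\<psi>\<in>chars G. eigentensor (j, \<psi>) (?z (j, \<psi>)))"
    using s by (intro sum.cong refl)
      (simp add: tensor_coord_pure_tensor G.char_eval_mult G.char_eval_scalar)
  also have "\<dots> \<approx> (\<Sum>j\<in>J. \<Sum>\<psi>\<in>chars G.
      if \<psi> \<in> char_extensions G H (\<chi> j) then eigentensor (j, \<psi>) (?z (j, \<psi>)) else 0)"
    by (intro tensor_eq_sum) (auto intro: eigentensor_vanishes)
  also have "\<dots> = (\<Sum>j\<in>J. \<Sum>\<psi>\<in>char_extensions G H (\<chi> j). eigentensor (j, \<psi>) (?z (j, \<psi>)))"
    by (intro sum.cong refl sum.mono_neutral_cong_right) (auto simp: char_extensions_def)
  also have "\<dots> = (\<Sum>p\<in>extension_pairs. eigentensor p (?z p))"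
    by (simp add: extension_pairs_def sum.Sigma V.finite_J case_prod_beta)
  finally show ?thesis .
qed

lemma tensor_normal_form:
  assumes "c \<in> carrier generators"
  shows "c \<approx> (\<Sum>p\<in>extension_pairs. eigentensor p (tensor_coord p c))"
proof -
  have "keys c \<subseteq> group_alg G \<times> carrier V" using assms by simp
  then show ?thesis
  proof (induction rule: frag_induction)
    case zero
    have "(\<Sum>p\<in>extension_pairs. eigentensor p (tensor_coord p 0)) \<approx> (\<Sum>p\<in>extension_pairs. 0)"
      by (rule tensor_eq_sum) (simp add: eigentensor_zero)
    from tensor_eq_sym[OF this] show ?case by simp
  next
    case (one x)
    then show ?case using pure_tensor_normal_form[of "fst x" "snd x"] by auto
  next
    case (diff a b)
    have "a - b \<approx> (\<Sum>p\<in>extension_pairs. eigentensor p (tensor_coord p a) - eigentensor p (tensor_coord p b))"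
      unfolding sum_subtractf using diff by (rule tensor_eq_diff)
    also have "\<dots> \<approx> (\<Sum>p\<in>extension_pairs. eigentensor p (tensor_coord p (a - b)))"
      unfolding tensor_coord_diff by (intro tensor_eq_sum tensor_eq_sym[OF eigentensor_diff])
    finally show ?case .
  qed
qed

lemma group_closure_relations_eq_kernel:
  "group_closure relations = {c \<in> carrier generators. \<forall>p\<in>extension_pairs. tensor_coord p c = 0}"
proof (intro equalityI subsetI)
  fix c assume c: "c \<in> {c \<in> carrier generators. \<forall>p\<in>extension_pairs. tensor_coord p c = 0}"
  then have "c \<approx> (\<Sum>p\<in>extension_pairs. eigentensor p (tensor_coord p c))"
    by (intro tensor_normal_form) simp
  also have "\<dots> \<approx> (\<Sum>p\<in>extension_pairs. 0)"
    by (rule tensor_eq_sum) (use c eigentensor_zero in auto)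
  finally show "c \<in> group_closure relations" by (simp add: tensor_eq_def)
qed (use group_closure_subset_kernel in blast)

sublocale Q: kernel_quotient generators "group_alg G" extension_pairs tensor_coord "group_closure relations"
proof -
  interpret abelian_group generators
    by (rule abelian_group_of_type) (use generators_add_closed in auto)
  show "kernel_quotient generators (group_alg G) extension_pairs tensor_coord (group_closure relations)"
  proof
    show "tensor_coord p (r \<odot>\<^bsub>generators\<^esub> c) = tensor_coord p (r \<odot>\<^bsub>generators\<^esub> d)"
      if "r \<in> group_alg G" "c \<in> carrier generators" "d \<in> carrier generators"
        "\<And>p. p \<in> extension_pairs \<Longrightarrow> tensor_coord p c = tensor_coord p d" "p \<in> extension_pairs" for r c d p
      using that by (cases p) (simp only: tensor_coord_smult)
    show "tensor_coord p (c \<oplus>\<^bsub>generators\<^esub> d) = tensor_coord p c + tensor_coord p d" for p c d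
      by (simp add: tensor_coord_add)
  qed (simp_all only: group_closure_relations_eq_kernel smult_generators_closed)
qed

lemma diagonalised_rep_induced: "diagonalised_rep G (induced_rep G H V) extension_pairs Q.lift snd"
proof -
  have induced: "induced_rep G H V = Q.quotient"
    by (simp add: induced_rep_def extend_scalars_def)
  show ?thesis
    unfolding induced
  proof
    show "finite extension_pairs" by (rule finite_extension_pairs)
    fix p assume p: "p \<in> extension_pairs"
    then show "snd p \<in> chars G" using extension_pairsD(2)[of "fst p" "snd p"] by simp
    fix a X assume a: "a \<in> group_alg G" and "X \<in> carrier Q.quotient"
    then obtain c where c: "c \<in> carrier generators" "X = Q.cls c" unfolding Q.carrier_quotient by blast
    show "Q.lift p (a \<odot>\<^bsub>Q.quotient\<^esub> X) = char_eval G (snd p) a * Q.lift p X"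
      unfolding c(2) Q.lift_smult_cls[OF p a c(1)] Q.lift_cls[OF p c(1)]
      using tensor_coord_smult[of "fst p" "snd p"] p a c(1) by (simp only: prod.collapse)
  next
    fix z :: "'j \<times> ('g \<Rightarrow> complex) \<Rightarrow> complex"
    define c where "c = (\<Sum>p\<in>extension_pairs. eigentensor p (z p))"
    have c: "c \<in> carrier generators"
      unfolding c_def by (intro generators_sum_closed eigentensor_closed)
    have "tensor_coord q c = z q" if "q \<in> extension_pairs" for q
      using that finite_extension_pairs
      by (simp add: c_def tensor_coord_sum tensor_coord_eigentensor)
    then show "\<exists>X\<in>carrier Q.quotient. \<forall>p\<in>extension_pairs. Q.lift p X = z p"
      unfolding Q.carrier_quotient using Q.lift_cls[OF _ c] c by (intro bexI[of _ "Q.cls c"]) auto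
  qed
qed

end

section \<open>Permutation modules\<close>

text \<open>Summing over \<open>keys a\<close> makes the kernel independent of the acting group.\<close>

definition action_kernel :: "('g \<Rightarrow> 'x \<Rightarrow> 'x) \<Rightarrow> ('g \<Rightarrow>\<^sub>0 complex) \<Rightarrow> 'x \<Rightarrow> 'x \<Rightarrow> complex" where
  "action_kernel \<sigma> a y x = (\<Sum>k\<in>keys a. lookup a k * kronecker (\<sigma> k x) y)"

locale finite_action = finite_add_group K
  for K :: "'g::ab_group_add set" +
  fixes X :: "'x set" and \<sigma> :: "'g \<Rightarrow> 'x \<Rightarrow> 'x"
  assumes finite_X: "finite X"
    and act_zero: "x \<in> X \<Longrightarrow> \<sigma> 0 x = x"
    and act_add: "g \<in> K \<Longrightarrow> h \<in> K \<Longrightarrow> x \<in> X \<Longrightarrow> \<sigma> (g + h) x = \<sigma> g (\<sigma> h x)"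
    and act_mem: "g \<in> K \<Longrightarrow> x \<in> X \<Longrightarrow> \<sigma> g x \<in> X"
begin

lemma act_uminus_left: "g \<in> K \<Longrightarrow> x \<in> X \<Longrightarrow> \<sigma> (- g) (\<sigma> g x) = x"
  using act_add[of "- g" g x] uminus_K[of g] by (simp add: act_zero)

lemma act_uminus_right: "g \<in> K \<Longrightarrow> x \<in> X \<Longrightarrow> \<sigma> g (\<sigma> (- g) x) = x"
  using act_add[of g "- g" x] uminus_K[of g] by (simp add: act_zero)

lemma act_eq_iff: "g \<in> K \<Longrightarrow> x \<in> X \<Longrightarrow> y \<in> X \<Longrightarrow> \<sigma> g x = y \<longleftrightarrow> x = \<sigma> (- g) y"
  using act_uminus_left act_uminus_right by metis

lemma act_inj: "g \<in> K \<Longrightarrow> x \<in> X \<Longrightarrow> y \<in> X \<Longrightarrow> \<sigma> g x = \<sigma> g y \<longleftrightarrow> x = y"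
  using act_uminus_left by metis

lemma kronecker_act: "g \<in> K \<Longrightarrow> x \<in> X \<Longrightarrow> y \<in> X \<Longrightarrow> kronecker (\<sigma> g x) (\<sigma> g y) = kronecker x y"
  by (simp add: kronecker_def act_inj)

lemma bij_betw_act: "g \<in> K \<Longrightarrow> bij_betw (\<sigma> g) X X"
  by (rule bij_betw_byWitness[where f' = "\<sigma> (- g)"])
    (auto simp: act_uminus_left act_uminus_right act_mem uminus_K)

lemma sum_act: "g \<in> K \<Longrightarrow> (\<Sum>x\<in>X. F (\<sigma> g x)) = (\<Sum>x\<in>X. F x)"
  by (rule sum.reindex_bij_betw[OF bij_betw_act])

lemma action_kernel_eq:
  assumes "a \<in> group_alg K"
  shows "action_kernel \<sigma> a y x = (\<Sum>k\<in>K. lookup a k * kronecker (\<sigma> k x) y)"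
  unfolding action_kernel_def using assms
  by (intro sum.mono_neutral_left) (auto simp: group_alg_def in_keys_iff)

lemma action_kernel_mult:
  assumes a: "a \<in> group_alg K" and b: "b \<in> group_alg K" and x: "x \<in> X"
  shows "kernel_mult X (action_kernel \<sigma> a) (action_kernel \<sigma> b) y x = action_kernel \<sigma> (a * b) y x"
proof -
  have "kernel_mult X (action_kernel \<sigma> a) (action_kernel \<sigma> b) y x =
      (\<Sum>h\<in>K. lookup b h * (\<Sum>z\<in>X. kronecker (\<sigma> h x) z * action_kernel \<sigma> a y z))"
    unfolding kernel_mult_def action_kernel_eq[OF b] sum_distrib_left
    by (subst sum.swap) (simp add: mult_ac)
  also have "\<dots> = (\<Sum>h\<in>K. lookup b h * (\<Sum>g\<in>K. lookup a g * kronecker (\<sigma> (g + h) x) y))"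
    using x finite_X by (intro sum.cong) (simp_all add: act_mem act_add action_kernel_eq[OF a])
  also have "\<dots> = (\<Sum>g\<in>K. \<Sum>h\<in>K. lookup a g * lookup b (g + h - g) * kronecker (\<sigma> (g + h) x) y)"
    unfolding sum_distrib_left by (subst sum.swap) (simp add: mult_ac)
  also have "\<dots> = (\<Sum>g\<in>K. \<Sum>k\<in>K. lookup a g * lookup b (k - g) * kronecker (\<sigma> k x) y)"
    by (intro sum.cong refl sum_translate)
  also have "\<dots> = (\<Sum>k\<in>K. lookup (a * b) k * kronecker (\<sigma> k x) y)"
    unfolding lookup_group_alg_mult[OF a] sum_distrib_right by (rule sum.swap)
  also have "\<dots> = action_kernel \<sigma> (a * b) y x"
    using a b by (intro action_kernel_eq[symmetric]) auto
  finally show ?thesis .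
qed

lemma action_kernel_commute:
  assumes a: "a \<in> group_alg K" and x: "x \<in> X" and y: "y \<in> X"
    and N: "\<And>k x y. k \<in> K \<Longrightarrow> x \<in> X \<Longrightarrow> y \<in> X \<Longrightarrow> N (\<sigma> k y) (\<sigma> k x) = N y x"
  shows "kernel_mult X (action_kernel \<sigma> a) N y x = kernel_mult X N (action_kernel \<sigma> a) y x"
proof -
  have kronecker: "kronecker (\<sigma> k z) y = (kronecker (\<sigma> (- k) y) z :: complex)" if "k \<in> K" "z \<in> X" for k z
    using act_eq_iff[OF that y] by (auto simp: kronecker_def)
  have "kernel_mult X (action_kernel \<sigma> a) N y x =
      (\<Sum>k\<in>K. lookup a k * (\<Sum>z\<in>X. kronecker (\<sigma> (- k) y) z * N z x))"
    unfolding kernel_mult_def action_kernel_eq[OF a] sum_distrib_left sum_distrib_right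
    by (subst sum.swap) (intro sum.cong refl, simp add: kronecker mult.assoc)
  also have "\<dots> = (\<Sum>k\<in>K. lookup a k * N y (\<sigma> k x))"
  proof (intro sum.cong refl)
    fix k assume k: "k \<in> K"
    have "N (\<sigma> (- k) y) x = N y (\<sigma> k x)"
      using N[OF uminus_K[OF k] act_mem[OF k x] y] by (simp add: act_uminus_left[OF k x])
    then show "lookup a k * (\<Sum>z\<in>X. kronecker (\<sigma> (- k) y) z * N z x) = lookup a k * N y (\<sigma> k x)"
      using finite_X act_mem[OF uminus_K[OF k] y] by simp
  qed
  also have "\<dots> = (\<Sum>k\<in>K. lookup a k * (\<Sum>z\<in>X. kronecker (\<sigma> k x) z * N y z))"
    using finite_X x by (simp add: act_mem)
  also have "\<dots> = kernel_mult X N (action_kernel \<sigma> a) y x"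
    unfolding kernel_mult_def action_kernel_eq[OF a] sum_distrib_left
    by (subst sum.swap) (simp add: mult_ac)
  finally show ?thesis .
qed

lemma char_eval_mean_element_kronecker:
  assumes "x \<in> X" and "y \<in> X"
  shows "char_eval K \<psi> (mean_element K (\<lambda>k. kronecker (\<sigma> k x) y)) = action_kernel \<sigma> (char_idem K \<psi>) x y"
proof -
  have "char_eval K \<psi> (mean_element K (\<lambda>k. kronecker (\<sigma> k x) y)) =
      (\<Sum>k\<in>K. kronecker (\<sigma> (- k) x) y * \<psi> (- k) / of_nat (card K))"
    unfolding char_eval_mean_element sum_divide_distrib by (rule sum_uminus[symmetric])
  also have "\<dots> = (\<Sum>k\<in>K. lookup (char_idem K \<psi>) k * kronecker (\<sigma> k y) x)"
    using assms by (intro sum.cong) (auto simp: lookup_char_idem kronecker_def act_eq_iff)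
  finally show ?thesis by (simp add: action_kernel_eq)
qed

definition orbit_sum :: "('x \<Rightarrow> 'g \<Rightarrow>\<^sub>0 complex) \<Rightarrow> 'x \<Rightarrow> complex" where
  "orbit_sum z x = (\<Sum>k\<in>K. lookup (z (\<sigma> (- k) x)) k)"

lemma sum_mean_element_mult:
  assumes e: "\<And>k x y. k \<in> K \<Longrightarrow> x \<in> X \<Longrightarrow> y \<in> X \<Longrightarrow> e (\<sigma> k x) (\<sigma> k y) = e x y"
    and z: "\<And>y. y \<in> X \<Longrightarrow> z y \<in> group_alg K" and x: "x \<in> X"
  shows "(\<Sum>y\<in>X. mean_element K (\<lambda>k. e (\<sigma> k x) y) * z y) =
    mean_element K (\<lambda>k. \<Sum>y\<in>X. e (\<sigma> k x) y * orbit_sum z y)"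
proof (rule group_alg_eqI)
  show "(\<Sum>y\<in>X. mean_element K (\<lambda>k. e (\<sigma> k x) y) * z y) \<in> group_alg K"
    using z by (intro A.sum_mem A.mult_mem) auto
  fix k assume k: "k \<in> K"
  have shift: "(\<Sum>y\<in>X. e (\<sigma> (k - l) x) y * lookup (z y) l) =
      (\<Sum>y\<in>X. e (\<sigma> k x) y * lookup (z (\<sigma> (- l) y)) l)" if l: "l \<in> K" for l
  proof -
    have "(\<Sum>y\<in>X. e (\<sigma> (k - l) x) y * lookup (z y) l) =
        (\<Sum>y\<in>X. e (\<sigma> (k - l) x) (\<sigma> (- l) y) * lookup (z (\<sigma> (- l) y)) l)"
      by (rule sum_act[OF uminus_K[OF l], symmetric])
    moreover have "\<sigma> (k - l) x = \<sigma> (- l) (\<sigma> k x)"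
      using act_add[OF uminus_K[OF l] k x] by simp
    ultimately show ?thesis
      using k l x by (simp add: e uminus_K act_mem)
  qed
  have "lookup (\<Sum>y\<in>X. mean_element K (\<lambda>k. e (\<sigma> k x) y) * z y) k =
      (\<Sum>y\<in>X. \<Sum>g\<in>K. e (\<sigma> g x) y * lookup (z y) (k - g) / of_nat (card K))"
    by (simp add: lookup_sum lookup_group_alg_mult lookup_mean_element)
  also have "\<dots> = (\<Sum>g\<in>K. \<Sum>y\<in>X. e (\<sigma> g x) y * lookup (z y) (k - g) / of_nat (card K))"
    by (rule sum.swap)
  also have "\<dots> = (\<Sum>l\<in>K. \<Sum>y\<in>X. e (\<sigma> (k - l) x) y * lookup (z y) (k - (k - l)) / of_nat (card K))"
    by (rule sum_reflect[OF k, symmetric])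
  also have "\<dots> = (\<Sum>l\<in>K. \<Sum>y\<in>X. e (\<sigma> k x) y * lookup (z (\<sigma> (- l) y)) l) / of_nat (card K)"
    by (simp add: sum_divide_distrib[symmetric] shift)
  also have "\<dots> = lookup (mean_element K (\<lambda>k. \<Sum>y\<in>X. e (\<sigma> k x) y * orbit_sum z y)) k"
    using k unfolding orbit_sum_def sum_distrib_left
    by (subst sum.swap) (simp add: lookup_mean_element)
  finally show "lookup (\<Sum>y\<in>X. mean_element K (\<lambda>k. e (\<sigma> k x) y) * z y) k =
      lookup (mean_element K (\<lambda>k. \<Sum>y\<in>X. e (\<sigma> k x) y * orbit_sum z y)) k" .
qed simp

end

text \<open>
  \<open>M\<close> is presented as the image of the idempotent kernel \<open>e\<close> on functions on \<open>X\<close>, through the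
  coordinate functionals \<open>L x\<close>. Averaging over \<open>K\<close> turns these complex-linear coordinates into
  \<open>\<complex>[K]\<close>-linear ones.
\<close>

locale permutation_summand = finite_action K X \<sigma> + coordinates "group_alg K" M X L
  for K :: "'g::ab_group_add set" and X :: "'x set" and \<sigma> and M :: "('g \<Rightarrow>\<^sub>0 complex, 'm) module"
    and L :: "'x \<Rightarrow> 'm \<Rightarrow> complex" +
  fixes e :: "'x \<Rightarrow> 'x \<Rightarrow> complex"
  assumes L_smult: "x \<in> X \<Longrightarrow> a \<in> group_alg K \<Longrightarrow> m \<in> carrier M \<Longrightarrow>
      L x (a \<odot>\<^bsub>M\<^esub> m) = (\<Sum>k\<in>K. lookup a k * L (\<sigma> (- k) x) m)"
    and e_equivariant: "k \<in> K \<Longrightarrow> x \<in> X \<Longrightarrow> y \<in> X \<Longrightarrow> e (\<sigma> k x) (\<sigma> k y) = e x y"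
    and e_L: "x \<in> X \<Longrightarrow> m \<in> carrier M \<Longrightarrow> (\<Sum>y\<in>X. e x y * L y m) = L x m"
    and e_surj: "\<exists>m\<in>carrier M. \<forall>x\<in>X. L x m = (\<Sum>y\<in>X. e x y * z y)"
begin

definition mean_coord :: "'x \<Rightarrow> 'm \<Rightarrow> 'g \<Rightarrow>\<^sub>0 complex" where
  "mean_coord x m = mean_element K (\<lambda>k. L (\<sigma> k x) m)"

lemma mean_coord_mem [simp]: "mean_coord x m \<in> group_alg K"
  by (simp add: mean_coord_def)

lemma orbit_sum_mean_coord: "x \<in> X \<Longrightarrow> orbit_sum (\<lambda>x. mean_coord x m) x = L x m"
  by (simp add: orbit_sum_def mean_coord_def lookup_mean_element act_uminus_right)

lemma mean_coord_smult:
  assumes x: "x \<in> X" and a: "a \<in> group_alg K" and m: "m \<in> carrier M"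
  shows "mean_coord x (a \<odot>\<^bsub>M\<^esub> m) = a * mean_coord x m"
proof (rule group_alg_eqI)
  fix k assume k: "k \<in> K"
  have "\<sigma> (- g) (\<sigma> k x) = \<sigma> (k - g) x" if "g \<in> K" for g
    using act_add[OF uminus_K[OF that] k x] by simp
  then show "lookup (mean_coord x (a \<odot>\<^bsub>M\<^esub> m)) k = lookup (a * mean_coord x m) k"
    using k x m by (simp add: mean_coord_def lookup_group_alg_mult[OF a] lookup_mean_element
        L_smult[OF act_mem a] diff_K sum_divide_distrib)
qed (use a in auto)

lemma mean_element_mult_mean_coord:
  assumes x: "x \<in> X" and m: "m \<in> carrier M"
  shows "(\<Sum>y\<in>X. mean_element K (\<lambda>k. e (\<sigma> k x) y) * mean_coord y m) = mean_coord x m"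
proof -
  have "(\<Sum>y\<in>X. mean_element K (\<lambda>k. e (\<sigma> k x) y) * mean_coord y m) =
      mean_element K (\<lambda>k. \<Sum>y\<in>X. e (\<sigma> k x) y * orbit_sum (\<lambda>x. mean_coord x m) y)"
    using x by (intro sum_mean_element_mult e_equivariant) auto
  also have "\<dots> = mean_coord x m"
    unfolding mean_coord_def[of x]
    using m x by (intro mean_element_cong) (simp add: orbit_sum_mean_coord e_L act_mem)
  finally show ?thesis .
qed

lemma mean_coord_surj:
  assumes z: "\<And>x. x \<in> X \<Longrightarrow> z x \<in> group_alg K"
  shows "\<exists>m\<in>carrier M. \<forall>x\<in>X. mean_coord x m = (\<Sum>y\<in>X. mean_element K (\<lambda>k. e (\<sigma> k x) y) * z y)"
proof -
  obtain m where m: "m \<in> carrier M" "\<And>x. x \<in> X \<Longrightarrow> L x m = (\<Sum>y\<in>X. e x y * orbit_sum z y)"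
    using e_surj[of "orbit_sum z"] by blast
  have "mean_coord x m = (\<Sum>y\<in>X. mean_element K (\<lambda>k. e (\<sigma> k x) y) * z y)" if x: "x \<in> X" for x
  proof -
    have "mean_coord x m = mean_element K (\<lambda>k. \<Sum>y\<in>X. e (\<sigma> k x) y * orbit_sum z y)"
      unfolding mean_coord_def using m(2) x by (intro mean_element_cong) (simp add: act_mem)
    also have "\<dots> = (\<Sum>y\<in>X. mean_element K (\<lambda>k. e (\<sigma> k x) y) * z y)"
      using z x by (intro sum_mean_element_mult[symmetric] e_equivariant)
    finally show ?thesis .
  qed
  with m(1) show ?thesis by blast
qed

sublocale projective_coordinates "group_alg K" M X mean_coord "\<lambda>x y. mean_element K (\<lambda>k. e (\<sigma> k x) y)"
proof
  show "mean_coord x \<zero>\<^bsub>M\<^esub> = 0" if "x \<in> X" for x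
    using that by (simp add: mean_coord_def mean_element_def f_zero act_mem)
  fix m assume m: "m \<in> carrier M"
  show "mean_coord x (a \<odot>\<^bsub>M\<^esub> m) = a * mean_coord x m" if "x \<in> X" "a \<in> group_alg K" for a x
    using that m by (intro mean_coord_smult)
  show "(\<Sum>y\<in>X. mean_element K (\<lambda>k. e (\<sigma> k x) y) * mean_coord y m) = mean_coord x m" if "x \<in> X" for x
    using that m by (rule mean_element_mult_mean_coord)
  fix m' assume m': "m' \<in> carrier M"
  show "mean_coord x (m \<oplus>\<^bsub>M\<^esub> m') = mean_coord x m + mean_coord x m'" if "x \<in> X" for x
    using m m' that
    by (intro poly_mapping_eqI)
      (simp add: mean_coord_def lookup_add lookup_mean_element f_add act_mem add_divide_distrib)
  show "m = m'" if eq: "\<And>x. x \<in> X \<Longrightarrow> mean_coord x m = mean_coord x m'"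
    using m m'
  proof (rule f_eqI)
    fix x assume x: "x \<in> X"
    have "orbit_sum (\<lambda>x. mean_coord x m) x = orbit_sum (\<lambda>x. mean_coord x m') x"
      using x by (simp add: orbit_sum_def eq act_mem uminus_K)
    then show "L x m = L x m'" using x by (simp add: orbit_sum_mean_coord)
  qed
next
  show "\<exists>m\<in>carrier M. \<forall>x\<in>X. mean_coord x m = (\<Sum>y\<in>X. mean_element K (\<lambda>k. e (\<sigma> k x) y) * z y)"
    if "\<And>x. x \<in> X \<Longrightarrow> z x \<in> group_alg K" for z
    using that by (rule mean_coord_surj)
qed (auto simp: finite_X zero_closed add_closed smult_closed)

lemma hs_rank_eq_mean_element: "hs_rank (group_alg K) M = mean_element K (\<lambda>k. \<Sum>x\<in>X. e (\<sigma> k x) x)"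
  by (simp add: hs_rank_eq_sum mean_element_sum)

lemma mean_coord_equivariant_endo:
  assumes b: "\<And>k x y. k \<in> K \<Longrightarrow> x \<in> X \<Longrightarrow> y \<in> X \<Longrightarrow> b (\<sigma> k x) (\<sigma> k y) = b x y"
    and L_\<phi>: "\<And>x. x \<in> X \<Longrightarrow> L x (\<phi> m) = (\<Sum>y\<in>X. b x y * L y m)" and x: "x \<in> X"
  shows "mean_coord x (\<phi> m) = (\<Sum>y\<in>X. scalar (b x y) * mean_coord y m)"
proof (rule group_alg_eqI)
  fix k assume k: "k \<in> K"
  have "L (\<sigma> k x) (\<phi> m) = (\<Sum>y\<in>X. b (\<sigma> k x) (\<sigma> k y) * L (\<sigma> k y) m)"
    unfolding L_\<phi>[OF act_mem[OF k x]] by (rule sum_act[OF k, symmetric])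
  also have "\<dots> = (\<Sum>y\<in>X. b x y * L (\<sigma> k y) m)"
    using k x by (simp add: b)
  finally show "lookup (mean_coord x (\<phi> m)) k = lookup (\<Sum>y\<in>X. scalar (b x y) * mean_coord y m) k"
    using k by (simp add: mean_coord_def lookup_mean_element lookup_sum lookup_single_mult sum_divide_distrib)
qed (auto intro!: A.sum_mem A.mult_mem)

end

context finite_action
begin

lemma perm_module_simps [simp]:
  "carrier (perm_module X \<sigma>) = {c. keys c \<subseteq> X}"
  "zero (perm_module X \<sigma>) = 0" "add (perm_module X \<sigma>) = (+)"
  by (simp_all add: perm_module_def)

lemma perm_module_smult:
  assumes a: "a \<in> group_alg K" and c: "keys c \<subseteq> X"
  shows "a \<odot>\<^bsub>perm_module X \<sigma>\<^esub> c = (\<Sum>k\<in>K. \<Sum>x\<in>X. single (\<sigma> k x) (lookup a k * lookup c x))"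
proof -
  have "(\<Sum>x\<in>keys c. single (\<sigma> k x) (lookup a k * lookup c x)) =
      (\<Sum>x\<in>X. single (\<sigma> k x) (lookup a k * lookup c x))" for k
    using c finite_X by (intro sum.mono_neutral_left) (auto simp: in_keys_iff)
  then have "a \<odot>\<^bsub>perm_module X \<sigma>\<^esub> c =
      (\<Sum>k\<in>keys a. \<Sum>x\<in>X. single (\<sigma> k x) (lookup a k * lookup c x))"
    by (simp add: perm_module_def)
  also have "\<dots> = (\<Sum>k\<in>K. \<Sum>x\<in>X. single (\<sigma> k x) (lookup a k * lookup c x))"
    using a by (intro sum.mono_neutral_left) (auto simp: in_keys_iff group_alg_def)
  finally show ?thesis .
qed

lemma perm_module_smult_closed:
  assumes a: "a \<in> group_alg K" and c: "keys c \<subseteq> X"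
  shows "keys (a \<odot>\<^bsub>perm_module X \<sigma>\<^esub> c) \<subseteq> X"
proof -
  have "lookup (a \<odot>\<^bsub>perm_module X \<sigma>\<^esub> c) y = 0" if "y \<notin> X" for y
    unfolding perm_module_smult[OF assms] lookup_sum lookup_single
    using act_mem that by (intro sum.neutral ballI) (auto simp: when_def)
  then show ?thesis by (metis in_keys_iff subsetI)
qed

lemma lookup_perm_module_smult:
  assumes a: "a \<in> group_alg K" and c: "keys c \<subseteq> X" and y: "y \<in> X"
  shows "lookup (a \<odot>\<^bsub>perm_module X \<sigma>\<^esub> c) y = (\<Sum>k\<in>K. lookup a k * lookup c (\<sigma> (- k) y))"
  unfolding perm_module_smult[OF a c] lookup_sum lookup_single
proof (rule sum.cong[OF refl])
  fix k assume k: "k \<in> K"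
  have "(\<Sum>x\<in>X. lookup a k * lookup c x when \<sigma> k x = y) =
      (\<Sum>x\<in>X. kronecker (\<sigma> (- k) y) x * (lookup a k * lookup c x))"
    using act_eq_iff[OF k _ y] by (intro sum.cong) (auto simp: when_def kronecker_def)
  then show "(\<Sum>x\<in>X. lookup a k * lookup c x when \<sigma> k x = y) = lookup a k * lookup c (\<sigma> (- k) y)"
    using finite_X act_mem[OF uminus_K[OF k] y] by simp
qed

lemma chain_with_coefficients:
  obtains c where "keys c \<subseteq> X" and "\<And>x. x \<in> X \<Longrightarrow> lookup c x = (z x :: complex)"
proof
  have lookup: "lookup (\<Sum>x\<in>X. single x (z x)) y = (if y \<in> X then z y else 0)" for y
    by (simp add: lookup_sum lookup_single when_def finite_X)
  show "keys (\<Sum>x\<in>X. single x (z x)) \<subseteq> X"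
    by (auto simp: in_keys_iff lookup split: if_splits)
  show "lookup (\<Sum>x\<in>X. single x (z x)) x = z x" if "x \<in> X" for x
    using that by (simp add: lookup)
qed

lemma permutation_summand_perm_module:
  "permutation_summand K X \<sigma> (perm_module X \<sigma>) (\<lambda>x c. lookup c x) kronecker"
proof
  fix c c' assume c: "c \<in> carrier (perm_module X \<sigma>)" "c' \<in> carrier (perm_module X \<sigma>)"
  show "c \<oplus>\<^bsub>perm_module X \<sigma>\<^esub> c' \<in> carrier (perm_module X \<sigma>)"
    using c keys_add[of c c'] by auto
  assume eq: "\<And>x. x \<in> X \<Longrightarrow> lookup c x = lookup c' x"
  show "c = c'"
  proof (rule poly_mapping_eqI)
    fix x show "lookup c x = lookup c' x"
      using c eq by (cases "x \<in> X") (simp_all add: lookup_eq_0_if_keys_subset)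
  qed
next
  fix z :: "'x \<Rightarrow> complex"
  obtain c where "keys c \<subseteq> X" "\<And>x. x \<in> X \<Longrightarrow> lookup c x = z x"
    using chain_with_coefficients by blast
  then show "\<exists>c\<in>carrier (perm_module X \<sigma>). \<forall>x\<in>X. lookup c x = (\<Sum>y\<in>X. kronecker x y * z y)"
    using finite_X by auto
qed (auto simp: lookup_add lookup_perm_module_smult kronecker_act finite_X
    intro: perm_module_smult_closed[THEN subsetD])

end

lemma finite_add_group_if_group:
  assumes "group (additive_group K)" and "finite K"
  shows "finite_add_group K"
proof -
  interpret group "additive_group K" by fact
  show ?thesis
  proof
    show "0 \<in> K" using one_closed by (simp add: additive_group_def)
    show "g + h \<in> K" if "g \<in> K" "h \<in> K" for g h
      using m_closed[of g h] that by (simp add: additive_group_def)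
    show "- g \<in> K" if "g \<in> K" for g
    proof -
      have "\<exists>h\<in>K. h + g = 0" using l_inv_ex[of g] that by (simp add: additive_group_def)
      then show ?thesis by (metis add_eq_0_iff2)
    qed
  qed fact
qed

lemma finite_action_if_group_action:
  assumes "finite_add_group K" and "finite X" and "group_action (additive_group K) X \<sigma>"
  shows "finite_action K X \<sigma>"
proof -
  interpret finite_add_group K by fact
  interpret act: group_action "additive_group K" X \<sigma> by fact
  show ?thesis
  proof
    show "\<sigma> 0 x = x" if "x \<in> X" for x
      using act.id_eq_one that by (metis additive_group_def monoid.select_convs(2) restrict_apply')
    show "\<sigma> (g + h) x = \<sigma> g (\<sigma> h x)" if "g \<in> K" "h \<in> K" "x \<in> X" for g h x
      using act.composition_rule[of x g h] that by (simp add: additive_group_def)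
    show "\<sigma> g x \<in> X" if "g \<in> K" "x \<in> X" for g x
      using act.element_image[of g x] that by (simp add: additive_group_def)
  qed fact
qed

section \<open>The exponential series\<close>

lemma fps_exp_compose_uminus_const:
  fixes c :: "'a::field_char_0"
  shows "fps_exp 1 oo (- fps_const c * F) = fps_exp (- c) oo F"
proof -
  have "(- fps_const c * F) ^ i = fps_const ((- c) ^ i) * F ^ i" for i
    by (simp only: fps_const_neg power_mult_distrib fps_const_power)
  then show ?thesis unfolding fps_eq_iff fps_compose_nth by simp
qed

lemma fps_exp_sum:
  fixes c :: "'p \<Rightarrow> 'a::field_char_0"
  assumes "finite S" and F_0: "fps_nth F 0 = 0"
  shows "fps_exp (\<Sum>p\<in>S. c p) oo F = (\<Prod>p\<in>S. fps_exp (c p) oo F)"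
  using assms(1)
  by induction (simp_all add: fps_exp_add_mult fps_compose_mult_distrib[OF F_0])

section \<open>Chains of finite graphs\<close>

definition edge_coord :: "('v, 'e) serre_graph \<Rightarrow> 'e \<Rightarrow> ('e \<Rightarrow>\<^sub>0 complex) \<Rightarrow> complex" where
  "edge_coord Y e c = lookup c e - lookup c (opp Y e)"

definition edge_kernel :: "('v, 'e) serre_graph \<Rightarrow> 'e \<Rightarrow> 'e \<Rightarrow> complex" where
  "edge_kernel Y e e' = (kronecker e e' - kronecker (opp Y e) e') / 2"

definition ihara_kernel :: "('v, 'e) serre_graph \<Rightarrow> nat \<Rightarrow> 'v \<Rightarrow> 'v \<Rightarrow> complex" where
  "ihara_kernel Y i x y =
     (if i = 0 then kronecker x y
      else if i = 1 then - of_nat (card {e \<in> edges Y. org Y e = y \<and> ter Y e = x})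
      else if i = 2 then kronecker x y * (of_nat (valency Y x) - 1)
      else 0)"

definition ihara_poly ::
  "('v, 'e) serre_graph \<Rightarrow> 'v \<Rightarrow> 'v \<Rightarrow> ('g::ab_group_add \<Rightarrow>\<^sub>0 complex) poly" where
  "ihara_poly Y x y =
     [:scalar (ihara_kernel Y 0 x y), scalar (ihara_kernel Y 1 x y), scalar (ihara_kernel Y 2 x y):]"

definition ihara_deviation :: "('v, 'e) serre_graph \<Rightarrow> 'v \<Rightarrow> 'v \<Rightarrow> complex fps" where
  "ihara_deviation Y x y = Abs_fps (\<lambda>i. ihara_kernel Y i x y) - kronecker x y"

lemma coeff_ihara_poly: "coeff (ihara_poly Y x y) i = scalar (ihara_kernel Y i x y)"
  by (auto simp: ihara_poly_def ihara_kernel_def coeff_pCons numeral_2_eq_2 split: nat.splits)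

context finite_serre_graph
begin

lemma edge_coord_opp: "e \<in> edges Y \<Longrightarrow> edge_coord Y (opp Y e) c = - edge_coord Y e c"
  by (simp add: edge_coord_def opp_opp)

lemma sum_edge_kernel_mult:
  "e \<in> edges Y \<Longrightarrow> (\<Sum>e'\<in>edges Y. edge_kernel Y e e' * z e') = (z e - z (opp Y e)) / 2"
  using finite_edges opp_closed
  by (simp add: edge_kernel_def left_diff_distrib sum_subtractf flip: sum_divide_distrib)

lemma lookup_orientation_relation:
  fixes z :: "'e \<Rightarrow> complex"
  shows "lookup (\<Sum>e\<in>edges Y. single e (z e) + single (opp Y e) (z e)) e =
    (if e \<in> edges Y then z e + z (opp Y e) else 0)"
proof (cases "e \<in> edges Y")
  case True
  then have "opp Y e' = e \<longleftrightarrow> e' = opp Y e" if "e' \<in> edges Y" for e'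
    using that opp_opp by metis
  then have "(\<Sum>e'\<in>edges Y. z e' when opp Y e' = e) = (\<Sum>e'\<in>edges Y. kronecker (opp Y e) e' * z e')"
    by (intro sum.cong) (auto simp: when_def kronecker_def)
  then show ?thesis
    using True finite_edges opp_closed
    by (simp add: lookup_sum lookup_add lookup_single sum.distrib when_def)
next
  case False
  then have "lookup (single e' (z e') + single (opp Y e') (z e')) e = 0" if "e' \<in> edges Y" for e'
    using that opp_closed by (auto simp: lookup_add lookup_single when_def)
  then show ?thesis using False by (simp add: lookup_sum)
qed

lemma orientation_relations_eq:
  "orientation_relations Y = {c. keys c \<subseteq> edges Y \<and> (\<forall>e\<in>edges Y. edge_coord Y e c = 0)}"
proof (intro equalityI subsetI)
  fix c assume "c \<in> orientation_relations Y"
  then obtain z where c: "c = (\<Sum>e\<in>edges Y. single e (z e) + single (opp Y e) (z e))"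
    by (auto simp: orientation_relations_def)
  show "c \<in> {c. keys c \<subseteq> edges Y \<and> (\<forall>e\<in>edges Y. edge_coord Y e c = 0)}"
    unfolding c edge_coord_def mem_Collect_eq subset_iff in_keys_iff lookup_orientation_relation
    by (simp add: opp_closed opp_opp)
next
  fix c assume c: "c \<in> {c. keys c \<subseteq> edges Y \<and> (\<forall>e\<in>edges Y. edge_coord Y e c = 0)}"
  define z where "z e = lookup c e / 2" for e
  have "c = (\<Sum>e\<in>edges Y. single e (z e) + single (opp Y e) (z e))"
  proof (rule poly_mapping_eqI)
    fix e
    show "lookup c e = lookup (\<Sum>e\<in>edges Y. single e (z e) + single (opp Y e) (z e)) e"
      unfolding lookup_orientation_relation
      using c by (auto simp: z_def edge_coord_def lookup_eq_0_if_keys_subset)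
  qed
  then show "c \<in> orientation_relations Y" by (auto simp: orientation_relations_def)
qed

lemma lookup_adjacency_op:
  assumes c: "keys c \<subseteq> verts Y"
  shows "lookup (adjacency_op Y c) x =
    (\<Sum>y\<in>verts Y. of_nat (card {e \<in> edges Y. org Y e = y \<and> ter Y e = x}) * lookup c y)"
proof -
  have "lookup (adjacency_op Y c) x =
      (\<Sum>y\<in>keys c. \<Sum>e\<in>{e \<in> edges Y. org Y e = y}. if ter Y e = x then lookup c y else 0)"
    by (simp add: adjacency_op_def lookup_sum lookup_single when_def)
  also have "\<dots> = (\<Sum>y\<in>keys c. of_nat (card {e \<in> edges Y. org Y e = y \<and> ter Y e = x}) * lookup c y)"
    using finite_edges by (intro sum.cong) (auto simp: sum.If_cases Int_def conj_assoc)
  also have "\<dots> = (\<Sum>y\<in>verts Y. of_nat (card {e \<in> edges Y. org Y e = y \<and> ter Y e = x}) * lookup c y)"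
    using c finite_verts by (intro sum.mono_neutral_left) (auto simp: in_keys_iff)
  finally show ?thesis .
qed

lemma lookup_valency_op: "lookup (valency_op Y c) x = of_nat (valency Y x) * lookup c x"
  by (auto simp: valency_op_def lookup_sum lookup_single when_def in_keys_iff)

lemma lookup_ihara_coeff:
  assumes c: "keys c \<subseteq> verts Y" and x: "x \<in> verts Y"
  shows "lookup (ihara_coeff Y i c) x = (\<Sum>y\<in>verts Y. ihara_kernel Y i x y * lookup c y)"
  using x finite_verts
  by (simp add: ihara_coeff_def ihara_kernel_def lookup_adjacency_op[OF c] lookup_valency_op
      lookup_minus sum_negf mult.assoc left_diff_distrib)

lemma ihara_coeff_closed:
  assumes c: "keys c \<subseteq> verts Y"
  shows "keys (ihara_coeff Y i c) \<subseteq> verts Y"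
proof -
  have "lookup (ihara_coeff Y i c) x = 0" if x: "x \<notin> verts Y" for x
  proof -
    have "{e \<in> edges Y. org Y e = y \<and> ter Y e = x} = {}" for y using x ter_closed by auto
    then have "lookup (adjacency_op Y c) x = 0"
      by (simp only: lookup_adjacency_op[OF c]) simp
    then show ?thesis
      using lookup_eq_0_if_keys_subset[OF c x] by (simp add: ihara_coeff_def lookup_valency_op lookup_minus)
  qed
  then show ?thesis by (metis in_keys_iff subsetI)
qed

end

section \<open>Group actions on finite graphs\<close>

definition lefschetz_number ::
  "('v, 'e) serre_graph \<Rightarrow> ('g \<Rightarrow> 'v \<Rightarrow> 'v) \<Rightarrow> ('g \<Rightarrow> 'e \<Rightarrow> 'e) \<Rightarrow> 'g \<Rightarrow> complex" where
  "lefschetz_number Y \<sigma>V \<sigma>E k =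
     of_nat (card {x \<in> verts Y. \<sigma>V k x = x}) - of_nat (card {e \<in> edges Y. \<sigma>E k e = e}) / 2"

lemma sum_kronecker_eq_card_fixed_points:
  assumes "finite X"
  shows "(\<Sum>x\<in>X. kronecker (f x) x) = (of_nat (card {x \<in> X. f x = x}) :: 'a::comm_ring_1)"
  using assms by (simp add: kronecker_def sum.If_cases Int_def)

locale finite_graph_action = finite_add_group K + action_without_inversion Y K \<sigma>V \<sigma>E
  for K :: "'g::ab_group_add set" and Y :: "('v, 'e) serre_graph"
    and \<sigma>V :: "'g \<Rightarrow> 'v \<Rightarrow> 'v" and \<sigma>E :: "'g \<Rightarrow> 'e \<Rightarrow> 'e"
begin

sublocale V: finite_action K "verts Y" \<sigma>V
  by (rule finite_action_if_group_action[OF finite_add_group_axioms finite_verts action_verts])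

sublocale E: finite_action K "edges Y" \<sigma>E
  by (rule finite_action_if_group_action[OF finite_add_group_axioms finite_edges action_edges])

sublocale C0: permutation_summand K "verts Y" \<sigma>V "chains0 Y \<sigma>V" "\<lambda>x c. lookup c x" kronecker
  unfolding chains0_def by (rule V.permutation_summand_perm_module)

lemma edge_coord_smult:
  assumes e: "e \<in> edges Y" and "a \<in> group_alg K" and "keys c \<subseteq> edges Y"
  shows "edge_coord Y e (a \<odot>\<^bsub>perm_module (edges Y) \<sigma>E\<^esub> c) =
    (\<Sum>k\<in>K. lookup a k * edge_coord Y (\<sigma>E (- k) e) c)"
  using assms
  by (simp add: edge_coord_def E.lookup_perm_module_smult opp_closed opp_equivariant uminus_K
      right_diff_distrib sum_subtractf)

sublocale Q: kernel_quotient "perm_module (edges Y) \<sigma>E" "group_alg K" "edges Y" "edge_coord Y"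
  "orientation_relations Y"
proof -
  interpret abelian_group "perm_module (edges Y) \<sigma>E"
    by (rule abelian_group_of_type) (auto dest: subsetD[OF keys_add])
  show "kernel_quotient (perm_module (edges Y) \<sigma>E) (group_alg K) (edges Y) (edge_coord Y)
      (orientation_relations Y)"
  proof
    fix a c c' e
    assume a: "a \<in> group_alg K" and c: "c \<in> carrier (perm_module (edges Y) \<sigma>E)"
      and c': "c' \<in> carrier (perm_module (edges Y) \<sigma>E)" and e: "e \<in> edges Y"
    assume "\<And>e. e \<in> edges Y \<Longrightarrow> edge_coord Y e c = edge_coord Y e c'"
    then show "edge_coord Y e (a \<odot>\<^bsub>perm_module (edges Y) \<sigma>E\<^esub> c) =
        edge_coord Y e (a \<odot>\<^bsub>perm_module (edges Y) \<sigma>E\<^esub> c')"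
      using a c c' e by (simp add: edge_coord_smult E.act_mem uminus_K)
  qed (use E.perm_module_smult_closed in
      \<open>auto simp: orientation_relations_eq edge_coord_def lookup_add\<close>)
qed

sublocale C1: permutation_summand K "edges Y" \<sigma>E "chains1 Y \<sigma>E" Q.lift "edge_kernel Y"
  unfolding chains1_def
proof
  fix C assume "C \<in> carrier Q.quotient"
  then obtain c where C: "C = Q.cls c" and c: "c \<in> carrier (perm_module (edges Y) \<sigma>E)"
    by (auto simp: Q.carrier_quotient)
  show "Q.lift e (a \<odot>\<^bsub>Q.quotient\<^esub> C) = (\<Sum>k\<in>K. lookup a k * Q.lift (\<sigma>E (- k) e) C)"
    if "e \<in> edges Y" "a \<in> group_alg K" for e a
    using that c by (simp add: C Q.lift_smult_cls Q.lift_cls edge_coord_smult E.act_mem uminus_K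
        del: E.perm_module_simps(1)) (simp add: edge_coord_smult)
  show "(\<Sum>e'\<in>edges Y. edge_kernel Y e e' * Q.lift e' C) = Q.lift e C" if "e \<in> edges Y" for e
    using that by (simp add: sum_edge_kernel_mult C Q.lift_cls[OF _ c] opp_closed edge_coord_opp)
next
  show "edge_kernel Y (\<sigma>E k e) (\<sigma>E k e') = edge_kernel Y e e'"
    if "k \<in> K" "e \<in> edges Y" "e' \<in> edges Y" for k e e'
    using that by (simp add: edge_kernel_def opp_equivariant opp_closed E.kronecker_act)
  fix z :: "'e \<Rightarrow> complex"
  obtain c where c: "keys c \<subseteq> edges Y" "\<And>e. e \<in> edges Y \<Longrightarrow> lookup c e = z e / 2"
    using E.chain_with_coefficients[of "\<lambda>e. z e / 2"] by blast
  have "Q.lift e (Q.cls c) = (\<Sum>e'\<in>edges Y. edge_kernel Y e e' * z e')" if "e \<in> edges Y" for e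
    using that c(1)
    by (simp add: sum_edge_kernel_mult Q.lift_cls edge_coord_def c(2) opp_closed diff_divide_distrib)
  then show "\<exists>C\<in>carrier Q.quotient. \<forall>e\<in>edges Y. Q.lift e C = (\<Sum>e'\<in>edges Y. edge_kernel Y e e' * z e')"
    using c(1) by (intro bexI[of _ "Q.cls c"]) (auto simp: Q.carrier_quotient)
qed

lemma equiv_euler_char_eq: "equiv_euler_char K Y \<sigma>V \<sigma>E = mean_element K (lefschetz_number Y \<sigma>V \<sigma>E)"
proof -
  have trace_edges: "(\<Sum>e\<in>edges Y. edge_kernel Y (\<sigma>E k e) e) = of_nat (card {e \<in> edges Y. \<sigma>E k e = e}) / 2"
    if k: "k \<in> K" for k
  proof -
    have "opp Y (\<sigma>E k e) \<noteq> e" if e: "e \<in> edges Y" for e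
      using no_inversion[OF k e] opp_opp[OF E.act_mem[OF k e]] by auto
    then have "(\<Sum>e\<in>edges Y. edge_kernel Y (\<sigma>E k e) e) = (\<Sum>e\<in>edges Y. kronecker (\<sigma>E k e) e / 2)"
      by (intro sum.cong) (simp_all add: edge_kernel_def kronecker_def)
    then show ?thesis
      using finite_edges
      by (simp add: sum_kronecker_eq_card_fixed_points flip: sum_divide_distrib)
  qed
  show ?thesis
    unfolding equiv_euler_char_def C0.hs_rank_eq_mean_element C1.hs_rank_eq_mean_element
    using finite_verts
    by (intro poly_mapping_eqI)
      (simp add: lookup_minus lookup_mean_element sum_kronecker_eq_card_fixed_points trace_edges
        lefschetz_number_def diff_divide_distrib)
qed

lemma card_edges_act:
  assumes k: "k \<in> K"
  shows "card {e \<in> edges Y. P (\<sigma>E k e)} = card {e \<in> edges Y. P e}"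
proof (rule bij_betw_same_card)
  show "bij_betw (\<sigma>E k) {e \<in> edges Y. P (\<sigma>E k e)} {e \<in> edges Y. P e}"
    by (rule bij_betw_byWitness[where f' = "\<sigma>E (- k)"])
      (use k in \<open>auto simp: E.act_uminus_left E.act_uminus_right E.act_mem uminus_K\<close>)
qed

lemma ihara_kernel_equivariant:
  assumes k: "k \<in> K" and x: "x \<in> verts Y" and y: "y \<in> verts Y"
  shows "ihara_kernel Y i (\<sigma>V k x) (\<sigma>V k y) = ihara_kernel Y i x y"
proof -
  have org: "org Y (\<sigma>E k e) = \<sigma>V k z \<longleftrightarrow> org Y e = z" if "e \<in> edges Y" "z \<in> verts Y" for e z
    using that k by (simp add: org_equivariant V.act_inj org_closed)
  have ter: "ter Y (\<sigma>E k e) = \<sigma>V k z \<longleftrightarrow> ter Y e = z" if "e \<in> edges Y" "z \<in> verts Y" for e z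
    using that k by (simp add: ter_equivariant V.act_inj ter_closed)
  have "card {e \<in> edges Y. org Y e = \<sigma>V k y \<and> ter Y e = \<sigma>V k x} =
      card {e \<in> edges Y. org Y e = y \<and> ter Y e = x}"
    using card_edges_act[OF k, of "\<lambda>e. org Y e = \<sigma>V k y \<and> ter Y e = \<sigma>V k x"] x y
    by (simp add: org ter cong: conj_cong)
  moreover have "valency Y (\<sigma>V k x) = valency Y x"
    using card_edges_act[OF k, of "\<lambda>e. org Y e = \<sigma>V k x"] x
    by (simp add: valency_def org cong: conj_cong)
  ultimately show ?thesis
    using k x y by (simp add: ihara_kernel_def V.kronecker_act)
qed

subsection \<open>The gamma factor\<close>

lemma fps_const_equiv_euler_char_mem: "fps_const (equiv_euler_char K Y \<sigma>V \<sigma>E) \<in> group_alg_fps K"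
  unfolding group_alg_fps_eq equiv_euler_char_eq by (rule A.fps_const_mem_fps_over) simp

lemma equiv_gamma_mem: "equiv_gamma K Y \<sigma>V \<sigma>E \<in> group_alg_fps K"
proof -
  have "- fps_const (equiv_euler_char K Y \<sigma>V \<sigma>E) * scalar_fps (fps_ln 1 oo - (fps_X ^ 2))
      \<in> group_alg_fps K"
    by (intro AF.mult_mem AF.uminus_mem scalar_fps_mem fps_const_equiv_euler_char_mem)
  then show ?thesis
    using scalar_fps_mem unfolding equiv_gamma_def group_alg_fps_eq
    by (intro A.fps_compose_mem_fps_over)
qed

lemma equiv_gamma_nth_0: "fps_nth (equiv_gamma K Y \<sigma>V \<sigma>E) 0 = 1"
  by (simp add: equiv_gamma_def scalar_fps_def)

lemma char_eval_equiv_gamma: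
  assumes \<psi>: "\<psi> \<in> chars K"
  shows "char_eval_fps K \<psi> (equiv_gamma K Y \<sigma>V \<sigma>E) =
    fps_exp (- char_eval K \<psi> (mean_element K (lefschetz_number Y \<sigma>V \<sigma>E))) oo (fps_ln 1 oo - (fps_X ^ 2))"
proof -
  note const = AF.uminus_mem[OF fps_const_equiv_euler_char_mem]
  have "char_eval_fps K \<psi> (equiv_gamma K Y \<sigma>V \<sigma>E) =
      fps_exp 1 oo (- fps_const (char_eval K \<psi> (equiv_euler_char K Y \<sigma>V \<sigma>E)) * (fps_ln 1 oo - (fps_X ^ 2)))"
    unfolding equiv_gamma_def using \<psi> const AF.mult_mem[OF const scalar_fps_mem]
    by (simp only: char_eval_fps_compose char_eval_fps_mult scalar_fps_mem char_eval_fps_scalar_fps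
        char_eval_fps_uminus char_eval_fps_const)
  then show ?thesis
    unfolding fps_exp_compose_uminus_const equiv_euler_char_eq .
qed

subsection \<open>The eta factor\<close>

definition eta_kernel :: "'v \<Rightarrow> 'v \<Rightarrow> ('g \<Rightarrow>\<^sub>0 complex) poly" where
  "eta_kernel x y = kronecker x y +
     kernel_mult (verts Y) (\<lambda>x y. ihara_poly Y x y - kronecker x y)
       (\<lambda>x y. [:mean_element K (\<lambda>k. kronecker (\<sigma>V k x) y):]) x y"

lemma ihara_poly_mem: "ihara_poly Y x y \<in> group_alg_poly K"
  by (simp add: group_alg_poly_def coeff_ihara_poly)

lemma kronecker_mem: "kronecker x y \<in> group_alg_poly K"
  by (simp add: kronecker_def)

lemma equiv_eta_eq: "equiv_eta K Y \<sigma>V = det_on (verts Y) eta_kernel"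
  unfolding equiv_eta_def eta_kernel_def[abs_def] group_alg_poly_eq
proof (rule C0.proj_det_series_endo)
  show "ihara_coeff Y i c \<in> carrier (chains0 Y \<sigma>V)" if "c \<in> carrier (chains0 Y \<sigma>V)" for i c
    using that ihara_coeff_closed by (simp add: chains0_def)
  show "ihara_poly Y x y \<in> polys_over (group_alg K)" for x y
    using ihara_poly_mem by (simp add: group_alg_poly_eq)
  show "C0.mean_coord x (ihara_coeff Y i c) =
      (\<Sum>y\<in>verts Y. coeff (ihara_poly Y x y) i * C0.mean_coord y c)"
    if "x \<in> verts Y" "c \<in> carrier (chains0 Y \<sigma>V)" for i x c
    unfolding coeff_ihara_poly using that
    by (intro C0.mean_coord_equivariant_endo ihara_kernel_equivariant lookup_ihara_coeff)
      (auto simp: chains0_def)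
qed

lemma eta_kernel_mem: "eta_kernel x y \<in> group_alg_poly K"
proof -
  have "[:mean_element K w:] \<in> group_alg_poly K" for w
    unfolding group_alg_poly_eq by (rule A.const_poly_mem_polys_over) simp
  then show ?thesis
    unfolding eta_kernel_def kernel_mult_def
    by (intro AP.add_mem AP.sum_mem AP.mult_mem AP.diff_mem ihara_poly_mem kronecker_mem)
qed

lemma equiv_eta_mem: "fps_of_poly (equiv_eta K Y \<sigma>V) \<in> group_alg_fps K"
  unfolding equiv_eta_eq by (intro fps_of_poly_mem AP.det_on_mem finite_verts eta_kernel_mem)

lemma coeff_0_equiv_eta: "coeff (equiv_eta K Y \<sigma>V) 0 = 1"
proof -
  have ihara: "coeff (ihara_poly Y x y) 0 = coeff (kronecker x y) 0" for x y
    by (simp add: coeff_ihara_poly ihara_kernel_def kronecker_def)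
  have "coeff (eta_kernel x y) 0 = kronecker x y" for x y
    by (simp add: eta_kernel_def kernel_mult_def coeff_sum coeff_mult_0 ihara)
      (simp add: kronecker_def)
  then have "coeff (equiv_eta K Y \<sigma>V) 0 = det_on (verts Y) kronecker"
    unfolding equiv_eta_eq using finite_verts
    by (subst AP.det_on_hom) (simp_all add: coeff_mult_0 eta_kernel_mem)
  then show ?thesis using finite_verts by (simp add: det_on_kronecker)
qed

definition isotypic_kernel :: "('g \<Rightarrow> complex) \<Rightarrow> 'v \<Rightarrow> 'v \<Rightarrow> complex fps" where
  "isotypic_kernel \<psi> x y = fps_const (action_kernel \<sigma>V (char_idem K \<psi>) x y)"

lemma char_eval_eta_kernel:
  assumes \<psi>: "\<psi> \<in> chars K" and y: "y \<in> verts Y"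
  shows "char_eval_fps K \<psi> (fps_of_poly (eta_kernel x y)) =
    kronecker x y + kernel_mult (verts Y) (ihara_deviation Y) (isotypic_kernel \<psi>) x y"
proof -
  have kronecker: "char_eval_fps K \<psi> (fps_of_poly (kronecker x z)) = kronecker x z" for z
    using \<psi> by (simp add: kronecker_def char_eval_fps_one) (simp add: fps_eq_iff)
  have "char_eval_fps K \<psi> (fps_of_poly (ihara_poly Y x z - kronecker x z)) = ihara_deviation Y x z" for z
    unfolding ihara_deviation_def kronecker[symmetric] using \<psi>
    by (simp add: fps_eq_iff char_eval_diff coeff_ihara_poly char_eval_scalar)
  moreover have "fps_of_poly (ihara_poly Y x z - kronecker x z) \<in> group_alg_fps K" for z
    by (intro fps_of_poly_mem AP.diff_mem ihara_poly_mem kronecker_mem)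
  moreover have "fps_const (mean_element K w) \<in> group_alg_fps K" for w
    unfolding group_alg_fps_eq by (rule A.fps_const_mem_fps_over) simp
  ultimately show ?thesis
    unfolding eta_kernel_def kernel_mult_def isotypic_kernel_def fps_of_poly_add fps_of_poly_sum
      fps_of_poly_mult fps_of_poly_const char_eval_fps_add char_eval_fps_sum kronecker
    using \<psi> y by (simp add: char_eval_fps_mult char_eval_fps_const V.char_eval_mean_element_kronecker)
qed

lemma char_eval_equiv_eta:
  assumes \<psi>: "\<psi> \<in> chars K"
  shows "char_eval_fps K \<psi> (fps_of_poly (equiv_eta K Y \<sigma>V)) = det_on (verts Y)
    (\<lambda>x y. kronecker x y + kernel_mult (verts Y) (ihara_deviation Y) (isotypic_kernel \<psi>) x y)"
proof -
  have "char_eval_fps K \<psi> (fps_of_poly (equiv_eta K Y \<sigma>V)) =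
      det_on (verts Y) (\<lambda>x y. char_eval_fps K \<psi> (fps_of_poly (eta_kernel x y)))"
    unfolding equiv_eta_eq using \<psi> finite_verts
    by (intro AP.det_on_hom) (simp_all add: fps_of_poly_add fps_of_poly_mult char_eval_fps_add
        char_eval_fps_mult fps_of_poly_mem char_eval_fps_one eta_kernel_mem)
  then show ?thesis
    using finite_verts by (simp add: char_eval_eta_kernel[OF \<psi>] cong: det_on_cong)
qed

lemma isotypic_kernel_commute:
  assumes "x \<in> verts Y" and "y \<in> verts Y"
  shows "kernel_mult (verts Y) (isotypic_kernel \<psi>) (ihara_deviation Y) x y =
    kernel_mult (verts Y) (ihara_deviation Y) (isotypic_kernel \<psi>) x y"
proof (rule fps_ext)
  fix i
  let ?N = "\<lambda>x y. fps_nth (ihara_deviation Y x y) i"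
  have "kernel_mult (verts Y) (action_kernel \<sigma>V (char_idem K \<psi>)) ?N x y =
      kernel_mult (verts Y) ?N (action_kernel \<sigma>V (char_idem K \<psi>)) x y"
    using assms by (intro V.action_kernel_commute)
      (simp_all add: ihara_deviation_def ihara_kernel_equivariant V.kronecker_act)
  then show "fps_nth (kernel_mult (verts Y) (isotypic_kernel \<psi>) (ihara_deviation Y) x y) i =
      fps_nth (kernel_mult (verts Y) (ihara_deviation Y) (isotypic_kernel \<psi>) x y) i"
    by (simp add: kernel_mult_def isotypic_kernel_def fps_sum_nth)
qed

lemma isotypic_kernel_orthogonal:
  assumes "\<psi> \<in> chars K" and "\<phi> \<in> chars K" and "\<psi> \<noteq> \<phi>" and y: "y \<in> verts Y"
  shows "kernel_mult (verts Y) (isotypic_kernel \<psi>) (isotypic_kernel \<phi>) x y = 0"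
proof -
  have "kernel_mult (verts Y) (isotypic_kernel \<psi>) (isotypic_kernel \<phi>) x y =
      fps_const (action_kernel \<sigma>V (char_idem K \<psi> * char_idem K \<phi>) x y)"
    unfolding V.action_kernel_mult[OF char_idem_mem char_idem_mem y, symmetric]
    by (simp add: fps_eq_iff kernel_mult_def isotypic_kernel_def fps_sum_nth)
  then show ?thesis using assms by (simp add: char_idem_orthogonal action_kernel_def)
qed

subsection \<open>The equivariant theta function\<close>

lemma equiv_theta_mem: "equiv_theta K Y \<sigma>V \<sigma>E \<in> group_alg_fps K"
  and equiv_theta_inverse:
    "equiv_gamma K Y \<sigma>V \<sigma>E * fps_of_poly (equiv_eta K Y \<sigma>V) * equiv_theta K Y \<sigma>V \<sigma>E = 1"
proof -
  have "equiv_gamma K Y \<sigma>V \<sigma>E * fps_of_poly (equiv_eta K Y \<sigma>V) \<in> fps_over (group_alg K)"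
    using AF.mult_mem[OF equiv_gamma_mem equiv_eta_mem] by (simp add: group_alg_fps_eq)
  moreover have "fps_nth (equiv_gamma K Y \<sigma>V \<sigma>E * fps_of_poly (equiv_eta K Y \<sigma>V)) 0 = 1"
    by (simp add: equiv_gamma_nth_0 coeff_0_equiv_eta)
  ultimately show "equiv_theta K Y \<sigma>V \<sigma>E \<in> group_alg_fps K"
    "equiv_gamma K Y \<sigma>V \<sigma>E * fps_of_poly (equiv_eta K Y \<sigma>V) * equiv_theta K Y \<sigma>V \<sigma>E = 1"
    unfolding equiv_theta_def group_alg_fps_eq by (rule A.inv_ring_on_fps_over)+
qed

lemma char_eval_equiv_theta:
  assumes \<psi>: "\<psi> \<in> chars K"
  shows "char_eval_fps K \<psi> (equiv_gamma K Y \<sigma>V \<sigma>E) * char_eval_fps K \<psi> (fps_of_poly (equiv_eta K Y \<sigma>V)) *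
    char_eval_fps K \<psi> (equiv_theta K Y \<sigma>V \<sigma>E) = 1"
  using AF.mult_mem[OF equiv_gamma_mem equiv_eta_mem]
  by (simp add: char_eval_fps_mult[OF \<psi>, symmetric] equiv_gamma_mem equiv_eta_mem equiv_theta_mem
      equiv_theta_inverse char_eval_fps_one[OF \<psi>])

end

section \<open>Restriction to a subgroup\<close>

lemma (in finite_add_subgroup) sigma_rep_induced:
  fixes V :: "('g \<Rightarrow>\<^sub>0 complex, 'm) module"
  assumes rep: "artin_rep H V"
    and F: "F \<in> group_alg_fps G" and F': "F' \<in> group_alg_fps H"
    and prod_eq: "\<And>\<chi>. \<chi> \<in> chars H \<Longrightarrow>
      (\<Prod>\<psi>\<in>char_extensions G H \<chi>. char_eval_fps G \<psi> F) = char_eval_fps H \<chi> F'"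
  shows "sigma_rep (induced_rep G H V) F = sigma_rep V F'"
proof -
  obtain J :: "'m set" and f \<chi> where "diagonalised_rep H V J f \<chi>"
    using artin_rep_diagonalised[OF H.finite_add_group_axioms rep] by blast
  then interpret V: diagonalised_rep H V J f \<chi> .
  interpret I: induced_diagonalised_rep G H V J f \<chi> ..
  interpret Ind: diagonalised_rep G "induced_rep G H V" I.extension_pairs I.Q.lift snd
    by (rule I.diagonalised_rep_induced)
  have "sigma_rep (induced_rep G H V) F = (\<Prod>p\<in>I.extension_pairs. char_eval_fps G (snd p) F)"
    by (rule Ind.sigma_rep_eq_prod[OF F])
  also have "\<dots> = (\<Prod>j\<in>J. \<Prod>\<psi>\<in>char_extensions G H (\<chi> j). char_eval_fps G \<psi> F)"
    unfolding I.extension_pairs_def using V.finite_J by (simp add: prod.Sigma case_prod_beta)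
  also have "\<dots> = (\<Prod>j\<in>J. char_eval_fps H (\<chi> j) F')"
    using V.chars by (intro prod.cong) (auto simp: prod_eq)
  also have "\<dots> = sigma_rep V F'"
    by (rule V.sigma_rep_eq_prod[OF F', symmetric])
  finally show ?thesis .
qed

locale restricted_graph_action = finite_add_subgroup G H +
  GA: finite_graph_action G Y \<sigma>V \<sigma>E + HA: finite_graph_action H Y \<sigma>V \<sigma>E
  for G H :: "'g::ab_group_add set" and Y :: "('v, 'e) serre_graph"
    and \<sigma>V :: "'g \<Rightarrow> 'v \<Rightarrow> 'v" and \<sigma>E :: "'g \<Rightarrow> 'e \<Rightarrow> 'e"
begin

lemma prod_char_eval_equiv_gamma:
  assumes \<chi>: "\<chi> \<in> chars H"
  shows "(\<Prod>\<psi>\<in>char_extensions G H \<chi>. char_eval_fps G \<psi> (equiv_gamma G Y \<sigma>V \<sigma>E)) =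
    char_eval_fps H \<chi> (equiv_gamma H Y \<sigma>V \<sigma>E)"
proof -
  let ?log = "fps_ln 1 oo - (fps_X ^ 2) :: complex fps"
  let ?\<Lambda> = "lefschetz_number Y \<sigma>V \<sigma>E"
  have "(\<Prod>\<psi>\<in>char_extensions G H \<chi>. char_eval_fps G \<psi> (equiv_gamma G Y \<sigma>V \<sigma>E)) =
      (\<Prod>\<psi>\<in>char_extensions G H \<chi>. fps_exp (- char_eval G \<psi> (mean_element G ?\<Lambda>)) oo ?log)"
    by (intro prod.cong) (auto simp: GA.char_eval_equiv_gamma char_extensionsD)
  also have "\<dots> = fps_exp (\<Sum>\<psi>\<in>char_extensions G H \<chi>. - char_eval G \<psi> (mean_element G ?\<Lambda>)) oo ?log"
    by (rule fps_exp_sum[symmetric]) auto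
  also have "\<dots> = char_eval_fps H \<chi> (equiv_gamma H Y \<sigma>V \<sigma>E)"
    by (simp add: sum_negf sum_char_eval_mean_element[OF \<chi>] HA.char_eval_equiv_gamma[OF \<chi>])
  finally show ?thesis .
qed

lemma sum_isotypic_kernel:
  assumes \<chi>: "\<chi> \<in> chars H"
  shows "(\<Sum>\<psi>\<in>char_extensions G H \<chi>. GA.isotypic_kernel \<psi> x y) = HA.isotypic_kernel \<chi> x y"
proof -
  have "action_kernel \<sigma>V (char_idem H \<chi>) x y =
      (\<Sum>k\<in>G. lookup (\<Sum>\<psi>\<in>char_extensions G H \<chi>. char_idem G \<psi>) k * kronecker (\<sigma>V k y) x)"
    unfolding sum_char_idem_extensions[OF \<chi>]
    by (intro GA.V.action_kernel_eq group_alg_mono[OF H_subset]) simp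
  also have "\<dots> = (\<Sum>\<psi>\<in>char_extensions G H \<chi>. action_kernel \<sigma>V (char_idem G \<psi>) x y)"
    unfolding lookup_sum sum_distrib_right
    by (subst sum.swap) (simp add: GA.V.action_kernel_eq)
  finally show ?thesis
    by (simp add: fps_eq_iff fps_sum_nth GA.isotypic_kernel_def HA.isotypic_kernel_def)
qed

lemma prod_char_eval_equiv_eta:
  assumes \<chi>: "\<chi> \<in> chars H"
  shows "(\<Prod>\<psi>\<in>char_extensions G H \<chi>. char_eval_fps G \<psi> (fps_of_poly (equiv_eta G Y \<sigma>V))) =
    char_eval_fps H \<chi> (fps_of_poly (equiv_eta H Y \<sigma>V))"
proof -
  let ?det = "\<lambda>P. det_on (verts Y) (\<lambda>x y. kronecker x y + kernel_mult (verts Y) (ihara_deviation Y) P x y)"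
  have "(\<Prod>\<psi>\<in>char_extensions G H \<chi>. char_eval_fps G \<psi> (fps_of_poly (equiv_eta G Y \<sigma>V))) =
      (\<Prod>\<psi>\<in>char_extensions G H \<chi>. ?det (GA.isotypic_kernel \<psi>))"
    by (intro prod.cong) (auto simp: GA.char_eval_equiv_eta char_extensionsD)
  also have "\<dots> = ?det (\<lambda>x y. \<Sum>\<psi>\<in>char_extensions G H \<chi>. GA.isotypic_kernel \<psi> x y)"
    by (rule det_on_one_plus_orthogonal_sum[symmetric])
      (auto simp: GA.finite_verts GA.isotypic_kernel_commute GA.isotypic_kernel_orthogonal char_extensionsD)
  also have "\<dots> = ?det (HA.isotypic_kernel \<chi>)"
    by (simp only: sum_isotypic_kernel[OF \<chi>])
  also have "\<dots> = char_eval_fps H \<chi> (fps_of_poly (equiv_eta H Y \<sigma>V))"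
    by (rule HA.char_eval_equiv_eta[OF \<chi>, symmetric])
  finally show ?thesis .
qed

lemma prod_char_eval_equiv_theta:
  assumes \<chi>: "\<chi> \<in> chars H"
  shows "(\<Prod>\<psi>\<in>char_extensions G H \<chi>. char_eval_fps G \<psi> (equiv_theta G Y \<sigma>V \<sigma>E)) =
    char_eval_fps H \<chi> (equiv_theta H Y \<sigma>V \<sigma>E)"
proof -
  let ?\<gamma>\<eta> = "char_eval_fps H \<chi> (equiv_gamma H Y \<sigma>V \<sigma>E) * char_eval_fps H \<chi> (fps_of_poly (equiv_eta H Y \<sigma>V))"
  let ?\<theta> = "\<Prod>\<psi>\<in>char_extensions G H \<chi>. char_eval_fps G \<psi> (equiv_theta G Y \<sigma>V \<sigma>E)"
  have "?\<gamma>\<eta> * ?\<theta> = (\<Prod>\<psi>\<in>char_extensions G H \<chi>. char_eval_fps G \<psi> (equiv_gamma G Y \<sigma>V \<sigma>E) *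
      char_eval_fps G \<psi> (fps_of_poly (equiv_eta G Y \<sigma>V)) * char_eval_fps G \<psi> (equiv_theta G Y \<sigma>V \<sigma>E))"
    unfolding prod.distrib prod_char_eval_equiv_gamma[OF \<chi>] prod_char_eval_equiv_eta[OF \<chi>] ..
  also have "\<dots> = 1"
    by (intro prod.neutral) (auto simp: GA.char_eval_equiv_theta char_extensionsD)
  finally have "?\<gamma>\<eta> * ?\<theta> = ?\<gamma>\<eta> * char_eval_fps H \<chi> (equiv_theta H Y \<sigma>V \<sigma>E)"
    by (simp add: HA.char_eval_equiv_theta[OF \<chi>])
  moreover have "?\<gamma>\<eta> \<noteq> 0" using HA.char_eval_equiv_theta[OF \<chi>] by auto
  ultimately show ?thesis by (metis mult_cancel_left)
qed

end

lemma restricted_graph_action_if_subgroup: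
  assumes "group (additive_group G)" and "finite G"
    and "action_without_inversion Y G \<sigma>V \<sigma>E" and H: "subgroup H (additive_group G)"
  shows "restricted_graph_action G H Y \<sigma>V \<sigma>E"
proof -
  interpret group "additive_group G" by fact
  interpret GA: action_without_inversion Y G \<sigma>V \<sigma>E by fact
  have subset: "H \<subseteq> G" using subgroup.subset[OF H] by (simp add: additive_group_def)
  have restrict: "additive_group G\<lparr>carrier := H\<rparr> = additive_group H" by (simp add: additive_group_def)
  interpret G: finite_add_group G
    using assms(1,2) by (rule finite_add_group_if_group)
  interpret H: finite_add_group H
    using subgroup_imp_group[OF H] finite_subset[OF subset assms(2)]
    unfolding restrict by (rule finite_add_group_if_group)
  have "action_without_inversion Y H \<sigma>V \<sigma>E"
  proof (intro action_without_inversion.intro action_without_inversion_axioms.intro)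
    show "finite_serre_graph Y" by (rule GA.finite_serre_graph_axioms)
    show "group_action (additive_group H) (verts Y) \<sigma>V"
      using group_action.induced_action[OF GA.action_verts H] by (simp add: restrict)
    show "group_action (additive_group H) (edges Y) \<sigma>E"
      using group_action.induced_action[OF GA.action_edges H] by (simp add: restrict)
  qed (simp_all add: subsetD[OF subset] GA.org_equivariant GA.ter_equivariant GA.opp_equivariant
      GA.no_inversion)
  then interpret HA: action_without_inversion Y H \<sigma>V \<sigma>E .
  show ?thesis by unfold_locales (rule subset)
qed

theorem theorem5p15:
  fixes Y :: "('v, 'e) serre_graph"
    and G H :: "'g::ab_group_add set"
    and \<sigma>V :: "'g \<Rightarrow> 'v \<Rightarrow> 'v" and \<sigma>E :: "'g \<Rightarrow> 'e \<Rightarrow> 'e"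
    and V :: "('g \<Rightarrow>\<^sub>0 complex, 'm) module"
  assumes "comm_group (additive_group G)" and "finite G"
    and "action_without_inversion Y G \<sigma>V \<sigma>E"
    and "subgroup H (additive_group G)"
    and "artin_rep H V"
  shows "c_fun G Y \<sigma>V \<sigma>E (induced_rep G H V) = c_fun H Y \<sigma>V \<sigma>E V \<and>
         h_fun G Y \<sigma>V (induced_rep G H V) = h_fun H Y \<sigma>V V \<and>
         L_fun G Y \<sigma>V \<sigma>E (induced_rep G H V) = L_fun H Y \<sigma>V \<sigma>E V"
proof -
  interpret restricted_graph_action G H Y \<sigma>V \<sigma>E
    using comm_group.axioms(2)[OF assms(1)] assms(2-4) by (rule restricted_graph_action_if_subgroup)
  show ?thesis
    unfolding c_fun_def h_fun_def L_fun_def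
    using sigma_rep_induced[OF assms(5) GA.equiv_gamma_mem HA.equiv_gamma_mem prod_char_eval_equiv_gamma]
      sigma_rep_induced[OF assms(5) GA.equiv_eta_mem HA.equiv_eta_mem prod_char_eval_equiv_eta]
      sigma_rep_induced[OF assms(5) GA.equiv_theta_mem HA.equiv_theta_mem prod_char_eval_equiv_theta]
    by blast
qed

end
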